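(* Assume $n=2$ and $\omega=0$. 1. If $f(0)=f(1)$, then as $m\to\infty$ $$\lambda_m^\pm=\frac{\sqrt{\mu_m}}{\sqrt{f(0)}}+\mathcal O\big(\sqrt{\mu_m}\,e^{-\sqrt{\mu_m}}\big),\qquad d_m=\frac{2}{\sqrt{f(0)}}\,\frac{\sqrt{\mu_m}}{\sinh(\sqrt{\mu_m})}.$$ Moreover, there exist constants $C>0$ and $m_0>0$ such that for all $m\ge m_0$ and all $(x,\theta)\in[0,1]\times K$ $$|\varphi_m^\pm(x,\theta)|\le C\left(e^{-\sqrt{\mu_m}\,x}+e^{-\sqrt{\mu_m}(1-x)}\right).$$ 2. If $f(0)\neq f(1)$, then as $m\to+\infty$ $$\lambda_m^+=\max\Big(\tfrac1{\sqrt{f(0)}},\tfrac1{\sqrt{f(1)}}\Big)\sqrt{\mu_m}+\mathcal O\big(\sqrt{\mu_m}e^{-\sqrt{\mu_m}}\big),$$ $$\lambda_m^-=\min\Big(\tfrac1{\sqrt{f(0)}},\tfrac1{\sqrt{f(1)}}\Big)\sqrt{\mu_m}+\mathcal O\big(\sqrt{\mu_m}e^{-\sqrt{\mu_m}}\big),$$ $$d_m=\Big|\tfrac1{\sqrt{f(0)}}-\tfrac1{\sqrt{f(1)}}\Big|\sqrt{\mu_m}+\mathcal O\big(\sqrt{\mu_m}e^{-2\sqrt{\mu_m}}\big).$$ Moreover, if $f(0)<f(1)$, there exist constants $C>0$ and $m_0>0$ such that for all $m\ge m_0$ and all $(x,\theta)\in[0,1]\times K$ $$|\varphi_m^+(x,\theta)|\le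 C\left(e^{-\sqrt{\mu_m}x}+e^{-\sqrt{\mu_m}(2-x)}\right),$$ $$|\varphi_m^-(x,\theta)|\le C\left(e^{-\sqrt{\mu_m}(1+x)}+e^{-\sqrt{\mu_m}(1-x)}\right),$$ and the same estimates hold with $+$ and $-$ interchanged if $f(0)>f(1)$.
   Context: Setting. $n\ge2$ is an integer, $K$ is a connected closed (compact, without boundary) smooth manifold of dimension $n-1$ with a smooth Riemannian metric $g_K$, $f:[0,1]\to(0,\infty)$ is smooth, and $M=[0,1]\times K$ carries the metric $g=f(x)[dx^2+g_K]$ (points of $M$ are written $(x,\theta)$). The boundary is $\partial M=\Gamma_0\cup\Gamma_1$ with $\Gamma_j=\{j\}\times K$, equipped with the induced metric. $\Delta_g$ and $\Delta_K$ are the Laplace–Beltrami operators of $(M,g)$ and $(K,g_K)$ ($-\Delta\ge0$). $\omega\in\mathbb R$ is a fixed frequency not in the Dirichlet spectrum of $-\Delta_g$. The Dirichlet-to-Neumann operator is $\Lambda_g(\omega)\psi=(\partial_\nu u)|_{\partial M}$ ($\nu$ the outward unit normal), where for $\psi\in H^{1/2}(\partial M)$, $u\in H^1(M)$ is the unique solution of $-\Delta_g u=\omega u$ on $M$, $u=\psi$ on $\partial M$. It is selfadjoint on $L^2(\partial M)$. $0=\mu_0<\mu_1\le\mu_2\le\cdots\to+\infty$ are the eigenvalues of $-\Delta_K$ counted with multiplicity and $(Y_m)_{m\ge0}$ is a fixed orthonormal basis of $L^2(K)$ with $-\Delta_KY_m=\mu_mY_m$. For each $m$ the two-dimensional space $\mathcal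 H_m$ of functions on $\partial M$ equal to $aY_m$ on $\Gamma_0$ and $bY_m$ on $\Gamma_1$ ($a,b\in\mathbb C$) is invariant under $\Lambda_g(\omega)$, and $\Lambda_g(\omega)|_{\mathcal H_m}$ has two distinct real eigenvalues, denoted $\lambda_m^-<\lambda_m^+$ (the Steklov eigenvalues). Put $d_m=\lambda_m^+-\lambda_m^-$. Let $\phi_m^\pm\in\mathcal H_m$ be an eigenfunction of $\Lambda_g(\omega)$ for $\lambda_m^\pm$ with $\|\phi_m^\pm\|_{L^2(\partial M)}=1$. The Steklov eigenfunction $\varphi_m^\pm$ is the solution of $-\Delta_g\varphi_m^\pm=\omega\varphi_m^\pm$ on $M$, $\varphi_m^\pm=\phi_m^\pm$ on $\partial M$. *)

theory Defs
  imports "HOL-Analysis.Analysis" "HOL-Library.Landau_Symbols"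
begin

section \<open>Smoothness\<close>

text \<open>
  Infinite differentiability on a set of reals. The set is always open or a compact interval;
  at an end point of an interval the derivatives are one-sided. \<open>D k\<close> is the \<open>k\<close>-th derivative.
\<close>

definition smooth_on :: "real set \<Rightarrow> (real \<Rightarrow> 'b::real_normed_vector) \<Rightarrow> bool" where
  "smooth_on S u \<longleftrightarrow>
     (\<exists>D :: nat \<Rightarrow> real \<Rightarrow> 'b.
        (\<forall>x\<in>S. D 0 x = u x) \<and>
        (\<forall>k. \<forall>x\<in>S. (D k has_vector_derivative D (Suc k) x) (at x within S)))"

text \<open>\<open>D i j\<close> is the partial derivative of order \<open>i\<close> in the first and \<open>j\<close> in the second variable.\<close>

definition smooth_on2 ::
  "real set \<Rightarrow> real set \<Rightarrow> (real \<Rightarrow> real \<Rightarrow> 'b::real_normed_vector) \<Rightarrow> bool" where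
  "smooth_on2 S T u \<longleftrightarrow>
     (\<exists>D :: nat \<Rightarrow> nat \<Rightarrow> real \<Rightarrow> real \<Rightarrow> 'b.
        (\<forall>x\<in>S. \<forall>t\<in>T. D 0 0 x t = u x t) \<and>
        (\<forall>i j. continuous_on (S \<times> T) (\<lambda>(x, t). D i j x t)) \<and>
        (\<forall>i j. \<forall>x\<in>S. \<forall>t\<in>T.
           ((\<lambda>s. D i j s t) has_vector_derivative D (Suc i) j x t) (at x within S) \<and>
           ((\<lambda>s. D i j x s) has_vector_derivative D i (Suc j) x t) (at t within T)))"


section \<open>Closed connected Riemannian manifolds of dimension one\<close>

type_synonym 'k chart = "'k set \<times> ('k \<Rightarrow> real)"

text \<open>
  The manifold is the whole type \<open>'k\<close>; \<open>charts\<close> is a smooth atlas (not necessarily maximal) of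
  pairs (domain, coordinate map). \<open>metric c\<close> is the component of the metric tensor in the
  coordinate of the chart \<open>c\<close>, that is \<open>g = metric c t dt\<^sup>2\<close>, and \<open>vol\<close> is the Riemannian measure.
\<close>

record 'k riem_manifold1 =
  charts :: "'k chart set"
  metric :: "'k chart \<Rightarrow> real \<Rightarrow> real"
  vol :: "'k measure"

definition chart_inv :: "'k chart \<Rightarrow> real \<Rightarrow> 'k" where
  "chart_inv c = inv_into (fst c) (snd c)"

definition chart_image :: "'k chart \<Rightarrow> real set" where
  "chart_image c = snd c ` fst c"

definition is_chart :: "'k::topological_space chart \<Rightarrow> bool" where
  "is_chart c \<longleftrightarrow> open (fst c) \<and> open (chart_image c) \<and>
     homeomorphism (fst c) (chart_image c) (snd c) (chart_inv c)"

definition transition :: "'k chart \<Rightarrow> 'k chart \<Rightarrow> real \<Rightarrow> real" where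
  "transition c c' = snd c' \<circ> chart_inv c"

text \<open>
  The last conjunct says that \<open>vol K\<close> is the measure with density \<open>sqrt (det g)\<close> with respect to
  Lebesgue measure in every chart; it is uniquely determined by this.
\<close>

definition closed_connected_riem_manifold1 ::
  "'k::{t2_space, second_countable_topology} riem_manifold1 \<Rightarrow> bool" where
  "closed_connected_riem_manifold1 K \<longleftrightarrow>
     compact (UNIV :: 'k set) \<and> connected (UNIV :: 'k set) \<and>
     (\<Union>c\<in>charts K. fst c) = UNIV \<and>
     (\<forall>c\<in>charts K. is_chart c) \<and>
     (\<forall>c\<in>charts K. \<forall>c'\<in>charts K. smooth_on (snd c ` (fst c \<inter> fst c')) (transition c c')) \<and>
     (\<forall>c\<in>charts K. smooth_on (chart_image c) (metric K c) \<and> (\<forall>t\<in>chart_image c. metric K c t > 0)) \<and>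
     (\<forall>c\<in>charts K. \<forall>c'\<in>charts K. \<forall>t\<in>snd c ` (fst c \<inter> fst c').
        metric K c t = metric K c' (transition c c' t) * (deriv (transition c c') t)\<^sup>2) \<and>
     sets (vol K) = sets borel \<and>
     (\<forall>c\<in>charts K. \<forall>B\<in>sets borel. B \<subseteq> fst c \<longrightarrow>
        emeasure (vol K) B = (\<integral>\<^sup>+t\<in>snd c ` B. ennreal (sqrt (metric K c t)) \<partial>lborel))"

text \<open>
  An arbitrary chart around a point. Everything below that is computed in this chart does not
  depend on the choice.
\<close>

definition chart_at :: "'k riem_manifold1 \<Rightarrow> 'k \<Rightarrow> 'k chart" where
  "chart_at K p = (SOME c. c \<in> charts K \<and> p \<in> fst c)"

definition smooth_fun :: "'k riem_manifold1 \<Rightarrow> ('k \<Rightarrow> complex) \<Rightarrow> bool" where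
  "smooth_fun K u \<longleftrightarrow> (\<forall>c\<in>charts K. smooth_on (chart_image c) (u \<circ> chart_inv c))"

text \<open>
  The Laplace--Beltrami operator \<open>\<bar>g\<bar>\<^bsup>-1/2\<^esup> \<partial>\<^sub>t (\<bar>g\<bar>\<^bsup>1/2\<^esup> g\<^sup>t\<^sup>t \<partial>\<^sub>t u)\<close>, where \<open>\<bar>g\<bar> = metric\<close> and
  \<open>g\<^sup>t\<^sup>t = 1 / metric\<close> in dimension one.
\<close>

definition laplacian :: "'k riem_manifold1 \<Rightarrow> ('k \<Rightarrow> complex) \<Rightarrow> 'k \<Rightarrow> complex" where
  "laplacian K u p =
     (let c = chart_at K p; t = snd c p; G = metric K c in
      (1 / sqrt (G t)) *\<^sub>R
        vector_derivative
          (\<lambda>s. (sqrt (G s) * (1 / G s)) *\<^sub>R vector_derivative (u \<circ> chart_inv c) (at s))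
          (at t))"

text \<open>The Hermitian product of the differentials of \<open>u\<close> and \<open>v\<close> at \<open>p\<close>.\<close>

definition grad_prod ::
  "'k riem_manifold1 \<Rightarrow> ('k \<Rightarrow> complex) \<Rightarrow> ('k \<Rightarrow> complex) \<Rightarrow> 'k \<Rightarrow> complex" where
  "grad_prod K u v p =
     (let c = chart_at K p; t = snd c p in
      (1 / metric K c t) *\<^sub>R
        (vector_derivative (u \<circ> chart_inv c) (at t) *
         cnj (vector_derivative (v \<circ> chart_inv c) (at t))))"


section \<open>Square integrable functions and spectral bases\<close>

definition L2 :: "'a measure \<Rightarrow> ('a \<Rightarrow> complex) set" where
  "L2 N = {u. u \<in> borel_measurable N \<and> integrable N (\<lambda>z. (cmod (u z))\<^sup>2)}"

definition inner_L2 :: "'a measure \<Rightarrow> ('a \<Rightarrow> complex) \<Rightarrow> ('a \<Rightarrow> complex) \<Rightarrow> complex" where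
  "inner_L2 N u v = (LINT z|N. u z * cnj (v z))"

definition tendsto_L2 :: "'a measure \<Rightarrow> (nat \<Rightarrow> 'a \<Rightarrow> complex) \<Rightarrow> ('a \<Rightarrow> complex) \<Rightarrow> bool" where
  "tendsto_L2 N S u \<longleftrightarrow>
     (\<forall>k. S k \<in> L2 N) \<and> u \<in> L2 N \<and> (\<lambda>k. LINT z|N. (cmod (S k z - u z))\<^sup>2) \<longlonglongrightarrow> 0"

text \<open>
  \<open>Y\<close> is an orthonormal basis of \<open>L\<^sup>2(K)\<close> of eigenfunctions and \<open>\<mu>\<close> lists the corresponding
  eigenvalues of minus the Laplacian in increasing order, with multiplicity.
\<close>

definition laplace_eigenbasis ::
  "'k riem_manifold1 \<Rightarrow> (nat \<Rightarrow> real) \<Rightarrow> (nat \<Rightarrow> 'k \<Rightarrow> complex) \<Rightarrow> bool" where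
  "laplace_eigenbasis K \<mu> Y \<longleftrightarrow>
     \<mu> 0 = 0 \<and> 0 < \<mu> 1 \<and> mono \<mu> \<and> filterlim \<mu> at_top sequentially \<and>
     (\<forall>m. smooth_fun K (Y m) \<and> (\<forall>p. - laplacian K (Y m) p = of_real (\<mu> m) * Y m p)) \<and>
     (\<forall>i j. inner_L2 (vol K) (Y i) (Y j) = (if i = j then 1 else 0)) \<and>
     (\<forall>u\<in>L2 (vol K).
        tendsto_L2 (vol K) (\<lambda>N p. \<Sum>m<N. inner_L2 (vol K) u (Y m) * Y m p) u)"


section \<open>The cylinder\<close>

text \<open>
  \<open>M = [0,1] \<times> K\<close> with the metric \<open>f(x) (dx\<^sup>2 + g)\<close>, where \<open>g\<close> is the metric of \<open>K\<close>. Functions on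
  \<open>M\<close> are functions on \<open>real \<times> 'k\<close> whose values outside \<open>M\<close> are irrelevant. In dimension two the
  Riemannian density is \<open>f\<close> times that of \<open>dx\<^sup>2 + g\<close>, the induced density on the boundary component
  \<open>\<Gamma>\<^sub>j\<close> is \<open>sqrt (f j)\<close> times that of \<open>g\<close>, and products of gradients are divided by \<open>f\<close>.
\<close>

definition cyl :: "(real \<times> 'k) set" where
  "cyl = {0..1} \<times> UNIV"

definition cyl_boundary :: "(real \<times> 'k) set" where
  "cyl_boundary = {0, 1} \<times> UNIV"

definition vol_cyl :: "'k riem_manifold1 \<Rightarrow> (real \<Rightarrow> real) \<Rightarrow> (real \<times> 'k) measure" where
  "vol_cyl K f = density (restrict_space lborel {0..1} \<Otimes>\<^sub>M vol K) (\<lambda>(x, p). ennreal (f x))"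

definition vol_boundary :: "'k riem_manifold1 \<Rightarrow> (real \<Rightarrow> real) \<Rightarrow> (real \<times> 'k) measure" where
  "vol_boundary K f =
     density (count_space {0, 1} \<Otimes>\<^sub>M vol K) (\<lambda>(j, p). ennreal (sqrt (f j)))"

definition smooth_cyl :: "'k riem_manifold1 \<Rightarrow> (real \<times> 'k \<Rightarrow> complex) \<Rightarrow> bool" where
  "smooth_cyl K u \<longleftrightarrow>
     (\<forall>c\<in>charts K. smooth_on2 {0..1} (chart_image c) (\<lambda>x t. u (x, chart_inv c t)))"

definition grad_prod_cyl ::
  "'k riem_manifold1 \<Rightarrow> (real \<Rightarrow> real) \<Rightarrow>
    (real \<times> 'k \<Rightarrow> complex) \<Rightarrow> (real \<times> 'k \<Rightarrow> complex) \<Rightarrow> real \<times> 'k \<Rightarrow> complex" where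
  "grad_prod_cyl K f u v = (\<lambda>(x, p).
     (1 / f x) *\<^sub>R
       (vector_derivative (\<lambda>s. u (s, p)) (at x within {0..1}) *
          cnj (vector_derivative (\<lambda>s. v (s, p)) (at x within {0..1})) +
        grad_prod K (\<lambda>q. u (x, q)) (\<lambda>q. v (x, q)) p))"

definition dirichlet_form ::
  "'k riem_manifold1 \<Rightarrow> (real \<Rightarrow> real) \<Rightarrow>
    (real \<times> 'k \<Rightarrow> complex) \<Rightarrow> (real \<times> 'k \<Rightarrow> complex) \<Rightarrow> complex" where
  "dirichlet_form K f u v = (LINT z|vol_cyl K f. grad_prod_cyl K f u v z)"

text \<open>
  \<open>H\<^sup>1(M)\<close> is the completion of the smooth functions on \<open>M\<close> (up to the boundary) for the \<open>H\<^sup>1\<close> norm.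
  \<open>H1_approx K f S u \<psi>\<close> says that the sequence \<open>S\<close> of smooth functions is Cauchy in \<open>H\<^sup>1(M)\<close> with limit
  \<open>u\<close>, and that \<open>\<psi>\<close> is the trace of \<open>u\<close> on the boundary. So \<open>u \<in> H\<^sup>1(M)\<close> if such \<open>S\<close> and \<open>\<psi>\<close> exist, and
  \<open>\<psi> \<in> H\<^bsup>1/2\<^esup>(\<partial>M)\<close> if such \<open>S\<close> and \<open>u\<close> exist.
\<close>

definition H1_approx ::
  "'k riem_manifold1 \<Rightarrow> (real \<Rightarrow> real) \<Rightarrow> (nat \<Rightarrow> real \<times> 'k \<Rightarrow> complex) \<Rightarrow>
    (real \<times> 'k \<Rightarrow> complex) \<Rightarrow> (real \<times> 'k \<Rightarrow> complex) \<Rightarrow> bool" where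
  "H1_approx K f S u \<psi> \<longleftrightarrow>
     (\<forall>k. smooth_cyl K (S k)) \<and>
     tendsto_L2 (vol_cyl K f) S u \<and>
     (\<forall>e>0. \<exists>N. \<forall>j\<ge>N. \<forall>k\<ge>N.
        cmod (dirichlet_form K f (\<lambda>z. S j z - S k z) (\<lambda>z. S j z - S k z)) < e) \<and>
     tendsto_L2 (vol_boundary K f) S \<psi>"

text \<open>
  Weak form of \<open>-\<Delta> u = \<omega> u\<close> on \<open>M\<close>, \<open>u = \<psi>\<close> on \<open>\<partial>M\<close>. For \<open>u\<close> in \<open>H\<^sup>1(M)\<close> the Dirichlet form with a
  smooth function is the limit along an approximating sequence and does not depend on the sequence.
\<close>

definition weak_solution_via ::
  "'k riem_manifold1 \<Rightarrow> (real \<Rightarrow> real) \<Rightarrow> real \<Rightarrow> (nat \<Rightarrow> real \<times> 'k \<Rightarrow> complex) \<Rightarrow>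
    (real \<times> 'k \<Rightarrow> complex) \<Rightarrow> (real \<times> 'k \<Rightarrow> complex) \<Rightarrow> bool" where
  "weak_solution_via K f \<omega> S u \<psi> \<longleftrightarrow>
     H1_approx K f S u \<psi> \<and>
     (\<forall>v. smooth_cyl K v \<and> (\<forall>z\<in>cyl_boundary. v z = 0) \<longrightarrow>
        (\<lambda>k. dirichlet_form K f (S k) v) \<longlonglongrightarrow> of_real \<omega> * inner_L2 (vol_cyl K f) u v)"

definition dirichlet_solution ::
  "'k riem_manifold1 \<Rightarrow> (real \<Rightarrow> real) \<Rightarrow> real \<Rightarrow>
    (real \<times> 'k \<Rightarrow> complex) \<Rightarrow> (real \<times> 'k \<Rightarrow> complex) \<Rightarrow> bool" where
  "dirichlet_solution K f \<omega> u \<psi> \<longleftrightarrow> (\<exists>S. weak_solution_via K f \<omega> S u \<psi>)"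

definition dirichlet_spectrum :: "'k riem_manifold1 \<Rightarrow> (real \<Rightarrow> real) \<Rightarrow> real set" where
  "dirichlet_spectrum K f =
     {\<omega>. \<exists>u. dirichlet_solution K f \<omega> u (\<lambda>_. 0) \<and> \<not> (AE z in vol_cyl K f. u z = 0)}"


section \<open>The Dirichlet-to-Neumann operator and its eigenvalues\<close>

text \<open>
  The graph of the operator as a selfadjoint operator on \<open>L\<^sup>2(\<partial>M)\<close>: \<open>\<psi>\<close> is mapped to \<open>\<eta>\<close> if \<open>\<eta> \<in> L\<^sup>2(\<partial>M)\<close>
  is the outward normal derivative of the solution \<open>u\<close> with boundary value \<open>\<psi>\<close>. The normal derivative
  of an \<open>H\<^sup>1\<close> solution is defined by Green's formula: the integral of \<open>\<partial>\<^sub>\<nu>u cnj v\<close> over \<open>\<partial>M\<close> is the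
  integral of \<open>\<langle>\<nabla>u, \<nabla>v\<rangle> + \<Delta>u cnj v\<close> over \<open>M\<close>, with \<open>\<Delta>u = -\<omega>u\<close>.
\<close>

definition DN ::
  "'k riem_manifold1 \<Rightarrow> (real \<Rightarrow> real) \<Rightarrow> real \<Rightarrow>
    (real \<times> 'k \<Rightarrow> complex) \<Rightarrow> (real \<times> 'k \<Rightarrow> complex) \<Rightarrow> bool" where
  "DN K f \<omega> \<psi> \<eta> \<longleftrightarrow>
     \<eta> \<in> L2 (vol_boundary K f) \<and>
     (\<exists>u S. weak_solution_via K f \<omega> S u \<psi> \<and>
        (\<forall>v. smooth_cyl K v \<longrightarrow>
           (\<lambda>k. dirichlet_form K f (S k) v) \<longlonglongrightarrow>
             of_real \<omega> * inner_L2 (vol_cyl K f) u v + inner_L2 (vol_boundary K f) \<eta> v))"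

definition mode_space :: "(nat \<Rightarrow> 'k \<Rightarrow> complex) \<Rightarrow> nat \<Rightarrow> (real \<times> 'k \<Rightarrow> complex) set" where
  "mode_space Y m = {\<psi>. \<exists>a b. \<forall>p. \<psi> (0, p) = a * Y m p \<and> \<psi> (1, p) = b * Y m p}"

text \<open>
  The eigenvalues of the operator restricted to \<open>mode_space Y m\<close>. There are exactly two of them, so
  that \<open>Min\<close> and \<open>Max\<close> below pick the smaller and the larger one.
\<close>

definition steklov_eigenvalues ::
  "'k riem_manifold1 \<Rightarrow> (real \<Rightarrow> real) \<Rightarrow> real \<Rightarrow> (nat \<Rightarrow> 'k \<Rightarrow> complex) \<Rightarrow> nat \<Rightarrow> real set" where
  "steklov_eigenvalues K f \<omega> Y m =
     {l. \<exists>\<psi>\<in>mode_space Y m. (\<exists>z\<in>cyl_boundary. \<psi> z \<noteq> 0) \<and> DN K f \<omega> \<psi> (\<lambda>z. of_real l * \<psi> z)}"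

definition steklov_minus ::
  "'k riem_manifold1 \<Rightarrow> (real \<Rightarrow> real) \<Rightarrow> real \<Rightarrow> (nat \<Rightarrow> 'k \<Rightarrow> complex) \<Rightarrow> nat \<Rightarrow> real" where
  "steklov_minus K f \<omega> Y m = Min (steklov_eigenvalues K f \<omega> Y m)"

definition steklov_plus ::
  "'k riem_manifold1 \<Rightarrow> (real \<Rightarrow> real) \<Rightarrow> real \<Rightarrow> (nat \<Rightarrow> 'k \<Rightarrow> complex) \<Rightarrow> nat \<Rightarrow> real" where
  "steklov_plus K f \<omega> Y m = Max (steklov_eigenvalues K f \<omega> Y m)"

text \<open>
  \<open>\<phi>\<close> is the solution whose boundary value is an \<open>L\<^sup>2\<close>-normalised eigenfunction for \<open>l\<close> in
  \<open>mode_space Y m\<close>. An element of \<open>H\<^sup>1(M)\<close> is only determined almost everywhere; the continuity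
  condition selects the representative to which pointwise estimates refer.
\<close>

definition steklov_eigenfunction ::
  "'k::topological_space riem_manifold1 \<Rightarrow> (real \<Rightarrow> real) \<Rightarrow> real \<Rightarrow> (nat \<Rightarrow> 'k \<Rightarrow> complex) \<Rightarrow> nat \<Rightarrow>
    real \<Rightarrow> (real \<times> 'k \<Rightarrow> complex) \<Rightarrow> bool" where
  "steklov_eigenfunction K f \<omega> Y m l \<phi> \<longleftrightarrow>
     continuous_on cyl \<phi> \<and>
     (\<exists>\<psi>\<in>mode_space Y m.
        (LINT z|vol_boundary K f. (cmod (\<psi> z))\<^sup>2) = 1 \<and>
        DN K f \<omega> \<psi> (\<lambda>z. of_real l * \<psi> z) \<and>
        dirichlet_solution K f \<omega> \<phi> \<psi>)"

end

theory Submission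
  imports Defs
begin

text \<open>
  In dimension two the Dirichlet form is conformally invariant, so for zero frequency the factor
  \<open>f\<close> acts only through the weights \<open>sqrt (f 0)\<close> and \<open>sqrt (f 1)\<close> of the two boundary components.
  Separation of variables then makes everything explicit. Put \<open>s = sqrt (\<mu> m)\<close>, \<open>p = 1 / sqrt (f 0)\<close> and
  \<open>q = 1 / sqrt (f 1)\<close>. The harmonic function with boundary values \<open>a Y\<^sub>m\<close> and \<open>b Y\<^sub>m\<close> is
  \<open>(a sinh (s (1 - x)) + b sinh (s x)) / sinh s\<close> times \<open>Y\<^sub>m\<close>, and on these functions the operator is the
  matrix with diagonal entries \<open>s p coth s\<close> and \<open>s q coth s\<close> and off-diagonal entries
  \<open>- s p / sinh s\<close> and \<open>- s q / sinh s\<close>. Its eigenvalues are elementary functions of \<open>s\<close>, and all the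
  asymptotic formulas follow from \<open>1 / sinh s = O(exp (- s))\<close>. For \<open>p \<noteq> q\<close> the diagonal entries are
  far apart compared with the off-diagonal ones, so that one component of each eigenvector is
  exponentially small; this is the localisation at one end (\<open>component_decay\<close>).

  The weak definition of the operator is connected with this matrix by Green's formula
  \<open>dirichlet_form_U\<close> for a test function and a separated solution. Testing with separated solutions
  shows that an eigenvalue must satisfy the matrix equation (\<open>DN_eigenvalue_relation\<close>), and
  inserting the separated solution itself shows that the eigenvalues of the matrix occur
  (\<open>DN_U\<close>). That zero is not a Dirichlet eigenvalue identifies an arbitrary Steklov eigenfunction
  with a separated solution (\<open>dirichlet_solution_eq_U\<close>).

  Two facts about the curve \<open>K\<close> enter. One is Green's identity \<open>green_identity\<close>, proved with a partition
  of unity by bump functions, for which the identity is the fundamental theorem of calculus in a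
  coordinate. The other is a bound for \<open>Y\<^sub>m\<close> independent of \<open>m\<close> (\<open>eigenfunction_bound\<close>): in
  arclength \<open>Y\<^sub>m\<close> is a harmonic oscillator, whose conserved energy is determined by the normalisation.
\<close>

section \<open>Smooth functions of one variable\<close>

lemma smooth_on_cong:
  assumes "smooth_on S u" "\<And>x. x \<in> S \<Longrightarrow> v x = u x"
  shows "smooth_on S v"
proof -
  obtain D where "(\<forall>x\<in>S. D 0 x = u x) \<and>
      (\<forall>k. \<forall>x\<in>S. (D k has_vector_derivative D (Suc k) x) (at x within S))"
    using assms(1) unfolding smooth_on_def by (elim exE)
  then have "(\<forall>x\<in>S. D 0 x = v x) \<and>
      (\<forall>k. \<forall>x\<in>S. (D k has_vector_derivative D (Suc k) x) (at x within S))"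
    using assms(2) by simp
  then show ?thesis unfolding smooth_on_def by (rule exI[of _ D])
qed

lemma smooth_on_derivative:
  assumes "smooth_on S u"
  obtains u' where "\<And>x. x \<in> S \<Longrightarrow> (u has_vector_derivative u' x) (at x within S)" "smooth_on S u'"
proof -
  obtain D where D: "(\<forall>x\<in>S. D 0 x = u x) \<and>
      (\<forall>k. \<forall>x\<in>S. (D k has_vector_derivative D (Suc k) x) (at x within S))"
    using assms unfolding smooth_on_def by (elim exE)
  have "(u has_vector_derivative D (Suc 0) x) (at x within S)" if "x \<in> S" for x
  proof (rule has_vector_derivative_transform[OF that])
    show "\<And>y. y \<in> S \<Longrightarrow> u y = D 0 y" using D by simp
    show "(D 0 has_vector_derivative D (Suc 0) x) (at x within S)" using D that by simp
  qed
  moreover have "smooth_on S (D (Suc 0))"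
    unfolding smooth_on_def by (rule exI[of _ "\<lambda>k. D (Suc k)"]) (simp add: D)
  ultimately show ?thesis by (rule that)
qed

lemma smooth_on_continuous:
  assumes "smooth_on S u"
  shows "continuous_on S u"
proof (rule smooth_on_derivative[OF assms])
  fix u'
  assume "\<And>x. x \<in> S \<Longrightarrow> (u has_vector_derivative u' x) (at x within S)"
  then show ?thesis
    unfolding continuous_on_eq_continuous_within
    by (auto intro: has_vector_derivative_continuous)
qed

text \<open>
  On an open set the one-sided derivatives of the definition are the ordinary ones, so that
  repeated use of this lemma produces derivatives of every order.
\<close>

lemma smooth_on_open_derivative:
  assumes "open S" "smooth_on S u"
  shows "\<And>x. x \<in> S \<Longrightarrow> (u has_vector_derivative vector_derivative u (at x)) (at x)"
    and "smooth_on S (\<lambda>x. vector_derivative u (at x))"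
proof -
  have "(\<forall>x\<in>S. (u has_vector_derivative vector_derivative u (at x)) (at x)) \<and>
      smooth_on S (\<lambda>x. vector_derivative u (at x))"
  proof (rule smooth_on_derivative[OF assms(2)])
    fix u'
    assume u': "\<And>x. x \<in> S \<Longrightarrow> (u has_vector_derivative u' x) (at x within S)" "smooth_on S u'"
    have d: "(u has_vector_derivative u' x) (at x)" if "x \<in> S" for x
      using u'(1)[OF that] by (simp only: at_within_open[OF that assms(1)])
    have eq: "vector_derivative u (at x) = u' x" if "x \<in> S" for x
      by (rule vector_derivative_at[OF d[OF that]])
    show ?thesis
      using d smooth_on_cong[OF u'(2) eq] by (simp add: eq)
  qed
  then show "\<And>x. x \<in> S \<Longrightarrow> (u has_vector_derivative vector_derivative u (at x)) (at x)"
    and "smooth_on S (\<lambda>x. vector_derivative u (at x))"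
    by simp_all
qed

section \<open>Charts and derivatives with respect to arclength\<close>

text \<open>
  The bump functions below have only one continuous derivative, so Green's identity is proved for
  functions of this class. Slices of test functions on the cylinder belong to it as well.
\<close>

definition C1_fun :: "'k riem_manifold1 \<Rightarrow> ('k \<Rightarrow> complex) \<Rightarrow> bool" where
  "C1_fun K u \<longleftrightarrow> (\<forall>c\<in>charts K. \<exists>u'. continuous_on (chart_image c) u' \<and>
     (\<forall>t\<in>chart_image c. ((u \<circ> chart_inv c) has_vector_derivative u' t) (at t)))"

text \<open>
  The derivative with respect to arclength along the coordinate line. Unlike the coordinate
  derivative it depends on the chart only through its orientation, hence up to sign, so
  products of two such derivatives, and the second such derivative, are intrinsic.
\<close>

definition unit_deriv :: "'k riem_manifold1 \<Rightarrow> 'k chart \<Rightarrow> ('k \<Rightarrow> complex) \<Rightarrow> real \<Rightarrow> complex" where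
  "unit_deriv K c u t = (1 / sqrt (metric K c t)) *\<^sub>R vector_derivative (u \<circ> chart_inv c) (at t)"

locale closed_curve =
  fixes K :: "'k::{t2_space, second_countable_topology} riem_manifold1"
  assumes closed_connected: "closed_connected_riem_manifold1 K"
begin

lemma
  shows compact_K: "compact (UNIV :: 'k set)"
    and connected_K: "connected (UNIV :: 'k set)"
    and charts_cover: "(\<Union>c\<in>charts K. fst c) = UNIV"
    and charts_are_charts: "\<forall>c\<in>charts K. is_chart c"
    and transition_smooth: "\<forall>c\<in>charts K. \<forall>c'\<in>charts K.
        smooth_on (snd c ` (fst c \<inter> fst c')) (transition c c')"
    and metric_chart: "\<forall>c\<in>charts K.
        smooth_on (chart_image c) (metric K c) \<and> (\<forall>t\<in>chart_image c. metric K c t > 0)"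
    and metric_transition: "\<forall>c\<in>charts K. \<forall>c'\<in>charts K. \<forall>t\<in>snd c ` (fst c \<inter> fst c').
        metric K c t = metric K c' (transition c c' t) * (deriv (transition c c') t)\<^sup>2"
    and sets_vol: "sets (vol K) = sets borel"
    and emeasure_vol_chart: "\<forall>c\<in>charts K. \<forall>B\<in>sets borel. B \<subseteq> fst c \<longrightarrow>
        emeasure (vol K) B = (\<integral>\<^sup>+t\<in>snd c ` B. ennreal (sqrt (metric K c t)) \<partial>lborel)"
proof -
  note * = closed_connected[unfolded closed_connected_riem_manifold1_def]
  show "compact (UNIV :: 'k set)"
    using * by (elim conjE)
  show "connected (UNIV :: 'k set)"
    using * by (elim conjE)
  show "(\<Union>c\<in>charts K. fst c) = UNIV"
    using * by (elim conjE)
  show "\<forall>c\<in>charts K. is_chart c"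
    using * by (elim conjE)
  show "\<forall>c\<in>charts K. \<forall>c'\<in>charts K.
            smooth_on (snd c ` (fst c \<inter> fst c')) (transition c c')"
    using * by (elim conjE)
  show "\<forall>c\<in>charts K.
            smooth_on (chart_image c) (metric K c) \<and> (\<forall>t\<in>chart_image c. metric K c t > 0)"
    using * by (elim conjE)
  show "\<forall>c\<in>charts K. \<forall>c'\<in>charts K. \<forall>t\<in>snd c ` (fst c \<inter> fst c').
            metric K c t = metric K c' (transition c c' t) * (deriv (transition c c') t)\<^sup>2"
    using * by (elim conjE)
  show "sets (vol K) = sets borel"
    using * by (elim conjE)
  show "\<forall>c\<in>charts K. \<forall>B\<in>sets borel. B \<subseteq> fst c \<longrightarrow>
            emeasure (vol K) B = (\<integral>\<^sup>+t\<in>snd c ` B. ennreal (sqrt (metric K c t)) \<partial>lborel)"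
    using * by (elim conjE)
qed

lemma space_vol: "space (vol K) = UNIV"
  using sets_eq_imp_space_eq[OF sets_vol] by simp

lemma chart_facts:
  assumes "c \<in> charts K"
  shows open_chart: "open (fst c)" and open_chart_image: "open (chart_image c)"
    and chart_homeomorphism: "homeomorphism (fst c) (chart_image c) (snd c) (chart_inv c)"
    and smooth_metric: "smooth_on (chart_image c) (metric K c)"
    and metric_pos: "\<And>t. t \<in> chart_image c \<Longrightarrow> metric K c t > 0"
  using bspec[OF charts_are_charts assms] bspec[OF metric_chart assms] unfolding is_chart_def
  by blast+

lemma chart_inverse:
  assumes "c \<in> charts K"
  shows "\<And>t. t \<in> chart_image c \<Longrightarrow> chart_inv c t \<in> fst c"
    and "\<And>t. t \<in> chart_image c \<Longrightarrow> snd c (chart_inv c t) = t"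
    and "\<And>p. p \<in> fst c \<Longrightarrow> snd c p \<in> chart_image c"
    and "\<And>p. p \<in> fst c \<Longrightarrow> chart_inv c (snd c p) = p"
    and "continuous_on (fst c) (snd c)"
    and "continuous_on (chart_image c) (chart_inv c)"
  using chart_homeomorphism[OF assms] unfolding homeomorphism_def by auto

lemma obtain_chart:
  obtains c where "c \<in> charts K" "p \<in> fst c"
  using charts_cover by blast

lemma chart_at: "chart_at K p \<in> charts K" "p \<in> fst (chart_at K p)"
proof -
  have "\<exists>c. c \<in> charts K \<and> p \<in> fst c" using obtain_chart by metis
  from someI_ex[OF this] show "chart_at K p \<in> charts K" "p \<in> fst (chart_at K p)"
    unfolding chart_at_def by auto
qed

lemma chart_preimage_open:
  assumes "c \<in> charts K" "open U"
  shows "open {t \<in> chart_image c. chart_inv c t \<in> U}"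
proof -
  have "open (chart_image c \<inter> chart_inv c -` U)"
    using chart_inverse(6)[OF assms(1)] assms open_chart_image continuous_on_open_vimage
    by (metis Int_commute)
  then show ?thesis by (simp add: Collect_conj_eq vimage_def)
qed

lemma overlap_eq:
  assumes "c \<in> charts K"
  shows "snd c ` (fst c \<inter> fst c') = {t \<in> chart_image c. chart_inv c t \<in> fst c'}"
  using chart_inverse(1-4)[OF assms] by force

text \<open>
  The derivative of a transition map cannot vanish: the metric components on both sides of the
  transformation law are positive.
\<close>

lemma transition_facts:
  assumes c: "c \<in> charts K" and c': "c' \<in> charts K"
  defines "O' \<equiv> snd c ` (fst c \<inter> fst c')" and "\<tau> \<equiv> transition c c'"
  shows "open O'"
    and "\<And>t. t \<in> O' \<Longrightarrow> (\<tau> has_vector_derivative deriv \<tau> t) (at t)"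
    and "continuous_on O' (deriv \<tau>)"
    and "\<And>t. t \<in> O' \<Longrightarrow> metric K c t = metric K c' (\<tau> t) * (deriv \<tau> t)\<^sup>2"
    and "\<And>t. t \<in> O' \<Longrightarrow> deriv \<tau> t \<noteq> 0"
    and "\<And>t. t \<in> O' \<Longrightarrow> \<tau> t \<in> chart_image c'"
    and "\<And>t. t \<in> O' \<Longrightarrow> chart_inv c' (\<tau> t) = chart_inv c t"
proof -
  show op: "open O'"
    unfolding O'_def overlap_eq[OF c] by (rule chart_preimage_open[OF c open_chart[OF c']])
  have sm: "smooth_on O' \<tau>" using transition_smooth c c' unfolding O'_def \<tau>_def by blast
  have metric: "metric K c t = metric K c' (\<tau> t) * (deriv \<tau> t)\<^sup>2" if "t \<in> O'" for t
    using metric_transition c c' that unfolding O'_def \<tau>_def by blast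
  have eq: "deriv \<tau> t = vector_derivative \<tau> (at t)" if "t \<in> O'" for t
    by (rule DERIV_imp_deriv)
       (simp only: has_real_derivative_iff_has_vector_derivative smooth_on_open_derivative(1)[OF op sm that])
  show "(\<tau> has_vector_derivative deriv \<tau> t) (at t)" if "t \<in> O'" for t
    unfolding eq[OF that] by (rule smooth_on_open_derivative(1)[OF op sm that])
  have "continuous_on O' (\<lambda>t. vector_derivative \<tau> (at t))"
    by (rule smooth_on_continuous[OF smooth_on_open_derivative(2)[OF op sm]])
  then show "continuous_on O' (deriv \<tau>)"
    by (rule continuous_on_eq) (simp add: eq)
  show "\<And>t. t \<in> O' \<Longrightarrow> metric K c t = metric K c' (\<tau> t) * (deriv \<tau> t)\<^sup>2" by (fact metric)
  show "deriv \<tau> t \<noteq> 0" if "t \<in> O'" for t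
  proof
    assume "deriv \<tau> t = 0"
    with metric[OF that] have "metric K c t = 0" by simp
    moreover have "t \<in> chart_image c" using that unfolding O'_def chart_image_def by auto
    ultimately show False using metric_pos[OF c] by force
  qed
  show "\<And>t. t \<in> O' \<Longrightarrow> \<tau> t \<in> chart_image c'" "\<And>t. t \<in> O' \<Longrightarrow> chart_inv c' (\<tau> t) = chart_inv c t"
    using chart_inverse(4)[OF c] chart_inverse(3,4)[OF c'] unfolding O'_def \<tau>_def transition_def
    by auto
qed

lemma change_chart_derivative:
  assumes c: "c \<in> charts K" and c': "c' \<in> charts K" and t: "t \<in> snd c ` (fst c \<inter> fst c')"
    and u: "((u \<circ> chart_inv c') has_vector_derivative a) (at (transition c c' t))"
  shows "((u \<circ> chart_inv c) has_vector_derivative deriv (transition c c') t *\<^sub>R a) (at t)"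
proof -
  have "((u \<circ> chart_inv c') \<circ> transition c c' has_vector_derivative deriv (transition c c') t *\<^sub>R a) (at t)"
    by (rule vector_diff_chain_at[OF transition_facts(2)[OF c c' t] u])
  then show ?thesis
    by (rule has_vector_derivative_transform_within_open[OF _ transition_facts(1)[OF c c'] t])
       (simp add: transition_facts(7)[OF c c'])
qed

lemma unit_deriv_change_chart:
  assumes c: "c \<in> charts K" and c': "c' \<in> charts K" and t: "t \<in> snd c ` (fst c \<inter> fst c')"
    and u: "((u \<circ> chart_inv c') has_vector_derivative a) (at (transition c c' t))"
  shows "unit_deriv K c u t = sgn (deriv (transition c c') t) *\<^sub>R unit_deriv K c' u (transition c c' t)"
proof -
  let ?\<tau> = "transition c c'"
  have "vector_derivative (u \<circ> chart_inv c) (at t) =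
      deriv ?\<tau> t *\<^sub>R vector_derivative (u \<circ> chart_inv c') (at (?\<tau> t))"
    using change_chart_derivative[OF assms] u by (simp add: vector_derivative_at)
  then show ?thesis
    unfolding unit_deriv_def
    by (simp add: transition_facts(4)[OF c c' t] real_sqrt_mult sgn_div_norm divide_inverse)
qed

lemma C1_fun_chart:
  assumes "C1_fun K u" "c \<in> charts K"
  shows "\<And>t. t \<in> chart_image c \<Longrightarrow>
      ((u \<circ> chart_inv c) has_vector_derivative vector_derivative (u \<circ> chart_inv c) (at t)) (at t)"
    and "continuous_on (chart_image c) (\<lambda>t. vector_derivative (u \<circ> chart_inv c) (at t))"
    and "continuous_on (chart_image c) (unit_deriv K c u)"
    and "continuous_on (chart_image c) (u \<circ> chart_inv c)"
proof -
  obtain u' where u': "continuous_on (chart_image c) u'"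
     "\<And>t. t\<in>chart_image c \<Longrightarrow> ((u \<circ> chart_inv c) has_vector_derivative u' t) (at t)"
    using assms unfolding C1_fun_def by blast
  then have eq: "\<And>t. t\<in>chart_image c \<Longrightarrow> vector_derivative (u \<circ> chart_inv c) (at t) = u' t"
    by (simp add: vector_derivative_at)
  show "\<And>t. t \<in> chart_image c \<Longrightarrow>
      ((u \<circ> chart_inv c) has_vector_derivative vector_derivative (u \<circ> chart_inv c) (at t)) (at t)"
    using u'(2) eq by simp
  show 1: "continuous_on (chart_image c) (\<lambda>t. vector_derivative (u \<circ> chart_inv c) (at t))"
    by (rule continuous_on_eq[OF u'(1)]) (simp add: eq)
  have "continuous_on (chart_image c) (metric K c)"
    by (rule smooth_on_continuous[OF smooth_metric[OF assms(2)]])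
  then show "continuous_on (chart_image c) (unit_deriv K c u)"
    unfolding unit_deriv_def using metric_pos[OF assms(2)]
    by (intro continuous_intros 1) (auto simp: less_imp_neq[symmetric])
  show "continuous_on (chart_image c) (u \<circ> chart_inv c)"
    using u'(2) has_vector_derivative_continuous by (blast intro: continuous_at_imp_continuous_on)
qed

lemma smooth_fun_imp_C1_fun:
  assumes "smooth_fun K u"
  shows "C1_fun K u"
  unfolding C1_fun_def
proof
  fix c assume c: "c \<in> charts K"
  have sm: "smooth_on (chart_image c) (u \<circ> chart_inv c)" using assms c unfolding smooth_fun_def by blast
  show "\<exists>u'. continuous_on (chart_image c) u' \<and>
     (\<forall>t\<in>chart_image c. ((u \<circ> chart_inv c) has_vector_derivative u' t) (at t))"
    using smooth_on_open_derivative[OF open_chart_image[OF c] sm] smooth_on_continuous by blast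
qed

text \<open>
  The gradient product may be computed in any chart: the two signs that arise when the chart is
  changed are equal and cancel.
\<close>

lemma grad_prod_chart:
  assumes u: "C1_fun K u" and v: "C1_fun K v" and c: "c \<in> charts K" and p: "p \<in> fst c"
  shows "grad_prod K u v p = unit_deriv K c u (snd c p) * cnj (unit_deriv K c v (snd c p))"
proof -
  define c0 where "c0 = chart_at K p"
  have c0: "c0 \<in> charts K" "p \<in> fst c0" unfolding c0_def by (rule chart_at)+
  define t where "t = snd c0 p"
  have t: "t \<in> snd c0 ` (fst c0 \<inter> fst c)" unfolding t_def using p c0 by blast
  have tr: "transition c0 c t = snd c p"
    unfolding t_def transition_def using chart_inverse(4)[OF c0] by simp
  have im: "snd c p \<in> chart_image c" using chart_inverse(3)[OF c p] .
  have pos: "metric K c0 t > 0" using metric_pos[OF c0(1)] chart_inverse(3)[OF c0] t_def by simp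
  have *: "unit_deriv K c0 w t = sgn (deriv (transition c0 c) t) *\<^sub>R unit_deriv K c w (snd c p)"
    if "C1_fun K w" for w
    using unit_deriv_change_chart[OF c0(1) c t] C1_fun_chart(1)[OF that c im] tr by metis
  have sq: "sgn (deriv (transition c0 c) t) * sgn (deriv (transition c0 c) t) = 1"
    using transition_facts(5)[OF c0(1) c t] by (simp add: sgn_if)
  have "grad_prod K u v p = unit_deriv K c0 u t * cnj (unit_deriv K c0 v t)"
    unfolding grad_prod_def c0_def[symmetric] t_def[symmetric] Let_def unit_deriv_def
    using pos by (simp add: real_sqrt_mult_self divide_inverse mult.commute mult.left_commute
      flip: of_real_mult real_sqrt_inverse)
  then show ?thesis unfolding *[OF u] *[OF v] using sq by (simp add: scaleR_conv_of_real mult_ac flip: of_real_mult)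
qed

end

section \<open>The Laplacian in a chart and the Riemannian measure\<close>

context closed_curve begin

text \<open>
  In terms of the metric component \<open>G\<close> the derivative of \<open>G\<^sup>-\<^sup>1\<^sup>/\<^sup>2 u'\<close> is an explicit continuous expression,
  which also gives the continuity of the Laplacian.
\<close>

lemma unit_deriv_differentiable:
  assumes u: "smooth_fun K u" and c: "c \<in> charts K"
  obtains Z' where "continuous_on (chart_image c) Z'"
    "\<And>t. t \<in> chart_image c \<Longrightarrow> (unit_deriv K c u has_vector_derivative Z' t) (at t)"
proof -
  let ?I = "chart_image c" and ?G = "metric K c"
  let ?u' = "\<lambda>t. vector_derivative (u \<circ> chart_inv c) (at t)"
  let ?u'' = "\<lambda>t. vector_derivative ?u' (at t)"
  let ?G' = "\<lambda>t. vector_derivative ?G (at t)"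
  have op: "open ?I" by (rule open_chart_image[OF c])
  have su: "smooth_on ?I (u \<circ> chart_inv c)" using u c unfolding smooth_fun_def by blast
  have su': "smooth_on ?I ?u'" by (rule smooth_on_open_derivative(2)[OF op su])
  have sG: "smooth_on ?I ?G" by (rule smooth_metric[OF c])
  let ?Z' = "\<lambda>t. (1 / sqrt (?G t)) *\<^sub>R ?u'' t + (- (?G' t / (2 * sqrt (?G t))) / ?G t) *\<^sub>R ?u' t"
  have "continuous_on ?I ?Z'"
    using metric_pos[OF c]
    by (intro continuous_intros smooth_on_continuous[OF smooth_on_open_derivative(2)[OF op su']]
      smooth_on_continuous[OF smooth_on_open_derivative(2)[OF op sG]]
      smooth_on_continuous[OF su'] smooth_on_continuous[OF sG]) (auto simp: less_imp_neq[symmetric])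
  moreover have "(unit_deriv K c u has_vector_derivative ?Z' t) (at t)" if t: "t \<in> ?I" for t
  proof -
    have G: "?G t > 0" by (rule metric_pos[OF c t])
    have dG: "(?G has_real_derivative ?G' t) (at t)"
      using smooth_on_open_derivative(1)[OF op sG t]
      by (simp only: has_real_derivative_iff_has_vector_derivative)
    have "((\<lambda>s. 1 / sqrt (?G s)) has_real_derivative - (?G' t / (2 * sqrt (?G t))) / ?G t) (at t)"
      using dG G by (auto intro!: derivative_eq_intros simp: field_simps)
    from has_vector_derivative_scaleR[OF this smooth_on_open_derivative(1)[OF op su' t]]
    show ?thesis unfolding unit_deriv_def[abs_def] .
  qed
  ultimately show ?thesis by (rule that)
qed

text \<open>
  The Laplacian is the second derivative with respect to arclength, in every chart. The
  derivative of a transition map is continuous without zeros, so its sign is locally constant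
  and may be pulled out of the outer derivative; it then occurs twice and disappears.
\<close>

lemma laplacian_chart:
  assumes u: "smooth_fun K u" and c: "c \<in> charts K" and t: "t \<in> chart_image c"
  shows "laplacian K u (chart_inv c t) =
    (1 / sqrt (metric K c t)) *\<^sub>R vector_derivative (unit_deriv K c u) (at t)"
proof -
  define p where "p = chart_inv c t"
  define c0 where "c0 = chart_at K p"
  have c0: "c0 \<in> charts K" "p \<in> fst c0" unfolding c0_def by (rule chart_at)+
  have p: "p \<in> fst c" "snd c p = t" unfolding p_def using chart_inverse(1,2)[OF c t] by auto
  define t0 where "t0 = snd c0 p"
  have t0: "t0 \<in> chart_image c0" unfolding t0_def using chart_inverse(3)[OF c0] .
  let ?\<tau> = "transition c c0" and ?O = "snd c ` (fst c \<inter> fst c0)"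
  have tO: "t \<in> ?O" using p c0 by force
  have \<tau>t: "?\<tau> t = t0" unfolding transition_def t0_def p_def by simp
  obtain Z' where Z': "\<And>t. t \<in> chart_image c0 \<Longrightarrow> (unit_deriv K c0 u has_vector_derivative Z' t) (at t)"
    using unit_deriv_differentiable[OF u c0(1)] by blast
  \<comment> \<open>the orientation of the change of charts at the given point\<close>
  let ?\<sigma> = "sgn (deriv ?\<tau> t)" and ?d = "deriv ?\<tau>"
  have \<sigma>: "?\<sigma> * ?d t = \<bar>?d t\<bar>" "?d t \<noteq> 0" using transition_facts(5)[OF c c0(1) tO]
    by (auto simp: sgn_mult_abs abs_if sgn_if)
  have "continuous_on ?O (\<lambda>s. ?\<sigma> * ?d s)"
    by (intro continuous_intros transition_facts(3)[OF c c0(1)])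
  then have "open (?O \<inter> (\<lambda>s. ?\<sigma> * ?d s) -` {0<..})"
    by (rule continuous_open_preimage[OF _ transition_facts(1)[OF c c0(1)]]) simp
  \<comment> \<open>a neighbourhood on which the orientation does not change\<close>
  then obtain W where W: "open W" "t \<in> W" "W \<subseteq> ?O" "\<And>s. s \<in> W \<Longrightarrow> ?\<sigma> * ?d s > 0"
    using that[of "?O \<inter> (\<lambda>s. ?\<sigma> * ?d s) -` {0<..}"] tO \<sigma> by auto
  have near: "?\<sigma> *\<^sub>R unit_deriv K c0 u (?\<tau> s) = unit_deriv K c u s" if "s \<in> W" for s
  proof -
    have sO: "s \<in> ?O" using that W by blast
    have "sgn (?d s) = ?\<sigma>" using W(4)[OF that] \<sigma>(2) by (auto simp: sgn_if zero_less_mult_iff split: if_splits)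
    then show ?thesis
      using unit_deriv_change_chart[OF c c0(1) sO
        C1_fun_chart(1)[OF smooth_fun_imp_C1_fun[OF u] c0(1) transition_facts(6)[OF c c0(1) sO]]]
      by simp
  qed
  have "((\<lambda>s. ?\<sigma> *\<^sub>R (unit_deriv K c0 u \<circ> ?\<tau>) s) has_vector_derivative ?\<sigma> *\<^sub>R (?d t *\<^sub>R Z' t0)) (at t)"
    by (rule has_vector_derivative_scaleR[OF DERIV_const, simplified])
       (rule vector_diff_chain_at[OF transition_facts(2)[OF c c0(1) tO]], simp add: \<tau>t Z'[OF t0])
  then have "(unit_deriv K c u has_vector_derivative ?\<sigma> *\<^sub>R (?d t *\<^sub>R Z' t0)) (at t)"
    by (rule has_vector_derivative_transform_within_open[OF _ W(1,2)]) (simp add: near)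
  then have 1: "vector_derivative (unit_deriv K c u) (at t) = \<bar>?d t\<bar> *\<^sub>R Z' t0"
    using \<sigma> by (simp add: vector_derivative_at)
  have 2: "sqrt (metric K c t) = sqrt (metric K c0 t0) * \<bar>?d t\<bar>"
    using transition_facts(4)[OF c c0(1) tO] \<tau>t by (simp add: real_sqrt_mult)
  have "((\<lambda>s. (sqrt (metric K c0 s) * (1 / metric K c0 s)) *\<^sub>R vector_derivative (u \<circ> chart_inv c0) (at s))
      has_vector_derivative Z' t0) (at t0)"
  proof (rule has_vector_derivative_transform_within_open[OF Z'[OF t0] open_chart_image[OF c0(1)] t0])
    fix s assume "s \<in> chart_image c0"
    then have "metric K c0 s > 0" by (rule metric_pos[OF c0(1)])
    then have "sqrt (metric K c0 s) * (1 / metric K c0 s) = 1 / sqrt (metric K c0 s)"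
      by (simp add: field_simps)
    then show "unit_deriv K c0 u s = (sqrt (metric K c0 s) * (1 / metric K c0 s)) *\<^sub>R vector_derivative (u \<circ> chart_inv c0) (at s)"
      unfolding unit_deriv_def by simp
  qed
  then have "laplacian K u p = (1 / sqrt (metric K c0 t0)) *\<^sub>R Z' t0"
    unfolding laplacian_def Let_def c0_def[symmetric] t0_def[symmetric]
    by (simp add: vector_derivative_at)
  then show ?thesis unfolding 1 2 p_def using \<sigma>(2) by simp
qed

text \<open>
  With \<open>Z\<close> the arclength derivative of \<open>u\<close> these are the equations \<open>u' = G\<^sup>1\<^sup>/\<^sup>2 Z\<close> and \<open>Z' = G\<^sup>1\<^sup>/\<^sup>2 \<Delta>u\<close>: along a
  chart every statement about \<open>u\<close> and its Laplacian becomes one about a first order system.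
\<close>

lemma structure_equations:
  assumes u: "smooth_fun K u" and c: "c \<in> charts K" and t: "t \<in> chart_image c"
  shows "((u \<circ> chart_inv c) has_vector_derivative sqrt (metric K c t) *\<^sub>R unit_deriv K c u t) (at t)"
    and "(unit_deriv K c u has_vector_derivative
      sqrt (metric K c t) *\<^sub>R laplacian K u (chart_inv c t)) (at t)"
proof -
  have G: "metric K c t > 0" by (rule metric_pos[OF c t])
  show "((u \<circ> chart_inv c) has_vector_derivative sqrt (metric K c t) *\<^sub>R unit_deriv K c u t) (at t)"
    using C1_fun_chart(1)[OF smooth_fun_imp_C1_fun[OF u] c t] G unfolding unit_deriv_def by simp
  obtain Z' where "\<And>t. t \<in> chart_image c \<Longrightarrow> (unit_deriv K c u has_vector_derivative Z' t) (at t)"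
    using unit_deriv_differentiable[OF u c] by blast
  from this[OF t] show "(unit_deriv K c u has_vector_derivative
      sqrt (metric K c t) *\<^sub>R laplacian K u (chart_inv c t)) (at t)"
    unfolding laplacian_chart[OF u c t] using G by (simp add: vector_derivative_at)
qed

lemma continuous_on_chartwise:
  fixes u :: "'k \<Rightarrow> 'b::topological_space"
  assumes "\<And>c. c \<in> charts K \<Longrightarrow> continuous_on (chart_image c) (u \<circ> chart_inv c)"
  shows "continuous_on UNIV u"
proof -
  have "continuous_on (\<Union>c\<in>charts K. fst c) u"
  proof (rule continuous_on_open_UN)
    fix c assume c: "c \<in> charts K"
    show "open (fst c)" by (rule open_chart[OF c])
    have "continuous_on (fst c) ((u \<circ> chart_inv c) \<circ> snd c)"
    proof (rule continuous_on_compose[OF chart_inverse(5)[OF c]])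
      have "snd c ` fst c = chart_image c" unfolding chart_image_def ..
      then show "continuous_on (snd c ` fst c) (u \<circ> chart_inv c)" using assms[OF c] by simp
    qed
    then show "continuous_on (fst c) u"
      by (rule continuous_on_eq) (simp add: chart_inverse(4)[OF c])
  qed
  then show ?thesis unfolding charts_cover .
qed

lemma C1_fun_continuous: "C1_fun K u \<Longrightarrow> continuous_on UNIV u"
  by (rule continuous_on_chartwise) (rule C1_fun_chart(4))

lemma continuous_grad_prod:
  assumes "C1_fun K u" "C1_fun K v"
  shows "continuous_on UNIV (grad_prod K u v)"
proof (rule continuous_on_chartwise)
  fix c assume c: "c \<in> charts K"
  have "continuous_on (chart_image c) (\<lambda>t. unit_deriv K c u t * cnj (unit_deriv K c v t))"
    by (intro continuous_intros C1_fun_chart(3)[OF assms(1) c] C1_fun_chart(3)[OF assms(2) c])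
  then show "continuous_on (chart_image c) (grad_prod K u v \<circ> chart_inv c)"
    by (rule continuous_on_eq)
       (simp add: grad_prod_chart[OF assms c chart_inverse(1)[OF c]] chart_inverse(2)[OF c])
qed

lemma continuous_laplacian:
  assumes u: "smooth_fun K u"
  shows "continuous_on UNIV (laplacian K u)"
proof (rule continuous_on_chartwise)
  fix c assume c: "c \<in> charts K"
  obtain Z' where Z': "continuous_on (chart_image c) Z'"
    "\<And>t. t \<in> chart_image c \<Longrightarrow> (unit_deriv K c u has_vector_derivative Z' t) (at t)"
    using unit_deriv_differentiable[OF u c] by blast
  have "continuous_on (chart_image c) (\<lambda>t. (1 / sqrt (metric K c t)) *\<^sub>R Z' t)"
    using metric_pos[OF c]
    by (intro continuous_intros Z'(1) smooth_on_continuous[OF smooth_metric[OF c]])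
       (auto simp: less_imp_neq[symmetric])
  then show "continuous_on (chart_image c) (laplacian K u \<circ> chart_inv c)"
    by (rule continuous_on_eq) (simp add: laplacian_chart[OF u c] vector_derivative_at[OF Z'(2)])
qed

lemma open_chart_inv_image:
  assumes c: "c \<in> charts K" and "open U" "U \<subseteq> chart_image c"
  shows "open (chart_inv c ` U)" "snd c ` (chart_inv c ` U) = U" "chart_inv c ` U \<subseteq> fst c"
proof -
  have "open (fst c \<inter> snd c -` U)"
    by (rule continuous_open_preimage[OF chart_inverse(5)[OF c] open_chart[OF c] assms(2)])
  moreover have "fst c \<inter> snd c -` U = chart_inv c ` U"
    using assms(3) chart_inverse(1,2,4)[OF c] by force
  ultimately show "open (chart_inv c ` U)" by simp
  show "snd c ` (chart_inv c ` U) = U" using assms(3) chart_inverse(2)[OF c] by force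
  show "chart_inv c ` U \<subseteq> fst c" using assms(3) chart_inverse(1)[OF c] by auto
qed

text \<open>
  Every point has a neighbourhood of finite measure, because the metric component is bounded on
  a compact coordinate interval; finitely many of them cover the compact manifold.
\<close>

lemma finite_measure_vol: "finite_measure (vol K)"
proof -
  have loc: "\<exists>U. open U \<and> p \<in> U \<and> emeasure (vol K) U < \<infinity>" for p
  proof -
    obtain c where c: "c \<in> charts K" "p \<in> fst c" by (rule obtain_chart)
    obtain r where r: "r > 0" "cball (snd c p) r \<subseteq> chart_image c"
      using open_contains_cball open_chart_image[OF c(1)] chart_inverse(3)[OF c] by blast
    let ?B = "ball (snd c p) r" and ?U = "chart_inv c ` ball (snd c p) r"
    have B: "open ?B" "?B \<subseteq> chart_image c" using r ball_subset_cball[of "snd c p" r] by auto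
    have "compact ((\<lambda>t. sqrt (metric K c t)) ` cball (snd c p) r)"
      by (intro compact_continuous_image continuous_intros continuous_on_subset[OF
        smooth_on_continuous[OF smooth_metric[OF c(1)]] r(2)] compact_cball)
    then obtain C where C: "\<And>t. t \<in> cball (snd c p) r \<Longrightarrow> sqrt (metric K c t) \<le> C"
      using compact_imp_bounded bounded_real by (metis abs_le_iff image_eqI)
    have "emeasure (vol K) ?U = (\<integral>\<^sup>+t\<in>?B. ennreal (sqrt (metric K c t)) \<partial>lborel)"
      using emeasure_vol_chart open_chart_inv_image[OF c(1) B] c(1) by (simp add: borel_open)
    also have "\<dots> \<le> (\<integral>\<^sup>+t\<in>?B. ennreal C \<partial>lborel)"
      using C by (intro nn_integral_mono) (auto split: split_indicator intro!: ennreal_leI)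
    also have "\<dots> = ennreal C * emeasure lborel ?B" by (simp add: nn_integral_cmult_indicator)
    also have "\<dots> < \<infinity>" using emeasure_bounded_finite[OF bounded_ball, of "snd c p" r]
      by (auto simp: ennreal_mult_less_top)
    finally have fin: "emeasure (vol K) ?U < \<infinity>" .
    moreover have "p \<in> ?U"
      using r(1) chart_inverse(4)[OF c] by (intro image_eqI[of _ _ "snd c p"]) auto
    ultimately show ?thesis using open_chart_inv_image(1)[OF c(1) B] by blast
  qed
  then obtain U where U: "\<And>p. open (U p)" "\<And>p. p \<in> U p" "\<And>p. emeasure (vol K) (U p) < \<infinity>"
    by metis
  have "UNIV \<subseteq> (\<Union>p\<in>UNIV. U p)" using U(2) by blast
  then obtain P where P: "finite P" "UNIV \<subseteq> (\<Union>p\<in>P. U p)"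
    using compactE_image[OF compact_K, of UNIV U] U(1) by metis
  have "emeasure (vol K) UNIV \<le> emeasure (vol K) (\<Union>p\<in>P. U p)"
    using P U(1) by (intro emeasure_mono) (auto simp: sets_vol)
  also have "\<dots> \<le> (\<Sum>p\<in>P. emeasure (vol K) (U p))"
    using U(1) by (intro emeasure_subadditive_finite P(1)) (auto simp: sets_vol borel_open)
  also have "\<dots> < \<infinity>" using U(3) by (simp add: P(1) ennreal_sum_less_top)
  finally show ?thesis by (intro finite_measureI) (simp add: space_vol)
qed

text \<open>
  The density formula is given for the measure of sets inside one chart. It says that the
  restriction of the measure is the image of a measure on the line, whence the formula for
  integrals.
\<close>

lemma integral_vol_chart:
  fixes F :: "'k \<Rightarrow> complex"
  assumes c: "c \<in> charts K" and F: "F \<in> borel_measurable borel" and supp: "\<And>p. p \<notin> fst c \<Longrightarrow> F p = 0"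
  shows "(LINT p|vol K. F p) =
    (LINT t|lborel. indicator (chart_image c) t *\<^sub>R (sqrt (metric K c t) *\<^sub>R F (chart_inv c t)))"
proof -
  let ?I = "chart_image c"
  obtain p0 where "p0 \<in> fst c \<or> fst c = {}" by blast
  define h where "h t = (if t \<in> ?I then chart_inv c t else p0)" for t
  have openI: "open ?I" by (rule open_chart_image[OF c])
  have [measurable]: "?I \<in> sets borel" using openI by (rule borel_open)
  have [measurable]: "h \<in> borel_measurable borel"
    unfolding h_def[abs_def]
    by (rule borel_measurable_continuous_on_if) (auto intro: chart_inverse(6)[OF c])
  have fstc: "fst c \<in> sets borel" using open_chart[OF c] by (rule borel_open)
  have rho[measurable]: "(\<lambda>t. indicator ?I t * sqrt (metric K c t)) \<in> borel_measurable borel"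
    using borel_measurable_continuous_on_indicator[OF _ continuous_on_real_sqrt[OF
      smooth_on_continuous[OF smooth_metric[OF c]]]] by simp
  let ?N = "distr (density lborel (\<lambda>t. ennreal (indicator ?I t * sqrt (metric K c t)))) borel h"
  have eq: "density (vol K) (\<lambda>p. ennreal (indicator (fst c) p)) = ?N"
  proof (rule measure_eqI)
    fix A assume "A \<in> sets (density (vol K) (\<lambda>p. ennreal (indicator (fst c) p)))"
    then have A: "A \<in> sets borel" by (simp add: sets_vol)
    have [measurable]: "A \<in> sets (vol K)" "fst c \<in> sets (vol K)" using A fstc sets_vol by auto
    have "emeasure (density (vol K) (\<lambda>p. ennreal (indicator (fst c) p))) A =
        (\<integral>\<^sup>+p. ennreal (indicator (fst c) p) * indicator A p \<partial>vol K)"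
      by (subst emeasure_density) auto
    also have "\<dots> = (\<integral>\<^sup>+p. indicator (A \<inter> fst c) p \<partial>vol K)"
      by (intro nn_integral_cong) (simp split: split_indicator)
    also have "\<dots> = emeasure (vol K) (A \<inter> fst c)" by simp
    also have "\<dots> = (\<integral>\<^sup>+t\<in>snd c ` (A \<inter> fst c). ennreal (sqrt (metric K c t)) \<partial>lborel)"
      using emeasure_vol_chart c A fstc by (simp add: sets.Int)
    also have "snd c ` (A \<inter> fst c) = {t \<in> ?I. chart_inv c t \<in> A}"
      using chart_inverse(1-4)[OF c] by force
    also have "(\<integral>\<^sup>+t\<in>{t \<in> ?I. chart_inv c t \<in> A}. ennreal (sqrt (metric K c t)) \<partial>lborel) =
        (\<integral>\<^sup>+t. ennreal (indicator ?I t * sqrt (metric K c t)) * indicator (h -` A) t \<partial>lborel)"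
      by (intro nn_integral_cong) (auto simp: h_def split: split_indicator)
    also have "\<dots> = emeasure ?N A"
      using A measurable_sets[OF \<open>h \<in> borel_measurable borel\<close> A]
      by (subst emeasure_distr) (auto simp: emeasure_density)
    finally show "emeasure (density (vol K) (\<lambda>p. ennreal (indicator (fst c) p))) A = emeasure ?N A" .
  qed (simp add: sets_vol)
  have [measurable]: "F \<in> borel_measurable (vol K)" "fst c \<in> sets (vol K)"
    using F fstc by (simp_all add: sets_vol measurable_cong_sets[OF sets_vol refl])
  note F[measurable]
  have "(LINT p|vol K. F p) = (LINT p|vol K. indicator (fst c) p *\<^sub>R F p)"
    by (intro Bochner_Integration.integral_cong) (auto simp: supp split: split_indicator)
  also have "\<dots> = (LINT p|density (vol K) (\<lambda>p. ennreal (indicator (fst c) p)). F p)"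
    by (subst integral_density) auto
  also have "\<dots> = (LINT t|lborel. (indicator ?I t * sqrt (metric K c t)) *\<^sub>R F (h t))"
    unfolding eq using metric_pos[OF c]
    by (subst integral_distr, simp, simp, subst integral_density)
       (auto split: split_indicator intro!: less_imp_le)
  also have "\<dots> = (LINT t|lborel. indicator ?I t *\<^sub>R (sqrt (metric K c t) *\<^sub>R F (chart_inv c t)))"
    by (intro Bochner_Integration.integral_cong) (auto simp: h_def split: split_indicator)
  finally show ?thesis .
qed

end

section \<open>Bump functions and Green's identity on the curve\<close>

text \<open>
  Squaring the positive part removes its corner; this makes the bump functions below
  continuously differentiable.
\<close>

lemma has_real_derivative_pos_part_square:
  "((\<lambda>y::real. (max 0 y)\<^sup>2) has_real_derivative 2 * max 0 y) (at y)"
proof (cases "y = 0")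
  case True
  have "((\<lambda>h. (max 0 h)\<^sup>2 / h) \<longlongrightarrow> 0) (at (0::real))"
  proof (rule Lim_null_comparison[OF _ tendsto_rabs_zero[OF tendsto_ident_at]])
    show "\<forall>\<^sub>F h in at 0. norm ((max 0 h)\<^sup>2 / h) \<le> \<bar>h::real\<bar>"
      by (rule always_eventually) (auto simp: max_def power2_eq_square)
  qed
  then show ?thesis using True by (simp add: DERIV_def)
next
  case False
  show ?thesis
  proof (cases "y > 0")
    case True
    have "((\<lambda>y::real. y\<^sup>2) has_real_derivative 2 * max 0 y) (at y)"
      using True by (auto intro!: derivative_eq_intros)
    then show ?thesis
      by (rule DERIV_cong_ev[THEN iffD1, rotated -1])
         (use eventually_gt_at_top in \<open>auto intro!: eventually_mono[OF eventually_nhds_in_open[of "{0<..}"]] simp: True\<close>)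
  next
    case neg: False
    have "((\<lambda>y::real. 0) has_real_derivative 2 * max 0 y) (at y)"
      using neg by simp
    then show ?thesis
      by (rule DERIV_cong_ev[THEN iffD1, rotated -1])
         (use neg False in \<open>auto intro!: eventually_mono[OF eventually_nhds_in_open[of "{..<0}"]]\<close>)
  qed
qed

lemma C1_funI:
  assumes "\<And>c. c \<in> charts K \<Longrightarrow> continuous_on (chart_image c) (u' c)"
    and "\<And>c t. c \<in> charts K \<Longrightarrow> t \<in> chart_image c \<Longrightarrow>
      ((u \<circ> chart_inv c) has_vector_derivative u' c t) (at t)"
  shows "C1_fun K u"
  using assms unfolding C1_fun_def by (auto intro!: exI[of _ "u' _"])

context closed_curve begin

lemma C1_fun_add:
  assumes u: "C1_fun K u" and v: "C1_fun K v"
  shows "C1_fun K (\<lambda>p. u p + v p)"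
proof (rule C1_funI)
  fix c assume c: "c \<in> charts K"
  show "continuous_on (chart_image c)
      (\<lambda>t. vector_derivative (u \<circ> chart_inv c) (at t) + vector_derivative (v \<circ> chart_inv c) (at t))"
    by (intro continuous_intros C1_fun_chart(2)[OF u c] C1_fun_chart(2)[OF v c])
  show "((\<lambda>p. u p + v p) \<circ> chart_inv c has_vector_derivative
      vector_derivative (u \<circ> chart_inv c) (at t) + vector_derivative (v \<circ> chart_inv c) (at t)) (at t)"
    if "t \<in> chart_image c" for t
    using has_vector_derivative_add[OF C1_fun_chart(1)[OF u c that] C1_fun_chart(1)[OF v c that]]
    by (simp add: o_def)
qed

lemma C1_fun_mult:
  assumes u: "C1_fun K u" and v: "C1_fun K v"
  shows "C1_fun K (\<lambda>p. u p * v p)"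
proof (rule C1_funI)
  fix c assume c: "c \<in> charts K"
  show "continuous_on (chart_image c)
      (\<lambda>t. (u \<circ> chart_inv c) t * vector_derivative (v \<circ> chart_inv c) (at t) +
        vector_derivative (u \<circ> chart_inv c) (at t) * (v \<circ> chart_inv c) t)"
    by (intro continuous_intros C1_fun_chart(2,4)[OF u c] C1_fun_chart(2,4)[OF v c])
  show "((\<lambda>p. u p * v p) \<circ> chart_inv c has_vector_derivative
      (u \<circ> chart_inv c) t * vector_derivative (v \<circ> chart_inv c) (at t) +
        vector_derivative (u \<circ> chart_inv c) (at t) * (v \<circ> chart_inv c) t) (at t)"
    if "t \<in> chart_image c" for t
    using has_vector_derivative_mult[OF C1_fun_chart(1)[OF u c that] C1_fun_chart(1)[OF v c that]]
    by (simp add: o_def)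
qed

lemma C1_fun_inverse:
  assumes u: "C1_fun K u" and nz: "\<And>p. u p \<noteq> 0"
  shows "C1_fun K (\<lambda>p. inverse (u p))"
proof (rule C1_funI)
  fix c assume c: "c \<in> charts K"
  show "continuous_on (chart_image c)
      (\<lambda>t. vector_derivative (u \<circ> chart_inv c) (at t) * - (inverse ((u \<circ> chart_inv c) t) ^ Suc (Suc 0)))"
    by (intro continuous_intros C1_fun_chart(2,4)[OF u c]) (simp add: nz)
  show "((\<lambda>p. inverse (u p)) \<circ> chart_inv c has_vector_derivative
      vector_derivative (u \<circ> chart_inv c) (at t) * - (inverse ((u \<circ> chart_inv c) t) ^ Suc (Suc 0))) (at t)"
    if "t \<in> chart_image c" for t
    using field_vector_diff_chain_at[OF C1_fun_chart(1)[OF u c that] DERIV_inverse, OF _] nz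
    by (simp add: o_def)
qed

lemma C1_fun_const: "C1_fun K (\<lambda>p. a)"
  by (rule C1_funI[of _ "\<lambda>_ _. 0"]) (auto simp: o_def)

lemma C1_fun_sum:
  assumes "\<And>i. i \<in> P \<Longrightarrow> C1_fun K (w i)"
  shows "C1_fun K (\<lambda>p. \<Sum>i\<in>P. w i p)"
  using assms by (induction P rule: infinite_finite_induct) (auto intro: C1_fun_add C1_fun_const)

lemma grad_prod_sum_left:
  assumes w: "\<And>i. i \<in> P \<Longrightarrow> C1_fun K (w i)" and u: "C1_fun K u"
  shows "grad_prod K (\<lambda>p. \<Sum>i\<in>P. w i p) u p = (\<Sum>i\<in>P. grad_prod K (w i) u p)"
proof -
  obtain c where c: "c \<in> charts K" "p \<in> fst c" by (rule obtain_chart)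
  have t: "snd c p \<in> chart_image c" by (rule chart_inverse(3)[OF c])
  have "((\<lambda>p. \<Sum>i\<in>P. w i p) \<circ> chart_inv c has_vector_derivative
      (\<Sum>i\<in>P. vector_derivative (w i \<circ> chart_inv c) (at (snd c p)))) (at (snd c p))"
    using has_vector_derivative_sum[OF C1_fun_chart(1)[OF w c(1) t]] by (simp add: o_def)
  then have "unit_deriv K c (\<lambda>p. \<Sum>i\<in>P. w i p) (snd c p) = (\<Sum>i\<in>P. unit_deriv K c (w i) (snd c p))"
    unfolding unit_deriv_def by (simp add: vector_derivative_at scaleR_sum_right)
  then show ?thesis
    using grad_prod_chart[OF C1_fun_sum[of P w, OF w] u c] grad_prod_chart[OF w u c]
    by (simp add: sum_distrib_right)
qed

lemma grad_prod_cnj: "grad_prod K u v p = cnj (grad_prod K v u p)"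
  unfolding grad_prod_def Let_def by (simp add: mult.commute)

lemma grad_prod_eq_0:
  assumes "open V" "p \<in> V" "\<And>q. q \<in> V \<Longrightarrow> w q = 0"
  shows "grad_prod K w u p = 0"
proof -
  define c where "c = chart_at K p"
  have c: "c \<in> charts K" "p \<in> fst c" unfolding c_def by (rule chart_at)+
  have "((\<lambda>_. 0) has_vector_derivative 0) (at (snd c p))" by simp
  then have "(w \<circ> chart_inv c has_vector_derivative 0) (at (snd c p))"
    by (rule has_vector_derivative_transform_within_open[OF _ chart_preimage_open[OF c(1) assms(1)]])
       (auto simp: assms chart_inverse[OF c(1)] c)
  then show ?thesis
    unfolding grad_prod_def c_def[symmetric] Let_def by (simp add: vector_derivative_at)
qed

lemma integrable_continuous_vol:
  fixes F :: "'k \<Rightarrow> 'b::{banach, second_countable_topology}"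
  assumes "continuous_on UNIV F"
  shows "integrable (vol K) F"
proof -
  have "bounded (range F)" by (intro compact_imp_bounded compact_continuous_image assms compact_K)
  then obtain B where "\<And>p. norm (F p) \<le> B" unfolding bounded_iff by blast
  moreover have "F \<in> borel_measurable (vol K)"
    using borel_measurable_continuous_onI[OF assms]
    by (simp add: measurable_cong_sets[OF sets_vol refl])
  ultimately show ?thesis
    by (intro finite_measure.integrable_const_bound[OF finite_measure_vol]) auto
qed

lemma chart_inv_notin_image:
  assumes c: "c \<in> charts K" and S: "S \<subseteq> chart_image c" and t: "t \<in> chart_image c" "t \<notin> S"
  shows "chart_inv c t \<notin> chart_inv c ` S"
proof
  assume "chart_inv c t \<in> chart_inv c ` S"
  then obtain s where s: "s \<in> S" "chart_inv c t = chart_inv c s" by blast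
  then have "t = s" using chart_inverse(2)[OF c t(1)] chart_inverse(2)[OF c, of s] S by auto
  then show False using s t by simp
qed

text \<open>
  For a function supported inside one coordinate interval, Green's identity is the fundamental
  theorem of calculus: in the coordinate the integrand is the derivative of \<open>w\<close> times the
  conjugate arclength derivative of \<open>u\<close>, and this product vanishes at both ends of the interval.
\<close>

lemma green_compact_support_in_chart:
  assumes w: "C1_fun K w" and u: "smooth_fun K u" and c: "c \<in> charts K"
    and r: "r > 0" "cball t0 r \<subseteq> chart_image c"
    and supp: "\<And>p. p \<notin> chart_inv c ` ball t0 r \<Longrightarrow> w p = 0"
  shows "(LINT p|vol K. grad_prod K w u p + w p * cnj (laplacian K u p)) = 0"
proof -
  define F where "F p = grad_prod K w u p + w p * cnj (laplacian K u p)" for p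
  let ?Q = "chart_inv c ` cball t0 r"
  let ?Z = "unit_deriv K c u" and ?W = "unit_deriv K c w" and ?s = "\<lambda>t. sqrt (metric K c t)"
  have uC1: "C1_fun K u" by (rule smooth_fun_imp_C1_fun[OF u])
  have contF: "continuous_on UNIV F"
    unfolding F_def[abs_def]
    by (intro continuous_intros continuous_grad_prod w uC1 C1_fun_continuous continuous_laplacian u)
  have "compact ?Q"
    by (intro compact_continuous_image continuous_on_subset[OF chart_inverse(6)[OF c] r(2)] compact_cball)
  then have "open (- ?Q)" using compact_imp_closed by blast
  moreover have w0: "w q = 0" if "q \<in> - ?Q" for q
    using that by (intro supp) auto
  ultimately have F0: "F p = 0" if "p \<notin> ?Q" for p
    using grad_prod_eq_0[of "- ?Q" p w u] that unfolding F_def by simp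
  define g where "g t = w (chart_inv c t) * cnj (?Z t)" for t
  define g' where "g' t = w (chart_inv c t) * cnj (?s t *\<^sub>R laplacian K u (chart_inv c t)) +
      (?s t *\<^sub>R ?W t) * cnj (?Z t)" for t
  have dg: "(g has_vector_derivative g' t) (at t)" if t: "t \<in> chart_image c" for t
  proof -
    have "((w \<circ> chart_inv c) has_vector_derivative ?s t *\<^sub>R ?W t) (at t)"
      using C1_fun_chart(1)[OF w c t] metric_pos[OF c t] unfolding unit_deriv_def by simp
    from has_vector_derivative_mult[OF this has_vector_derivative_cnj[OF structure_equations(2)[OF u c t]]]
    show ?thesis unfolding g_def[abs_def] g'_def by (simp add: o_def)
  qed
  have gF: "?s t *\<^sub>R F (chart_inv c t) = g' t" if t: "t \<in> chart_image c" for t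
    unfolding g'_def F_def using grad_prod_chart[OF w uC1 c chart_inverse(1)[OF c t]] chart_inverse(2)[OF c t]
    by (simp add: algebra_simps)
  have "(LINT p|vol K. F p) = (LINT t|lborel. indicator (chart_image c) t *\<^sub>R (?s t *\<^sub>R F (chart_inv c t)))"
  proof (rule integral_vol_chart[OF c])
    show "F \<in> borel_measurable borel" by (rule borel_measurable_continuous_onI[OF contF])
    show "F p = 0" if "p \<notin> fst c" for p using that r(2) chart_inverse(1)[OF c] by (intro F0) auto
  qed
  also have "\<dots> = (LINT t|lborel. indicator {t0 - r..t0 + r} t *\<^sub>R g' t)"
  proof (intro Bochner_Integration.integral_cong refl)
    fix t
    show "indicator (chart_image c) t *\<^sub>R (?s t *\<^sub>R F (chart_inv c t)) = indicator {t0 - r..t0 + r} t *\<^sub>R g' t"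
    proof (cases "t \<in> cball t0 r")
      case True
      then have "t \<in> chart_image c" "t \<in> {t0 - r..t0 + r}" using r by (auto simp: dist_real_def)
      then show ?thesis by (simp only: gF indicator_simps)
    next
      case False
      then have "t \<notin> {t0 - r..t0 + r}" by (auto simp: dist_real_def)
      moreover have "F (chart_inv c t) = 0" if "t \<in> chart_image c"
      proof (rule F0)
        show "chart_inv c t \<notin> ?Q"
          by (rule chart_inv_notin_image[OF c r(2) that False])
      qed
      ultimately show ?thesis by (cases "t \<in> chart_image c") simp_all
    qed
  qed
  also have "\<dots> = g (t0 + r) - g (t0 - r)"
  proof (rule integral_FTC_atLeastAtMost)
    have sub: "{t0 - r..t0 + r} \<subseteq> chart_image c" using r(2) by (simp add: cball_eq_atLeastAtMost)
    show "(g has_vector_derivative g' t) (at t within {t0 - r..t0 + r})"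
      if "t0 - r \<le> t" "t \<le> t0 + r" for t
      by (rule has_vector_derivative_at_within[OF dg]) (use sub that in auto)
    have "continuous_on (chart_image c) (\<lambda>t. F (chart_inv c t))"
      by (rule continuous_on_compose2[OF contF chart_inverse(6)[OF c] subset_UNIV])
    then have "continuous_on (chart_image c) (\<lambda>t. ?s t *\<^sub>R F (chart_inv c t))"
      by (intro continuous_on_scaleR continuous_on_real_sqrt smooth_on_continuous[OF smooth_metric[OF c]])
    then have "continuous_on (chart_image c) g'" by (rule continuous_on_eq) (rule gF)
    then show "continuous_on {t0 - r..t0 + r} g'" using sub by (rule continuous_on_subset)
  qed (use r in simp)
  also have "\<dots> = 0"
  proof -
    have "w (chart_inv c t) = 0" if "t \<in> {t0 + r, t0 - r}" for t
    proof (rule supp)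
      have "t \<in> chart_image c" using that r by (auto simp: cball_eq_atLeastAtMost)
      moreover have "t \<notin> ball t0 r" using that r(1) by (auto simp: dist_real_def)
      ultimately show "chart_inv c t \<notin> chart_inv c ` ball t0 r"
        using r(2) ball_subset_cball by (intro chart_inv_notin_image[OF c]) auto
    qed
    then show ?thesis unfolding g_def by simp
  qed
  finally show ?thesis unfolding F_def .
qed

text \<open>
  A bump \<open>max(0, r\<^sup>2 - (t - t\<^sub>0)\<^sup>2)\<^sup>2\<close> in a coordinate, extended by zero. The extension is differentiable
  in every other chart because the closed coordinate interval is compact, hence closed in the
  manifold: each point either lies in the domain of the chart or has a neighbourhood on which
  the bump vanishes.
\<close>

lemma C1_bump:
  fixes p0 :: 'k
  obtains c t0 r and b :: "'k \<Rightarrow> real"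
  where "c \<in> charts K" "r > 0" "cball t0 r \<subseteq> chart_image c" "C1_fun K (\<lambda>p. of_real (b p))"
    "\<And>p. b p \<ge> 0" "b p0 > 0" "\<And>p. p \<notin> chart_inv c ` ball t0 r \<Longrightarrow> b p = 0"
proof -
  obtain c where c: "c \<in> charts K" "p0 \<in> fst c" by (rule obtain_chart)
  define t0 where "t0 = snd c p0"
  obtain r where r: "r > 0" "cball t0 r \<subseteq> chart_image c"
    using open_contains_cball open_chart_image[OF c(1)] chart_inverse(3)[OF c] t0_def by blast
  define b0 where "b0 t = (max 0 (r\<^sup>2 - (t - t0)\<^sup>2))\<^sup>2" for t
  define b0' where "b0' t = - 4 * (t - t0) * max 0 (r\<^sup>2 - (t - t0)\<^sup>2)" for t
  have db0: "(b0 has_real_derivative b0' t) (at t)" for t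
  proof -
    have "((\<lambda>t. r\<^sup>2 - (t - t0)\<^sup>2) has_real_derivative - (2 * (t - t0))) (at t)"
      by (auto intro!: derivative_eq_intros)
    from DERIV_chain2[OF has_real_derivative_pos_part_square this]
    show ?thesis unfolding b0_def[abs_def] b0'_def by (simp add: algebra_simps)
  qed
  have out: "r\<^sup>2 - (t - t0)\<^sup>2 \<le> 0" if "t \<notin> ball t0 r" for t
    using that r(1) by (auto simp: dist_real_def abs_le_square_iff[symmetric] abs_minus_commute)
  have b0_out: "b0 t = 0" "b0' t = 0" if "t \<notin> ball t0 r" for t
    using out[OF that] unfolding b0_def b0'_def by auto
  define b where "b p = (if p \<in> fst c then b0 (snd c p) else 0)" for p
  have b_out: "b p = 0" if "p \<notin> chart_inv c ` ball t0 r" for p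
    using that b0_out(1)[of "snd c p"] chart_inverse(4)[OF c(1)] unfolding b_def by (metis imageI)
  have C1: "C1_fun K (\<lambda>p. of_real (b p))"
  proof (rule C1_funI)
    fix c' assume c': "c' \<in> charts K"
    let ?O = "snd c' ` (fst c' \<inter> fst c)" and ?\<tau> = "transition c' c"
    let ?Q = "chart_inv c ` cball t0 r"
    let ?O2 = "{t \<in> chart_image c'. chart_inv c' t \<in> - ?Q}"
    let ?u' = "\<lambda>t. complex_of_real (if chart_inv c' t \<in> fst c then b0' (?\<tau> t) * deriv ?\<tau> t else 0)"
    have "compact ?Q"
      by (intro compact_continuous_image continuous_on_subset[OF chart_inverse(6)[OF c(1)] r(2)] compact_cball)
    then have opQ: "open (- ?Q)" using compact_imp_closed by blast
    have Qc: "?Q \<subseteq> fst c" using r(2) chart_inverse(1)[OF c(1)] by auto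
    have cov: "chart_image c' = ?O \<union> ?O2" unfolding overlap_eq[OF c'] using Qc by auto
    have op: "open ?O" "open ?O2"
      by (rule transition_facts(1)[OF c' c(1)], rule chart_preimage_open[OF c' opQ])
    have inO: "chart_inv c' t \<in> fst c \<and> snd c (chart_inv c' t) = ?\<tau> t" if "t \<in> ?O" for t
      using that unfolding overlap_eq[OF c'] transition_def by auto
    have u'O2: "?u' t = 0" if "t \<in> ?O2" for t
    proof -
      have "?\<tau> t \<notin> ball t0 r" if f: "chart_inv c' t \<in> fst c"
      proof
        assume "?\<tau> t \<in> ball t0 r"
        then have "chart_inv c (?\<tau> t) \<in> ?Q" by (intro imageI) auto
        then show False using \<open>t \<in> ?O2\<close> f chart_inverse(4)[OF c(1)] unfolding transition_def by auto
      qed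
      then show ?thesis using b0_out(2) by simp
    qed
    have "continuous_on ?O (\<lambda>t. complex_of_real (b0' (?\<tau> t) * deriv ?\<tau> t))"
    proof (intro continuous_intros transition_facts(3)[OF c' c(1)])
      have "isCont ?\<tau> t" if "t \<in> ?O" for t
        by (rule has_vector_derivative_continuous[OF transition_facts(2)[OF c' c(1) that]])
      then have "continuous_on ?O ?\<tau>" by (simp add: continuous_at_imp_continuous_on)
      then show "continuous_on ?O (\<lambda>t. b0' (?\<tau> t))"
        unfolding b0'_def
        by (intro continuous_on_mult continuous_on_max continuous_on_diff continuous_on_power
          continuous_on_const)
    qed
    then have 1: "continuous_on ?O ?u'" by (rule continuous_on_eq) (simp add: inO)
    have 2: "continuous_on ?O2 ?u'" by (rule continuous_on_eq[OF continuous_on_const]) (simp only: u'O2)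
    show "continuous_on (chart_image c') ?u'"
      by (subst cov) (rule continuous_on_open_Un[OF op 1 2])
    fix t assume "t \<in> chart_image c'"
    then have "t \<in> ?O \<union> ?O2" by (rule subst[OF cov])
    then show "((\<lambda>p. complex_of_real (b p)) \<circ> chart_inv c' has_vector_derivative ?u' t) (at t)"
    proof
      assume 1: "t \<in> ?O"
      have "(?\<tau> has_real_derivative deriv ?\<tau> t) (at t)"
        using transition_facts(2)[OF c' c(1) 1] by (simp only: has_real_derivative_iff_has_vector_derivative)
      from has_vector_derivative_of_real[OF DERIV_chain2[OF db0 this]]
      have "((\<lambda>x. complex_of_real (b0 (?\<tau> x))) has_vector_derivative ?u' t) (at t)"
        using inO[OF 1] by simp
      then show ?thesis
        by (rule has_vector_derivative_transform_within_open[OF _ op(1) 1]) (simp add: b_def inO)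
    next
      assume 2: "t \<in> ?O2"
      have "((\<lambda>x. 0) has_vector_derivative ?u' t) (at t)" unfolding u'O2[OF 2] by simp
      then show ?thesis
      proof (rule has_vector_derivative_transform_within_open[OF _ op(2) 2])
        fix s assume "s \<in> ?O2"
        then have "chart_inv c' s \<notin> chart_inv c ` ball t0 r" using ball_subset_cball by blast
        then show "0 = ((\<lambda>p. complex_of_real (b p)) \<circ> chart_inv c') s" by (simp add: b_out)
      qed
    qed
  qed
  have "b p \<ge> 0" for p unfolding b_def b0_def by simp
  moreover have "b p0 > 0" unfolding b_def b0_def t0_def[symmetric] using c(2) r(1) by simp
  ultimately show ?thesis using that[OF c(1) r C1] b_out by blast
qed

end

context closed_curve begin

text \<open>
  Partition of unity: dividing finitely many bumps by their sum, which is positive everywhere,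
  splits \<open>w\<close> into functions supported in coordinate intervals, for which the identity is known.
\<close>

lemma green_identity:
  assumes w: "C1_fun K w" and u: "smooth_fun K u"
  shows "(LINT p|vol K. grad_prod K w u p) = - (LINT p|vol K. w p * cnj (laplacian K u p))"
proof -
  define bump :: "'k \<Rightarrow> ('k \<Rightarrow> real) \<Rightarrow> bool" where
    "bump p b \<longleftrightarrow> (\<exists>c t0 r. c \<in> charts K \<and> r > 0 \<and> cball t0 r \<subseteq> chart_image c \<and>
      C1_fun K (\<lambda>p. of_real (b p)) \<and> (\<forall>p. b p \<ge> 0) \<and> b p > 0 \<and>
      (\<forall>p. p \<notin> chart_inv c ` ball t0 r \<longrightarrow> b p = 0))" for p b
  have "\<exists>b. bump p b" for p unfolding bump_def using C1_bump[of p] by metis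
  then obtain b where b: "\<And>i. bump i (b i)" by metis
  have bC1: "C1_fun K (\<lambda>p. of_real (b i p))" and b0: "b i p \<ge> 0" and bi: "b i i > 0" for i p
    using b[of i] unfolding bump_def by blast+
  have op: "open {p. b i p > 0}" for i
  proof -
    have "continuous_on UNIV (\<lambda>p. Re (of_real (b i p)))"
      by (intro continuous_intros C1_fun_continuous bC1)
    then have "continuous_on UNIV (b i)" by simp
    then show ?thesis by (intro open_Collect_less continuous_on_const)
  qed
  have cov: "UNIV \<subseteq> (\<Union>i\<in>UNIV. {p. b i p > 0})" using bi by auto
  obtain P where P: "P \<subseteq> UNIV" "finite P" "UNIV \<subseteq> (\<Union>i\<in>P. {p. b i p > 0})"
    by (rule compactE_image[OF compact_K op cov])
  define B where "B p = (\<Sum>i\<in>P. b i p)" for p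
  have Bpos: "B p > 0" for p
  proof -
    obtain i where i: "i \<in> P" "b i p > 0" using P(3) by auto
    then show ?thesis unfolding B_def
      using sum_pos2[of P i "\<lambda>i. b i p"] b0 P(2) by simp
  qed
  define \<zeta> where "\<zeta> i p = of_real (b i p) * (inverse (of_real (B p)) * w p)" for i p
  have "C1_fun K (\<lambda>p. \<Sum>i\<in>P. of_real (b i p))" by (intro C1_fun_sum bC1)
  then have BC1: "C1_fun K (\<lambda>p. of_real (B p))" unfolding B_def by simp
  have \<zeta>C1: "C1_fun K (\<zeta> i)" for i
    unfolding \<zeta>_def[abs_def] using Bpos
    by (intro C1_fun_mult C1_fun_inverse bC1 BC1 w) (simp add: less_imp_neq[symmetric])
  have w_eq: "w p = (\<Sum>i\<in>P. \<zeta> i p)" for p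
  proof -
    have "(\<Sum>i\<in>P. \<zeta> i p) = of_real (B p) * (inverse (of_real (B p)) * w p)"
      unfolding \<zeta>_def B_def by (simp add: sum_distrib_right)
    then show ?thesis using Bpos[of p] by (simp add: mult.assoc[symmetric] less_imp_neq[symmetric])
  qed
  have uC1: "C1_fun K u" by (rule smooth_fun_imp_C1_fun[OF u])
  have int: "integrable (vol K) (grad_prod K v u)"
    "integrable (vol K) (\<lambda>p. v p * cnj (laplacian K u p))" if v: "C1_fun K v" for v
    by (intro integrable_continuous_vol continuous_grad_prod v uC1)
       (intro integrable_continuous_vol continuous_on_mult continuous_on_cnj C1_fun_continuous v
          continuous_laplacian u)
  have zero: "(LINT p|vol K. grad_prod K (\<zeta> i) u p + \<zeta> i p * cnj (laplacian K u p)) = 0" for i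
  proof -
    obtain c t0 r where "c \<in> charts K" "r > 0" "cball t0 r \<subseteq> chart_image c"
      "\<And>p. p \<notin> chart_inv c ` ball t0 r \<Longrightarrow> b i p = 0"
      using b[of i] unfolding bump_def by blast
    then show ?thesis
      by (intro green_compact_support_in_chart[OF \<zeta>C1 u]) (auto simp: \<zeta>_def)
  qed
  have "grad_prod K w u p + w p * cnj (laplacian K u p) =
      (\<Sum>i\<in>P. grad_prod K (\<zeta> i) u p + \<zeta> i p * cnj (laplacian K u p))" for p
  proof -
    have weq: "w = (\<lambda>p. \<Sum>i\<in>P. \<zeta> i p)" using w_eq by (rule ext)
    have "grad_prod K w u p = (\<Sum>i\<in>P. grad_prod K (\<zeta> i) u p)"
      by (subst weq) (rule grad_prod_sum_left[OF \<zeta>C1 uC1])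
    then show ?thesis by (simp only: w_eq[of p] sum.distrib sum_distrib_right)
  qed
  then have "(LINT p|vol K. grad_prod K w u p + w p * cnj (laplacian K u p)) =
      (\<Sum>i\<in>P. LINT p|vol K. grad_prod K (\<zeta> i) u p + \<zeta> i p * cnj (laplacian K u p))"
    using int[OF \<zeta>C1] by simp
  then show ?thesis using int[OF w] by (simp add: zero eq_neg_iff_add_eq_0)
qed

text \<open>
  Eigenfunctions on a closed curve are bounded independently of the eigenvalue. The equation
  \<open>u'' = - m u\<close> in arclength is a harmonic oscillator, so the energy \<open>m \<bar>u\<bar>\<^sup>2 + \<bar>u'\<bar>\<^sup>2\<close> is constant on the
  connected curve. By Green's identity both of its terms have integral \<open>m\<close>; hence the constant
  is \<open>2 m\<close> divided by the length, and it dominates \<open>m \<bar>u\<bar>\<^sup>2\<close> pointwise.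
\<close>

lemma eigenfunction_bound:
  assumes u: "smooth_fun K u" and eig: "\<And>p. - laplacian K u p = of_real m * u p"
    and m: "m > 0" and norm: "inner_L2 (vol K) u u = 1"
  shows "(cmod (u p))\<^sup>2 \<le> 2 / measure (vol K) UNIV"
proof -
  let ?V = "measure (vol K) UNIV"
  interpret finite_measure "vol K" by (rule finite_measure_vol)
  define e where "e p = of_real m * (u p * cnj (u p)) + grad_prod K u u p" for p
  have uC1: "C1_fun K u" by (rule smooth_fun_imp_C1_fun[OF u])
  have lap: "laplacian K u p = - (of_real m * u p)" for p using eig[of p] by (metis minus_minus)
  \<comment> \<open>conservation of energy in a coordinate interval\<close>
  have ev: "\<forall>\<^sub>F q in at p. e p = e q" for p
  proof -
    obtain c where c: "c \<in> charts K" "p \<in> fst c" by (rule obtain_chart)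
    obtain r where r: "r > 0" "ball (snd c p) r \<subseteq> chart_image c"
      using open_chart_image[OF c(1)] chart_inverse(3)[OF c] by (auto simp: open_contains_ball)
    let ?B = "ball (snd c p) r"
    let ?u = "u \<circ> chart_inv c" and ?Z = "unit_deriv K c u"
    let ?e = "\<lambda>t. of_real m * (?u t * cnj (?u t)) + ?Z t * cnj (?Z t)"
    have ee: "e (chart_inv c t) = ?e t" if "t \<in> chart_image c" for t
      unfolding e_def using grad_prod_chart[OF uC1 uC1 c(1) chart_inverse(1)[OF c(1) that]]
      by (simp add: chart_inverse(2)[OF c(1) that])
    have "(?e has_vector_derivative 0) (at t within ?B)" if "t \<in> ?B" for t
    proof -
      have t: "t \<in> chart_image c" using that r by auto
      note d = structure_equations[OF u c(1) t]
      let ?du = "sqrt (metric K c t) *\<^sub>R ?Z t" and ?dZ = "sqrt (metric K c t) *\<^sub>R laplacian K u (chart_inv c t)"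
      have "(?e has_vector_derivative
        of_real m * (?u t * cnj ?du + ?du * cnj (?u t)) + (?Z t * cnj ?dZ + ?dZ * cnj (?Z t))) (at t)"
        using has_vector_derivative_add[OF
          has_vector_derivative_mult_right[OF has_vector_derivative_mult[OF d(1) has_vector_derivative_cnj[OF d(1)]]]
          has_vector_derivative_mult[OF d(2) has_vector_derivative_cnj[OF d(2)]]] .
      moreover have "of_real m * (?u t * cnj ?du + ?du * cnj (?u t)) + (?Z t * cnj ?dZ + ?dZ * cnj (?Z t)) = 0"
        by (simp add: lap scaleR_conv_of_real algebra_simps)
      ultimately show ?thesis using has_vector_derivative_at_within by metis
    qed
    then have "\<exists>k. \<forall>t\<in>?B. ?e t = k"
      by (intro has_derivative_zero_constant) (auto simp: has_vector_derivative_def)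
    then obtain k where "\<forall>t\<in>?B. ?e t = k" by (rule exE)
    then have k: "?e t = k" if "t \<in> ?B" for t using that by (rule bspec)
    let ?U = "chart_inv c ` ?B"
    have "e q = k" if "q \<in> ?U" for q
    proof -
      obtain t where t: "t \<in> ?B" "q = chart_inv c t" using \<open>q \<in> ?U\<close> by (rule imageE)
      then have "t \<in> chart_image c" using r(2) by (rule_tac subsetD)
      then show ?thesis using ee[of t] k[OF t(1)] t(2) by simp
    qed
    moreover have "p \<in> ?U" using r(1) chart_inverse(4)[OF c] by (intro image_eqI[of _ _ "snd c p"]) auto
    moreover have "open ?U" by (rule open_chart_inv_image(1)[OF c(1) _ r(2)]) simp
    ultimately show ?thesis
      unfolding eventually_at_topological by (intro exI[of _ ?U]) simp
  qed
  have const: "e q = e p" for p q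
    by (rule connected_local_const[OF connected_K]) (use ev in auto)
  have int: "integrable (vol K) (\<lambda>p. u p * cnj (u p))" "integrable (vol K) (grad_prod K u u)"
    by (intro integrable_continuous_vol continuous_intros C1_fun_continuous uC1)
       (rule integrable_continuous_vol[OF continuous_grad_prod[OF uC1 uC1]])
  have "(LINT p|vol K. grad_prod K u u p) = of_real m * inner_L2 (vol K) u u"
    unfolding green_identity[OF uC1 u] lap inner_L2_def
    by (simp add: mult.left_commute)
  then have "(LINT p|vol K. e p) = 2 * of_real m"
    unfolding e_def using int norm by (simp add: inner_L2_def)
  moreover have "(LINT q|vol K. e q) = of_real ?V * e p" for p
  proof -
    have "(LINT q|vol K. e q) = (LINT q|vol K. e p)"
      by (rule Bochner_Integration.integral_cong[OF refl const])
    then show ?thesis by (simp add: space_vol scaleR_conv_of_real)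
  qed
  ultimately have eV: "of_real ?V * e p = 2 * of_real m" for p by simp
  have Ree: "Re (e p) \<ge> m * (cmod (u p))\<^sup>2" for p
  proof -
    obtain c where c: "c \<in> charts K" "p \<in> fst c" by (rule obtain_chart)
    show ?thesis unfolding e_def grad_prod_chart[OF uC1 uC1 c]
      by (simp add: complex_mult_cnj cmod_power2 flip: of_real_power of_real_add of_real_mult)
  qed
  have eV': "?V * Re (e p) = 2 * m" for p using arg_cong[OF eV[of p], of Re] by simp
  have "?V \<noteq> 0" using eV'[of undefined] m by auto
  then have V: "?V > 0" by (simp add: zero_less_measure_iff less_le)
  have "?V * (m * (cmod (u p))\<^sup>2) \<le> 2 * m" using mult_left_mono[OF Ree[of p], of ?V] eV'[of p] V by simp
  then show "(cmod (u p))\<^sup>2 \<le> 2 / ?V" using m V by (simp add: field_simps)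
qed

end

section \<open>Calculus and integration on the cylinder\<close>

lemma vector_derivative_unit_interval:
  assumes "(g has_vector_derivative d) (at x within {0..1})" "x \<in> {0..1::real}"
  shows "vector_derivative g (at x within {0..1}) = d"
  using vector_derivative_within_cbox[of 0 1 x g d] assms by simp

definition cyl_dx :: "(real \<times> 'k \<Rightarrow> complex) \<Rightarrow> real \<times> 'k \<Rightarrow> complex" where
  "cyl_dx v z = vector_derivative (\<lambda>s. v (s, snd z)) (at (fst z) within {0..1})"

text \<open>
  The product measure without the conformal factor. In dimension two the factor \<open>f\<close> of the area
  cancels the factor \<open>1 / f\<close> of the gradient product, so Dirichlet forms are integrals with
  respect to this measure.
\<close>

definition base_measure :: "'k riem_manifold1 \<Rightarrow> (real \<times> 'k) measure" where
  "base_measure K = restrict_space lborel {0..1} \<Otimes>\<^sub>M vol K"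

context closed_curve begin

lemma grad_prod_diff_left:
  assumes v: "C1_fun K v" and w: "C1_fun K w" and u: "C1_fun K u"
  shows "grad_prod K (\<lambda>p. v p - w p) u p = grad_prod K v u p - grad_prod K w u p"
proof -
  have n: "C1_fun K (\<lambda>p. (- 1) * w p)" by (intro C1_fun_mult C1_fun_const w)
  obtain c where c: "c \<in> charts K" "p \<in> fst c" by (rule obtain_chart)
  have t: "snd c p \<in> chart_image c" by (rule chart_inverse(3)[OF c])
  have d: "((\<lambda>p. v p - w p) \<circ> chart_inv c has_vector_derivative
      vector_derivative (v \<circ> chart_inv c) (at (snd c p)) -
      vector_derivative (w \<circ> chart_inv c) (at (snd c p))) (at (snd c p))"
    using has_vector_derivative_diff[OF C1_fun_chart(1)[OF v c(1) t] C1_fun_chart(1)[OF w c(1) t]]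
    by (simp add: o_def)
  have "unit_deriv K c (\<lambda>p. v p - w p) (snd c p) = unit_deriv K c v (snd c p) - unit_deriv K c w (snd c p)"
    unfolding unit_deriv_def by (simp add: vector_derivative_at[OF d] scaleR_diff_right)
  moreover have "C1_fun K (\<lambda>p. v p - w p)" using C1_fun_add[OF v n] by simp
  ultimately show ?thesis
    using grad_prod_chart[OF _ u c] v w by (simp add: left_diff_distrib)
qed

lemma grad_prod_mult_right:
  assumes v: "C1_fun K v" and u: "C1_fun K u"
  shows "grad_prod K v (\<lambda>p. a * u p) p = cnj a * grad_prod K v u p"
proof -
  have au: "C1_fun K (\<lambda>p. a * u p)" by (intro C1_fun_mult C1_fun_const u)
  obtain c where c: "c \<in> charts K" "p \<in> fst c" by (rule obtain_chart)
  have t: "snd c p \<in> chart_image c" by (rule chart_inverse(3)[OF c])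
  have d: "((\<lambda>p. a * u p) \<circ> chart_inv c has_vector_derivative
      a * vector_derivative (u \<circ> chart_inv c) (at (snd c p))) (at (snd c p))"
    using has_vector_derivative_mult_right[OF C1_fun_chart(1)[OF u c(1) t]] by (simp add: o_def)
  have "unit_deriv K c (\<lambda>p. a * u p) (snd c p) = a * unit_deriv K c u (snd c p)"
    unfolding unit_deriv_def by (simp add: vector_derivative_at[OF d])
  then show ?thesis
    using grad_prod_chart[OF v _ c] u au by (simp add: mult_ac)
qed

lemma continuous_on_cyl_chartwise:
  fixes F :: "real \<times> 'k \<Rightarrow> 'b::topological_space"
  assumes "\<And>c. c \<in> charts K \<Longrightarrow> continuous_on ({0..1} \<times> chart_image c) (\<lambda>(x, t). F (x, chart_inv c t))"
  shows "continuous_on cyl F"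
  unfolding continuous_on_eq_continuous_within
proof
  fix z :: "real \<times> 'k" assume z: "z \<in> cyl"
  obtain c where c: "c \<in> charts K" "snd z \<in> fst c" by (rule obtain_chart)
  let ?A = "{0..1::real} \<times> fst c"
  have "continuous_on ?A ((\<lambda>(x, t). F (x, chart_inv c t)) \<circ> (\<lambda>z. (fst z, snd c (snd z))))"
  proof (rule continuous_on_compose)
    show "continuous_on ?A (\<lambda>z. (fst z, snd c (snd z)))"
      by (intro continuous_on_Pair continuous_on_fst continuous_on_id
        continuous_on_compose2[OF chart_inverse(5)[OF c(1)] continuous_on_snd[OF continuous_on_id]]) auto
    show "continuous_on ((\<lambda>z. (fst z, snd c (snd z))) ` ?A) (\<lambda>(x, t). F (x, chart_inv c t))"
      by (rule continuous_on_subset[OF assms[OF c(1)]]) (auto simp: chart_image_def)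
  qed
  then have "continuous_on ?A F"
    by (rule continuous_on_eq) (auto simp: chart_inverse(4)[OF c(1)])
  moreover have zA: "z \<in> ?A" using z c(2) by (cases z) (auto simp: cyl_def)
  ultimately have "continuous (at z within ?A) F"
    unfolding continuous_on_eq_continuous_within by (rule bspec)
  moreover have "at z within ?A = at z within cyl"
  proof (rule at_within_nhd)
    show "z \<in> UNIV \<times> fst c" using zA by auto
    show "open (UNIV \<times> fst c :: (real \<times> 'k) set)" by (intro open_Times open_UNIV open_chart c)
    show "?A \<inter> UNIV \<times> fst c - {z} = cyl \<inter> UNIV \<times> fst c - {z}" by (auto simp: cyl_def)
  qed
  ultimately show "continuous (at z within cyl) F" by simp
qed

text \<open>
  Dirichlet forms involve first derivatives; they are extracted here chart by chart, together with
  their joint continuity, which makes all integrands below bounded.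
\<close>

lemma smooth_cyl_jet:
  assumes v: "smooth_cyl K v" and c: "c \<in> charts K"
  obtains Dx Dt where
    "continuous_on ({0..1} \<times> chart_image c) (\<lambda>(x, t). v (x, chart_inv c t))"
    "continuous_on ({0..1} \<times> chart_image c) (\<lambda>(x, t). Dx x t)"
    "continuous_on ({0..1} \<times> chart_image c) (\<lambda>(x, t). Dt x t)"
    "\<And>x t. x \<in> {0..1} \<Longrightarrow> t \<in> chart_image c \<Longrightarrow>
      ((\<lambda>s. v (s, chart_inv c t)) has_vector_derivative Dx x t) (at x within {0..1})"
    "\<And>x t. x \<in> {0..1} \<Longrightarrow> t \<in> chart_image c \<Longrightarrow>
      (((\<lambda>q. v (x, q)) \<circ> chart_inv c) has_vector_derivative Dt x t) (at t)"
proof -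
  let ?I = "chart_image c"
  have "smooth_on2 {0..1} ?I (\<lambda>x t. v (x, chart_inv c t))"
    using v c unfolding smooth_cyl_def by blast
  then obtain D where D: "(\<forall>x\<in>{0..1}. \<forall>t\<in>?I. D 0 0 x t = v (x, chart_inv c t)) \<and>
        (\<forall>i j. continuous_on ({0..1} \<times> ?I) (\<lambda>(x, t). D i j x t)) \<and>
        (\<forall>i j. \<forall>x\<in>{0..1}. \<forall>t\<in>?I.
           ((\<lambda>s. D i j s t) has_vector_derivative D (Suc i) j x t) (at x within {0..1}) \<and>
           ((\<lambda>s. D i j x s) has_vector_derivative D i (Suc j) x t) (at t within ?I))"
    unfolding smooth_on2_def by (elim exE)
  note D0 = D[THEN conjunct1, rule_format]
  note Dc = D[THEN conjunct2, THEN conjunct1, rule_format]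
  note Dd = D[THEN conjunct2, THEN conjunct2, rule_format]
  show ?thesis
  proof (rule that[of "D (Suc 0) 0" "D 0 (Suc 0)"])
    show "continuous_on ({0..1} \<times> ?I) (\<lambda>(x, t). v (x, chart_inv c t))"
      by (rule continuous_on_eq[OF Dc[of 0 0]]) (auto intro!: D0)
    show "continuous_on ({0..1} \<times> ?I) (\<lambda>(x, t). D (Suc 0) 0 x t)"
      "continuous_on ({0..1} \<times> ?I) (\<lambda>(x, t). D 0 (Suc 0) x t)" by (rule Dc)+
    fix x t assume x: "x \<in> {0..1::real}" and t: "t \<in> ?I"
    show "((\<lambda>s. v (s, chart_inv c t)) has_vector_derivative D (Suc 0) 0 x t) (at x within {0..1})"
      by (rule has_vector_derivative_transform[OF x _ Dd[OF x t, THEN conjunct1]]) (simp add: D0 t)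
    have "((\<lambda>s. D 0 0 x s) has_vector_derivative D 0 (Suc 0) x t) (at t)"
      using Dd[OF x t, THEN conjunct2] by (simp only: at_within_open[OF t open_chart_image[OF c]])
    then show "(((\<lambda>q. v (x, q)) \<circ> chart_inv c) has_vector_derivative D 0 (Suc 0) x t) (at t)"
      by (rule has_vector_derivative_transform_within_open[OF _ open_chart_image[OF c] t]) (simp add: D0[OF x])
  qed
qed

lemma smooth_cyl_continuous:
  assumes v: "smooth_cyl K v"
  shows "continuous_on cyl v"
proof (rule continuous_on_cyl_chartwise)
  fix c assume c: "c \<in> charts K"
  show "continuous_on ({0..1} \<times> chart_image c) (\<lambda>(x, t). v (x, chart_inv c t))"
    by (rule smooth_cyl_jet[OF v c])
qed

lemma smooth_cyl_dx:
  assumes v: "smooth_cyl K v"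
  shows "x \<in> {0..1} \<Longrightarrow> ((\<lambda>s. v (s, p)) has_vector_derivative cyl_dx v (x, p)) (at x within {0..1})"
    and "continuous_on cyl (cyl_dx v)"
proof -
  have dx: "cyl_dx v (x, q) = d"
    if x: "x \<in> {0..1}" and "((\<lambda>s. v (s, q)) has_vector_derivative d) (at x within {0..1})"
    for x q d
    unfolding cyl_dx_def using vector_derivative_unit_interval[OF that(2) x] by simp
  show "((\<lambda>s. v (s, p)) has_vector_derivative cyl_dx v (x, p)) (at x within {0..1})" if x: "x \<in> {0..1}"
  proof -
    obtain c where c: "c \<in> charts K" "p \<in> fst c" by (rule obtain_chart)
    show ?thesis
    proof (rule smooth_cyl_jet[OF v c(1)])
      fix Dx :: "real \<Rightarrow> real \<Rightarrow> complex"
      assume "\<And>x t. x \<in> {0..1} \<Longrightarrow> t \<in> chart_image c \<Longrightarrow>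
        ((\<lambda>s. v (s, chart_inv c t)) has_vector_derivative Dx x t) (at x within {0..1})"
      from this[OF x chart_inverse(3)[OF c]] dx[OF x this[OF x chart_inverse(3)[OF c]]]
      show ?thesis unfolding chart_inverse(4)[OF c] by simp
    qed
  qed
  show "continuous_on cyl (cyl_dx v)"
  proof (rule continuous_on_cyl_chartwise)
    fix c assume c: "c \<in> charts K"
    show "continuous_on ({0..1} \<times> chart_image c) (\<lambda>(x, t). cyl_dx v (x, chart_inv c t))"
    proof (rule smooth_cyl_jet[OF v c(1)])
      fix Dx :: "real \<Rightarrow> real \<Rightarrow> complex"
      assume cont: "continuous_on ({0..1} \<times> chart_image c) (\<lambda>(x, t). Dx x t)"
        and d: "\<And>x t. x \<in> {0..1} \<Longrightarrow> t \<in> chart_image c \<Longrightarrow>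
        ((\<lambda>s. v (s, chart_inv c t)) has_vector_derivative Dx x t) (at x within {0..1})"
      show ?thesis by (rule continuous_on_eq[OF cont]) (auto simp: dx[OF _ d])
    qed
  qed
qed

lemma smooth_cyl_slice:
  assumes v: "smooth_cyl K v" and x: "x \<in> {0..1}"
  shows "C1_fun K (\<lambda>q. v (x, q))"
  unfolding C1_fun_def
proof
  fix c assume c: "c \<in> charts K"
  show "\<exists>u'. continuous_on (chart_image c) u' \<and>
     (\<forall>t\<in>chart_image c. (((\<lambda>q. v (x, q)) \<circ> chart_inv c) has_vector_derivative u' t) (at t))"
  proof (rule smooth_cyl_jet[OF v c])
    fix Dt :: "real \<Rightarrow> real \<Rightarrow> complex"
    assume cont: "continuous_on ({0..1} \<times> chart_image c) (\<lambda>(x, t). Dt x t)"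
      and d: "\<And>x t. x \<in> {0..1} \<Longrightarrow> t \<in> chart_image c \<Longrightarrow>
      (((\<lambda>q. v (x, q)) \<circ> chart_inv c) has_vector_derivative Dt x t) (at t)"
    have "continuous_on (chart_image c) (\<lambda>t. case (x, t) of (x, t) \<Rightarrow> Dt x t)"
      by (rule continuous_on_compose2[OF cont]) (use x in \<open>auto intro!: continuous_intros\<close>)
    then show ?thesis using d[OF x] by (intro exI[of _ "Dt x"]) auto
  qed
qed

lemma smooth_cyl_grad_prod:
  assumes v: "smooth_cyl K v" and w: "smooth_cyl K w"
  shows "continuous_on cyl (\<lambda>z. grad_prod K (\<lambda>q. v (fst z, q)) (\<lambda>q. w (fst z, q)) (snd z))"
proof (rule continuous_on_cyl_chartwise)
  fix c assume c: "c \<in> charts K"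
  let ?A = "{0..1::real} \<times> chart_image c"
  have unit: "continuous_on ?A (\<lambda>z. unit_deriv K c (\<lambda>q. u (fst z, q)) (snd z))" if u: "smooth_cyl K u" for u
  proof (rule smooth_cyl_jet[OF u c])
    fix Dt :: "real \<Rightarrow> real \<Rightarrow> complex"
    assume cont: "continuous_on ?A (\<lambda>(x, t). Dt x t)"
      and d: "\<And>x t. x \<in> {0..1} \<Longrightarrow> t \<in> chart_image c \<Longrightarrow>
      (((\<lambda>q. u (x, q)) \<circ> chart_inv c) has_vector_derivative Dt x t) (at t)"
    have "continuous_on ?A (\<lambda>z. metric K c (snd z))"
      by (rule continuous_on_compose2[OF smooth_on_continuous[OF smooth_metric[OF c]]])
         (auto intro: continuous_on_snd)
    then have "continuous_on ?A (\<lambda>z. (1 / sqrt (metric K c (snd z))) *\<^sub>R (\<lambda>(x, t). Dt x t) z)"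
      using metric_pos[OF c]
      by (intro continuous_on_scaleR cont continuous_on_divide continuous_on_const continuous_on_real_sqrt)
         (auto simp: less_imp_neq[symmetric])
    then show ?thesis
      by (rule continuous_on_eq) (auto simp: unit_deriv_def vector_derivative_at[OF d])
  qed
  have "continuous_on ?A (\<lambda>z. unit_deriv K c (\<lambda>q. v (fst z, q)) (snd z) *
      cnj (unit_deriv K c (\<lambda>q. w (fst z, q)) (snd z)))"
    by (intro continuous_on_mult continuous_on_cnj unit v w)
  then show "continuous_on ?A (\<lambda>(x, t). grad_prod K (\<lambda>q. v (fst (x, chart_inv c t), q))
      (\<lambda>q. w (fst (x, chart_inv c t), q)) (snd (x, chart_inv c t)))"
  proof (rule continuous_on_eq)
    fix z assume z: "z \<in> ?A"
    show "unit_deriv K c (\<lambda>q. v (fst z, q)) (snd z) * cnj (unit_deriv K c (\<lambda>q. w (fst z, q)) (snd z)) =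
       (\<lambda>(x, t). grad_prod K (\<lambda>q. v (fst (x, chart_inv c t), q))
      (\<lambda>q. w (fst (x, chart_inv c t), q)) (snd (x, chart_inv c t))) z"
      using z grad_prod_chart[OF smooth_cyl_slice[OF v] smooth_cyl_slice[OF w] c chart_inverse(1)[OF c], of "fst z" "fst z" "snd z"]
        chart_inverse(2)[OF c, of "snd z"]
      by (cases z) simp
  qed
qed

lemma space_base: "space (base_measure K) = cyl"
  unfolding base_measure_def by (simp add: space_pair_measure space_vol cyl_def)

lemma finite_measure_interval: "finite_measure (restrict_space lborel {0..1::real})"
  by (rule finite_measureI) (simp add: emeasure_restrict_space)

sublocale base: pair_sigma_finite "restrict_space lborel {0..1::real}" "vol K"
  by (intro pair_sigma_finite.intro finite_measure.axioms finite_measure_vol finite_measure_interval)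

lemma finite_measure_base: "finite_measure (base_measure K)"
  unfolding base_measure_def
  by (rule finite_measure_pair_measure[OF finite_measure_vol finite_measure_interval])

text \<open>
  The product sigma-algebra is the Borel sigma-algebra of the product, since both factors are
  second countable.
\<close>

lemma measurable_base:
  fixes F :: "real \<times> 'k \<Rightarrow> 'b::{banach, second_countable_topology}"
  assumes "continuous_on cyl F"
  shows "F \<in> borel_measurable (base_measure K)"
proof -
  have "closed (cyl :: (real \<times> 'k) set)" unfolding cyl_def by (intro closed_Times) auto
  then have G: "(\<lambda>z. indicator cyl z *\<^sub>R F z) \<in> borel_measurable borel"
    by (intro borel_measurable_continuous_on_indicator assms borel_closed)
  have "(\<lambda>z. z) \<in> base_measure K \<rightarrow>\<^sub>M borel \<Otimes>\<^sub>M borel"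
    unfolding base_measure_def
  proof (rule measurable_pair)
    show "fst \<circ> (\<lambda>z. z) \<in> restrict_space lborel {0..1} \<Otimes>\<^sub>M vol K \<rightarrow>\<^sub>M borel"
      unfolding o_def
      by (rule measurable_compose[OF measurable_fst]) (simp add: measurable_restrict_space1)
    show "snd \<circ> (\<lambda>z. z) \<in> restrict_space lborel {0..1} \<Otimes>\<^sub>M vol K \<rightarrow>\<^sub>M borel"
      unfolding o_def
      by (rule measurable_compose[OF measurable_snd]) (simp add: measurable_ident_sets[OF sets_vol])
  qed
  then have "(\<lambda>z. z) \<in> base_measure K \<rightarrow>\<^sub>M borel" by (simp add: borel_prod)
  from measurable_compose[OF this G]
  show ?thesis
    by (rule measurable_cong[THEN iffD1, rotated]) (simp add: space_base)
qed

lemma compact_cyl: "compact (cyl :: (real \<times> 'k) set)"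
  unfolding cyl_def by (intro compact_Times compact_K) auto

lemma integrable_base:
  fixes F :: "real \<times> 'k \<Rightarrow> 'b::{banach, second_countable_topology}"
  assumes "continuous_on cyl F"
  shows "integrable (base_measure K) F"
proof -
  have "bounded (F ` cyl)" by (intro compact_imp_bounded compact_continuous_image assms compact_cyl)
  then obtain B where "\<And>z. z \<in> cyl \<Longrightarrow> norm (F z) \<le> B" unfolding bounded_iff by blast
  then show ?thesis
    by (intro finite_measure.integrable_const_bound[OF finite_measure_base, of _ B] measurable_base assms)
       (auto simp: space_base)
qed

lemma fubini_base:
  fixes F :: "real \<times> 'k \<Rightarrow> complex"
  assumes "continuous_on cyl F"
  shows "(LINT z|base_measure K. F z) = (LINT x|restrict_space lborel {0..1}. LINT p|vol K. F (x, p))"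
    and "(LINT z|base_measure K. F z) = (LINT p|vol K. LINT x|restrict_space lborel {0..1}. F (x, p))"
proof -
  have i: "integrable (restrict_space lborel {0..1} \<Otimes>\<^sub>M vol K) F"
    using integrable_base[OF assms] unfolding base_measure_def .
  show "(LINT z|base_measure K. F z) = (LINT x|restrict_space lborel {0..1}. LINT p|vol K. F (x, p))"
    unfolding base_measure_def using base.integral_fst'[OF i] by simp
  show "(LINT z|base_measure K. F z) = (LINT p|vol K. LINT x|restrict_space lborel {0..1}. F (x, p))"
    unfolding base_measure_def using base.integral_snd[of "\<lambda>x p. F (x, p)"] i by simp
qed

end

locale conformal_cylinder = closed_curve K
  for K :: "'k::{t2_space, second_countable_topology} riem_manifold1" +
  fixes f :: "real \<Rightarrow> real"
  assumes f_continuous: "continuous_on {0..1} f"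
    and f_pos: "x \<in> {0..1} \<Longrightarrow> f x > 0"
begin

lemma vol_cyl_base: "vol_cyl K f = density (base_measure K) (\<lambda>z. ennreal (f (fst z)))"
  unfolding vol_cyl_def base_measure_def case_prod_beta ..

lemma continuous_f_fst: "continuous_on cyl (\<lambda>z. f (fst z))"
  by (rule continuous_on_compose2[OF f_continuous continuous_on_fst[OF continuous_on_id]])
     (auto simp: cyl_def)

lemma f_fst_pos: "z \<in> cyl \<Longrightarrow> f (fst z) > 0"
  by (auto simp: cyl_def intro: f_pos)

lemma space_vol_cyl: "space (vol_cyl K f) = cyl"
  unfolding vol_cyl_base by (simp add: space_base)

lemma integral_vol_cyl:
  fixes F :: "real \<times> 'k \<Rightarrow> complex"
  assumes "continuous_on cyl F"
  shows "(LINT z|vol_cyl K f. F z) = (LINT z|base_measure K. f (fst z) *\<^sub>R F z)"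
  unfolding vol_cyl_base
  by (rule integral_density) (use f_fst_pos in \<open>auto intro!: measurable_base continuous_f_fst assms AE_I2 less_imp_le simp: space_base\<close>)

lemma measurable_vol_cyl:
  fixes F :: "real \<times> 'k \<Rightarrow> 'b::{banach, second_countable_topology}"
  assumes "continuous_on cyl F"
  shows "F \<in> borel_measurable (vol_cyl K f)"
  unfolding vol_cyl_base using measurable_base[OF assms] by simp

lemma integrable_vol_cyl:
  fixes F :: "real \<times> 'k \<Rightarrow> 'b::{banach, second_countable_topology}"
  assumes "continuous_on cyl F"
  shows "integrable (vol_cyl K f) F"
proof -
  have "integrable (base_measure K) (\<lambda>z. f (fst z) *\<^sub>R F z)"
    by (intro integrable_base continuous_on_scaleR continuous_f_fst assms)
  then show ?thesis unfolding vol_cyl_base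
    by (subst integrable_density)
       (use f_fst_pos in \<open>auto intro!: measurable_base continuous_f_fst assms AE_I2 less_imp_le simp: space_base\<close>)
qed

lemma grad_prod_cyl_eq:
  "grad_prod_cyl K f u v z = (1 / f (fst z)) *\<^sub>R
    (cyl_dx u z * cnj (cyl_dx v z) + grad_prod K (\<lambda>q. u (fst z, q)) (\<lambda>q. v (fst z, q)) (snd z))"
  unfolding grad_prod_cyl_def cyl_dx_def by (simp add: case_prod_beta)

lemma continuous_grad_prod_cyl:
  assumes "smooth_cyl K u" "smooth_cyl K v"
  shows "continuous_on cyl (grad_prod_cyl K f u v)"
  unfolding grad_prod_cyl_eq[abs_def]
  by (intro continuous_on_scaleR continuous_on_divide continuous_on_const continuous_f_fst
    continuous_on_add continuous_on_mult continuous_on_cnj smooth_cyl_dx(2) smooth_cyl_grad_prod assms)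
    (metis f_fst_pos less_irrefl)

text \<open>
  Conformal invariance of the Dirichlet form in dimension two.
\<close>

lemma dirichlet_form_base:
  assumes "smooth_cyl K u" "smooth_cyl K v"
  shows "dirichlet_form K f u v = (LINT z|base_measure K. cyl_dx u z * cnj (cyl_dx v z) +
    grad_prod K (\<lambda>q. u (fst z, q)) (\<lambda>q. v (fst z, q)) (snd z))"
  unfolding dirichlet_form_def integral_vol_cyl[OF continuous_grad_prod_cyl[OF assms]]
proof (rule Bochner_Integration.integral_cong[OF refl])
  fix z assume "z \<in> space (base_measure K)"
  then have "f (fst z) > 0" by (simp add: space_base f_fst_pos)
  then show "f (fst z) *\<^sub>R grad_prod_cyl K f u v z = cyl_dx u z * cnj (cyl_dx v z) +
    grad_prod K (\<lambda>q. u (fst z, q)) (\<lambda>q. v (fst z, q)) (snd z)"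
    unfolding grad_prod_cyl_eq by simp
qed

lemma dirichlet_form_cnj: "dirichlet_form K f u v = cnj (dirichlet_form K f v u)"
proof -
  have "grad_prod_cyl K f u v z = cnj (grad_prod_cyl K f v u z)" for z
    unfolding grad_prod_cyl_eq by (subst grad_prod_cnj) (simp add: mult.commute)
  then have "grad_prod_cyl K f u v = (\<lambda>z. cnj (grad_prod_cyl K f v u z))" by (rule ext)
  then show ?thesis unfolding dirichlet_form_def by (simp only: Bochner_Integration.integral_cnj)
qed

lemma dirichlet_form_diff:
  assumes u: "smooth_cyl K u" and w: "smooth_cyl K w" and v: "smooth_cyl K v"
  shows "dirichlet_form K f (\<lambda>z. u z - w z) v = dirichlet_form K f u v - dirichlet_form K f w v"
proof -
  have pt: "grad_prod_cyl K f (\<lambda>z. u z - w z) v z = grad_prod_cyl K f u v z - grad_prod_cyl K f w v z"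
    if z: "z \<in> cyl" for z
  proof -
    have x: "fst z \<in> {0..1}" using z by (auto simp: cyl_def)
    have "cyl_dx (\<lambda>z. u z - w z) z = cyl_dx u z - cyl_dx w z"
      using vector_derivative_unit_interval[OF has_vector_derivative_diff[OF
        smooth_cyl_dx(1)[OF u x, of "snd z"] smooth_cyl_dx(1)[OF w x, of "snd z"]] x]
      by (simp add: cyl_dx_def)
    then show ?thesis unfolding grad_prod_cyl_eq
      using grad_prod_diff_left[OF smooth_cyl_slice[OF u x] smooth_cyl_slice[OF w x] smooth_cyl_slice[OF v x]]
      by (simp add: left_diff_distrib scaleR_diff_right scaleR_add_right)
  qed
  have "dirichlet_form K f (\<lambda>z. u z - w z) v = (LINT z|vol_cyl K f. grad_prod_cyl K f u v z - grad_prod_cyl K f w v z)"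
    unfolding dirichlet_form_def
    by (rule Bochner_Integration.integral_cong[OF refl]) (simp add: space_vol_cyl pt)
  also have "\<dots> = dirichlet_form K f u v - dirichlet_form K f w v"
    unfolding dirichlet_form_def
    by (intro Bochner_Integration.integral_diff integrable_vol_cyl continuous_grad_prod_cyl u v w)
  finally show ?thesis .
qed

end

section \<open>Convergence in the mean, null sets and boundary integrals\<close>

lemma L2_diff:
  assumes "u \<in> L2 N" "v \<in> L2 N"
  shows "(\<lambda>z. u z - v z) \<in> L2 N"
proof -
  have [measurable]: "u \<in> borel_measurable N" "v \<in> borel_measurable N"
    and i: "integrable N (\<lambda>z. 2 * (cmod (u z))\<^sup>2 + 2 * (cmod (v z))\<^sup>2)"
    using assms unfolding L2_def by auto
  have "integrable N (\<lambda>z. (cmod (u z - v z))\<^sup>2)"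
  proof (rule Bochner_Integration.integrable_bound[OF i])
    show "AE z in N. norm ((cmod (u z - v z))\<^sup>2) \<le> norm (2 * (cmod (u z))\<^sup>2 + 2 * (cmod (v z))\<^sup>2)"
    proof (rule AE_I2)
      fix z
      have "(cmod (u z - v z))\<^sup>2 \<le> (cmod (u z) + cmod (v z))\<^sup>2"
        by (intro power_mono norm_triangle_ineq4) auto
      also have "\<dots> \<le> 2 * (cmod (u z))\<^sup>2 + 2 * (cmod (v z))\<^sup>2"
        using sum_squares_bound[of "cmod (u z)" "cmod (v z)"] by (simp add: power2_sum)
      finally show "norm ((cmod (u z - v z))\<^sup>2) \<le> norm (2 * (cmod (u z))\<^sup>2 + 2 * (cmod (v z))\<^sup>2)" by simp
    qed
  qed measurable
  then show ?thesis unfolding L2_def by simp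
qed

lemma young_inequality:
  fixes a b t :: real
  assumes "t > 0"
  shows "a * b \<le> (a\<^sup>2 / t + t * b\<^sup>2) / 2"
proof -
  have "0 \<le> (a - t * b)\<^sup>2" by simp
  then have "2 * t * (a * b) \<le> a\<^sup>2 + t * (t * b\<^sup>2)" by (simp add: power2_diff power2_eq_square algebra_simps)
  then show ?thesis using assms by (simp add: field_simps)
qed

lemma L2_mult_integrable:
  assumes "u \<in> L2 N" "v \<in> L2 N"
  shows "integrable N (\<lambda>z. u z * cnj (v z))"
proof -
  have [measurable]: "u \<in> borel_measurable N" "v \<in> borel_measurable N"
    and i: "integrable N (\<lambda>z. ((cmod (u z))\<^sup>2 / 1 + 1 * (cmod (v z))\<^sup>2) / 2)"
    using assms unfolding L2_def by auto
  have [measurable]: "(\<lambda>z. cnj (v z)) \<in> borel_measurable N"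
    by (rule borel_measurable_continuous_on[OF continuous_on_cnj[OF continuous_on_id]]) measurable
  show ?thesis
  proof (rule Bochner_Integration.integrable_bound[OF i])
    show "AE z in N. norm (u z * cnj (v z)) \<le> norm (((cmod (u z))\<^sup>2 / 1 + 1 * (cmod (v z))\<^sup>2) / 2)"
      using young_inequality[of 1] by (intro AE_I2) (simp add: norm_mult)
  qed measurable
qed

text \<open>
  The weighted Young inequality splits the error into the square mean of \<open>S k - u\<close>, which tends to
  zero, and a fixed term that the weight makes small.
\<close>

lemma tendsto_inner_L2:
  assumes S: "tendsto_L2 N S u" and w: "w \<in> L2 N"
  shows "(\<lambda>k. inner_L2 N (S k) w) \<longlonglongrightarrow> inner_L2 N u w"
proof (rule LIMSEQ_I)
  fix e :: real assume e: "e > 0"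
  have Sk: "S k \<in> L2 N" and u: "u \<in> L2 N"
    and lim: "(\<lambda>k. LINT z|N. (cmod (S k z - u z))\<^sup>2) \<longlonglongrightarrow> 0" for k
    using S unfolding tendsto_L2_def by auto
  define A where "A = (LINT z|N. (cmod (w z))\<^sup>2)"
  have A: "A \<ge> 0" unfolding A_def by simp
  \<comment> \<open>the weight for which the fixed factor contributes less than \<open>e / 2\<close>\<close>
  define t where "t = e / (A + 1)"
  have t: "t > 0" "t * A < e" using e A unfolding t_def by (auto simp: field_simps)
  have "\<forall>\<^sub>F k in sequentially. (LINT z|N. (cmod (S k z - u z))\<^sup>2) < t * e"
    using order_tendstoD(2)[OF lim, of "t * e"] t e by simp
  then obtain n where n: "\<And>k. k \<ge> n \<Longrightarrow> (LINT z|N. (cmod (S k z - u z))\<^sup>2) < t * e"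
    unfolding eventually_sequentially by blast
  have "norm (inner_L2 N (S k) w - inner_L2 N u w) < e" if k: "k \<ge> n" for k
  proof -
    have D: "(\<lambda>z. S k z - u z) \<in> L2 N" by (rule L2_diff[OF Sk u])
    have i1: "integrable N (\<lambda>z. (cmod (S k z - u z))\<^sup>2)" "integrable N (\<lambda>z. (cmod (w z))\<^sup>2)"
      using D w unfolding L2_def by auto
    have "inner_L2 N (S k) w - inner_L2 N u w = (LINT z|N. (S k z - u z) * cnj (w z))"
      unfolding inner_L2_def
      using L2_mult_integrable[OF Sk w] L2_mult_integrable[OF u w]
      by (simp add: left_diff_distrib)
    also have "norm \<dots> \<le> (LINT z|N. norm ((S k z - u z) * cnj (w z)))"
      by (rule integral_norm_bound)
    also have "\<dots> \<le> (LINT z|N. ((cmod (S k z - u z))\<^sup>2 / t + t * (cmod (w z))\<^sup>2) / 2)"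
    proof (rule integral_mono)
      show "integrable N (\<lambda>z. norm ((S k z - u z) * cnj (w z)))"
        by (rule integrable_norm[OF L2_mult_integrable[OF D w]])
      show "integrable N (\<lambda>z. ((cmod (S k z - u z))\<^sup>2 / t + t * (cmod (w z))\<^sup>2) / 2)"
        using i1 by simp
      show "norm ((S k z - u z) * cnj (w z)) \<le> ((cmod (S k z - u z))\<^sup>2 / t + t * (cmod (w z))\<^sup>2) / 2" for z
        using young_inequality[OF t(1)] by (simp add: norm_mult)
    qed
    also have "\<dots> = ((LINT z|N. (cmod (S k z - u z))\<^sup>2) / t + t * A) / 2"
      unfolding A_def using i1 by simp
    also have "\<dots> < e"
    proof -
      have "(LINT z|N. (cmod (S k z - u z))\<^sup>2) / t < e" using n[OF k] t(1) by (simp add: field_simps)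
      then show ?thesis using t(2) by simp
    qed
    finally show ?thesis .
  qed
  then show "\<exists>n. \<forall>k\<ge>n. norm (inner_L2 N (S k) w - inner_L2 N u w) < e" by blast
qed

context closed_curve begin

text \<open>
  Nonempty open sets have positive measure because the density is positive in every chart.
\<close>

lemma AE_vol_continuous_eq_0:
  fixes g :: "'k \<Rightarrow> complex"
  assumes g: "continuous_on UNIV g" and ae: "AE p in vol K. g p = 0"
  shows "g p = 0"
proof (rule ccontr)
  assume p: "g p \<noteq> 0"
  obtain c where c: "c \<in> charts K" "p \<in> fst c" by (rule obtain_chart)
  let ?U = "{q. g q \<noteq> 0}" and ?I = "chart_image c"
  have opU: "open ?U" using g by (intro open_Collect_neq continuous_on_const)
  let ?N = "fst c \<inter> ?U" and ?O = "{t \<in> ?I. chart_inv c t \<in> ?U}"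
  have opN: "open ?N" by (intro open_Int open_chart[OF c(1)] opU)
  have opO: "open ?O" by (rule chart_preimage_open[OF c(1) opU])
  have [measurable]: "?O \<in> sets borel" using opO by (rule borel_open)
  have imN: "snd c ` ?N = ?O" using chart_inverse(1-4)[OF c(1)] by force
  have "emeasure (vol K) ?U = 0"
    using ae AE_iff_measurable[of ?U "vol K" "\<lambda>p. g p = 0"] opU by (simp add: sets_vol space_vol)
  then have "emeasure (vol K) ?N = 0"
    using emeasure_mono[of ?N ?U "vol K"] opU by (simp add: sets_vol)
  then have 0: "(\<integral>\<^sup>+t\<in>?O. ennreal (sqrt (metric K c t)) \<partial>lborel) = 0"
    using emeasure_vol_chart[rule_format, OF c(1), of ?N] opN imN by (simp add: borel_open)
  have "(\<lambda>t. indicator ?O t *\<^sub>R sqrt (metric K c t)) \<in> borel_measurable borel"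
    by (intro borel_measurable_continuous_on_indicator continuous_on_real_sqrt
      continuous_on_subset[OF smooth_on_continuous[OF smooth_metric[OF c(1)]]])
      (use borel_open[OF opO] in auto)
  then have "(\<lambda>t. ennreal (indicator ?O t *\<^sub>R sqrt (metric K c t))) \<in> borel_measurable lborel" by simp
  moreover have "ennreal (sqrt (metric K c t)) * indicator ?O t = ennreal (indicator ?O t *\<^sub>R sqrt (metric K c t))" for t
    by (simp split: split_indicator)
  ultimately have "AE t in lborel. ennreal (sqrt (metric K c t)) * indicator ?O t = 0"
    using 0 by (simp only: nn_integral_0_iff_AE)
  then have "AE t in lborel. t \<in> - ?O"
  proof (rule AE_mp, intro AE_I2 impI)
    fix t assume 0: "ennreal (sqrt (metric K c t)) * indicator ?O t = 0"
    show "t \<in> - ?O"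
    proof
      assume t: "t \<in> ?O"
      then have "metric K c t > 0" by (intro metric_pos[OF c(1)]) simp
      then have "ennreal (sqrt (metric K c t)) \<noteq> 0" by simp
      then show False using 0 t by (simp only: indicator_simps mult_1_right)
    qed
  qed
  then have "snd c p \<in> - ?O"
    using opO by (intro mem_closed_if_AE_lebesgue AE_completion) (auto simp: closed_def)
  then show False using p c(2) chart_inverse(3,4)[OF c] by simp
qed

end

lemma AE_interval_continuous_eq_0:
  fixes g :: "real \<Rightarrow> complex"
  assumes g: "continuous_on {0..1} g" and ae: "AE x in restrict_space lborel {0..1}. g x = 0"
    and x: "x \<in> {0..1}"
  shows "g x = 0"
proof -
  let ?C = "{x \<in> {0..1}. g x = 0}"
  have cl: "closed ?C"
    using continuous_closed_preimage_constant[OF g closed_atLeastAtMost] .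
  have "AE x in lborel. x \<in> {0..1} \<longrightarrow> g x = 0" using ae by (simp add: AE_restrict_space_iff)
  then have "AE x in lebesgue. x \<in> {0<..<1} \<longrightarrow> x \<in> ?C"
    by (intro AE_completion) auto
  then have "{0<..<1} \<subseteq> ?C"
    using mem_closed_if_AE_lebesgue_open[OF open_greaterThanLessThan cl] by blast
  then have "closure {0<..<1} \<subseteq> ?C" using cl by (rule closure_minimal)
  then show ?thesis using x by auto
qed

definition mode_fun :: "complex \<Rightarrow> complex \<Rightarrow> ('k \<Rightarrow> complex) \<Rightarrow> real \<times> 'k \<Rightarrow> complex" where
  "mode_fun a b Y = (\<lambda>(j, p). (if j = 0 then a else b) * Y p)"

context conformal_cylinder begin

text \<open>
  Fubini reduces the claim to almost every slice, and continuity is then used in each of the two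
  variables in turn.
\<close>

lemma AE_cyl_continuous_eq:
  assumes u: "continuous_on cyl u" and v: "continuous_on cyl v"
    and ae: "AE z in vol_cyl K f. u z = v z" and z: "z \<in> cyl"
  shows "u z = (v z :: complex)"
proof -
  have sl1: "continuous_on UNIV (\<lambda>p. u (x, p) - v (x, p))" if "x \<in> {0..1}" for x
    by (intro continuous_on_diff continuous_on_compose2[OF u] continuous_on_compose2[OF v]
      continuous_on_Pair continuous_on_const continuous_on_id) (use that in \<open>auto simp: cyl_def\<close>)
  have sl2: "continuous_on {0..1} (\<lambda>x. u (x, p) - v (x, p))" for p
    by (intro continuous_on_diff continuous_on_compose2[OF u] continuous_on_compose2[OF v]
      continuous_on_Pair continuous_on_const continuous_on_id) (auto simp: cyl_def)
  have m: "(\<lambda>z. ennreal (f (fst z))) \<in> borel_measurable (base_measure K)"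
    using measurable_base[OF continuous_f_fst] by simp
  have "AE z in base_measure K. 0 < ennreal (f (fst z)) \<longrightarrow> u z = v z"
    using ae unfolding vol_cyl_base AE_density[OF m] .
  then have "AE z in base_measure K. u z = v z"
  proof (rule AE_mp, intro AE_I2 impI)
    fix z assume "z \<in> space (base_measure K)" "0 < ennreal (f (fst z)) \<longrightarrow> u z = v z"
    then show "u z = v z" using f_fst_pos[of z] by (simp add: space_base)
  qed
  then have "AE x in restrict_space lborel {0..1}. AE p in vol K. u (x, p) = v (x, p)"
    unfolding base_measure_def by (rule base.AE_pair)
  then have 1: "AE x in restrict_space lborel {0..1}. \<forall>p. u (x, p) - v (x, p) = 0"
  proof (rule AE_mp, intro AE_I2 impI allI)
    fix x p assume "x \<in> space (restrict_space lborel {0..1::real})" and ae: "AE p in vol K. u (x, p) = v (x, p)"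
    then have "x \<in> {0..1}" by simp
    from AE_vol_continuous_eq_0[OF sl1[OF this]] ae show "u (x, p) - v (x, p) = 0" by simp
  qed
  have "u (x, p) - v (x, p) = 0" if "x \<in> {0..1}" for x p
    by (rule AE_interval_continuous_eq_0[OF sl2 _ that]) (rule AE_mp[OF 1], intro AE_I2 impI, blast)
  then show ?thesis using z by (cases z) (auto simp: cyl_def)
qed

lemma boundary_integral:
  fixes F :: "real \<times> 'k \<Rightarrow> 'b::{banach, second_countable_topology}"
  assumes "integrable (vol K) (\<lambda>p. F (0, p))" "integrable (vol K) (\<lambda>p. F (1, p))"
  shows "integrable (vol_boundary K f) F"
    and "(LINT z|vol_boundary K f. F z) =
      sqrt (f 0) *\<^sub>R (LINT p|vol K. F (0, p)) + sqrt (f 1) *\<^sub>R (LINT p|vol K. F (1, p))"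
proof -
  let ?C = "count_space {0, 1::real}"
  interpret pair_sigma_finite ?C "vol K"
    by (intro pair_sigma_finite.intro finite_measure.axioms(1)[OF finite_measure_vol]
      sigma_finite_measure_count_space_finite) simp
  have F: "F \<in> borel_measurable (?C \<Otimes>\<^sub>M vol K)"
    by (rule measurable_pair_measure_countable1) (use assms in auto)
  have w: "(\<lambda>z. sqrt (f (fst z))) \<in> borel_measurable (?C \<Otimes>\<^sub>M vol K)"
    by (rule measurable_pair_measure_countable1) auto
  have nn: "AE z in ?C \<Otimes>\<^sub>M vol K. 0 \<le> sqrt (f (fst z))"
    by (intro AE_I2) (use f_pos in \<open>auto simp: space_pair_measure less_imp_le\<close>)
  let ?G = "\<lambda>z. sqrt (f (fst z)) *\<^sub>R F z"
  have G: "?G \<in> borel_measurable (?C \<Otimes>\<^sub>M vol K)" using F w by measurable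
  have int: "integrable (?C \<Otimes>\<^sub>M vol K) ?G"
    by (rule Fubini_integrable[OF G]) (use assms in \<open>auto simp: integrable_count_space intro!: AE_I2\<close>)
  have eq: "vol_boundary K f = density (?C \<Otimes>\<^sub>M vol K) (\<lambda>z. ennreal (sqrt (f (fst z))))"
    unfolding vol_boundary_def case_prod_beta ..
  show "integrable (vol_boundary K f) F"
    unfolding eq using integrable_density[OF F w nn] int by simp
  have "(LINT z|vol_boundary K f. F z) = (LINT z|(?C \<Otimes>\<^sub>M vol K). ?G z)"
    unfolding eq by (rule integral_density[OF F w nn])
  also have "\<dots> = (LINT j|?C. LINT p|vol K. ?G (j, p))" by (rule integral_fst'[OF int, symmetric])
  also have "\<dots> = (\<Sum>j\<in>{0, 1}. (LINT p|vol K. ?G (j, p)))"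
    by (rule lebesgue_integral_count_space_finite) simp
  finally show "(LINT z|vol_boundary K f. F z) =
      sqrt (f 0) *\<^sub>R (LINT p|vol K. F (0, p)) + sqrt (f 1) *\<^sub>R (LINT p|vol K. F (1, p))"
    by simp
qed

lemma space_vol_boundary: "space (vol_boundary K f) = {0, 1} \<times> UNIV"
  unfolding vol_boundary_def by (simp add: space_pair_measure space_vol)

lemma L2_boundaryI:
  assumes "continuous_on UNIV (\<lambda>p. u (0, p))" "continuous_on UNIV (\<lambda>p. u (1, p))"
  shows "u \<in> L2 (vol_boundary K f)"
proof -
  have "integrable (vol_boundary K f) u" "integrable (vol_boundary K f) (\<lambda>z. (cmod (u z))\<^sup>2)"
    by (intro boundary_integral(1) integrable_continuous_vol continuous_on_power continuous_on_norm assms)+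
  then show ?thesis unfolding L2_def by auto
qed

lemma inner_boundary:
  assumes u: "continuous_on UNIV (\<lambda>p. u (0, p))" "continuous_on UNIV (\<lambda>p. u (1, p))"
    and v: "continuous_on UNIV (\<lambda>p. v (0, p))" "continuous_on UNIV (\<lambda>p. v (1, p))"
  shows "inner_L2 (vol_boundary K f) u v =
    sqrt (f 0) * inner_L2 (vol K) (\<lambda>p. u (0, p)) (\<lambda>p. v (0, p)) +
    sqrt (f 1) * inner_L2 (vol K) (\<lambda>p. u (1, p)) (\<lambda>p. v (1, p))"
  unfolding inner_L2_def
  by (subst boundary_integral(2))
     (auto intro!: integrable_continuous_vol continuous_on_mult continuous_on_cnj u v simp: scaleR_conv_of_real)

lemma L2_cylI:
  assumes "continuous_on cyl u"
  shows "u \<in> L2 (vol_cyl K f)"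
  unfolding L2_def
  by (auto intro!: measurable_vol_cyl integrable_vol_cyl continuous_on_power continuous_on_norm assms)

end

section \<open>Separated harmonic functions\<close>

text \<open>
  Separation of variables: if \<open>- \<Delta>Y = m Y\<close> on the curve and \<open>h'' = m h\<close>, then \<open>h(x) Y(\<theta>)\<close> is harmonic for
  \<open>dx\<^sup>2 + g\<close>, and by conformal invariance for every metric \<open>f(x) (dx\<^sup>2 + g)\<close>.
\<close>

locale separated_solution = conformal_cylinder K f
  for K :: "'k::{t2_space, second_countable_topology} riem_manifold1" and f +
  fixes Y :: "'k \<Rightarrow> complex" and m :: real and h h' :: "real \<Rightarrow> complex"
  assumes Y_smooth: "smooth_fun K Y"
    and Y_eigen: "- laplacian K Y p = of_real m * Y p"
    and Y_norm: "inner_L2 (vol K) Y Y = 1"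
    and h_deriv: "(h has_vector_derivative h' x) (at x)"
    and h'_deriv: "(h' has_vector_derivative of_real m * h x) (at x)"
begin

definition U :: "real \<times> 'k \<Rightarrow> complex" where
  "U = (\<lambda>(x, p). h x * Y p)"

lemma Y_continuous: "continuous_on UNIV Y"
  by (rule C1_fun_continuous[OF smooth_fun_imp_C1_fun[OF Y_smooth]])

lemma h_continuous: "continuous_on A h" and h'_continuous: "continuous_on A h'"
  using has_vector_derivative_continuous[OF h_deriv] has_vector_derivative_continuous[OF h'_deriv]
  by (auto intro: continuous_at_imp_continuous_on)

lemma U_smooth: "smooth_cyl K U"
  unfolding smooth_cyl_def
proof
  fix c assume c: "c \<in> charts K"
  let ?I = "chart_image c"
  have "smooth_on ?I (Y \<circ> chart_inv c)" using Y_smooth c unfolding smooth_fun_def by blast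
  then obtain D where D: "(\<forall>t\<in>?I. D 0 t = (Y \<circ> chart_inv c) t) \<and>
      (\<forall>k. \<forall>t\<in>?I. (D k has_vector_derivative D (Suc k) t) (at t within ?I))"
    unfolding smooth_on_def by (elim exE)
  note D0 = D[THEN conjunct1, rule_format] and Dd = D[THEN conjunct2, rule_format]
  have Dc: "continuous_on ?I (D j)" for j
    unfolding continuous_on_eq_continuous_within by (intro ballI has_vector_derivative_continuous[OF Dd])
  \<comment> \<open>the \<open>i\<close>-th derivative of \<open>h\<close>, by \<open>h'' = m h\<close>\<close>
  define H where "H i x = of_real (m ^ (i div 2)) * (if even i then h x else h' x)" for i x
  have Hd: "(H i has_vector_derivative H (Suc i) x) (at x within A)" for i x A
  proof (rule has_vector_derivative_at_within)
    show "(H i has_vector_derivative H (Suc i) x) (at x)"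
    proof (cases "even i")
      case True
      then show ?thesis unfolding H_def[abs_def]
        using has_vector_derivative_mult_right[OF h_deriv, of "of_real (m ^ (i div 2))"] by simp
    next
      case False
      then show ?thesis unfolding H_def[abs_def]
        using has_vector_derivative_mult_right[OF h'_deriv, of "of_real (m ^ (i div 2))"]
        by (simp add: odd_Suc_div_two mult_ac)
    qed
  qed
  have Hc: "continuous_on A (H i)" for A i
    unfolding continuous_on_eq_continuous_within by (intro ballI has_vector_derivative_continuous[OF Hd])
  show "smooth_on2 {0..1} ?I (\<lambda>x t. U (x, chart_inv c t))"
    unfolding smooth_on2_def
  proof (rule exI[of _ "\<lambda>i j x t. H i x * D j t"], intro conjI allI ballI)
    show "H 0 x * D 0 t = U (x, chart_inv c t)" if "t \<in> ?I" for x t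
      using D0[OF that] by (simp add: H_def U_def)
    show "continuous_on ({0..1} \<times> ?I) (\<lambda>(x, t). H i x * D j t)" for i j
      unfolding case_prod_beta
      by (intro continuous_on_mult continuous_on_compose2[OF Hc[of UNIV]] continuous_on_compose2[OF Dc]
        continuous_on_fst continuous_on_snd continuous_on_id) auto
    show "((\<lambda>s. H i s * D j t) has_vector_derivative H (Suc i) x * D j t) (at x within {0..1})" for i j x t
      by (rule has_vector_derivative_mult_left[OF Hd])
    show "((\<lambda>s. H i x * D j s) has_vector_derivative H i x * D (Suc j) t) (at t within ?I)"
      if "t \<in> ?I" for i j x t
      by (rule has_vector_derivative_mult_right[OF Dd[OF that]])
  qed
qed

lemma U_continuous: "continuous_on cyl U"
  by (rule smooth_cyl_continuous[OF U_smooth])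

text \<open>
  The outward normal derivative of \<open>U\<close>: the unit normal is \<open>- f(0)\<^sup>-\<^sup>1\<^sup>/\<^sup>2 \<partial>\<^sub>x\<close> at the left end and
  \<open>f(1)\<^sup>-\<^sup>1\<^sup>/\<^sup>2 \<partial>\<^sub>x\<close> at the right end.
\<close>

definition normal_data :: "real \<times> 'k \<Rightarrow> complex" where
  "normal_data = mode_fun (- h' 0 / sqrt (f 0)) (h' 1 / sqrt (f 1)) Y"

lemma slice_continuous:
  assumes "smooth_cyl K v" "x \<in> {0..1}"
  shows "continuous_on UNIV (\<lambda>p. v (x, p))"
  by (rule C1_fun_continuous[OF smooth_cyl_slice[OF assms]])

lemma mode_fun_slice_continuous: "continuous_on UNIV (\<lambda>p. mode_fun a b Y (j, p))"
  unfolding mode_fun_def by (auto intro!: continuous_on_mult continuous_on_const Y_continuous)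

text \<open>
  Green's formula on the cylinder, from which the whole computation of the
  Dirichlet-to-Neumann operator follows. Green's identity on each slice turns the tangential part into a
  multiple of \<open>v\<close>; together with the part in the direction of \<open>x\<close> this is, by \<open>h'' = m h\<close>, the
  \<open>x\<close>-derivative of \<open>v\<close> times the conjugate of \<open>h' Y\<close>, and integration over \<open>x\<close> leaves the boundary values.
\<close>

lemma dirichlet_form_U:
  assumes v: "smooth_cyl K v"
  shows "dirichlet_form K f v U = inner_L2 (vol_boundary K f) v normal_data"
proof -
  let ?R = "restrict_space lborel {0..1::real}"
  have YC1: "C1_fun K Y" by (rule smooth_fun_imp_C1_fun[OF Y_smooth])
  have lap: "laplacian K Y p = - (of_real m * Y p)" for p using Y_eigen[of p] by (metis minus_minus)
  have cont_fst: "continuous_on cyl (\<lambda>z. g (fst z))" if "continuous_on UNIV g" for g :: "real \<Rightarrow> complex"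
    by (rule continuous_on_compose2[OF that continuous_on_fst[OF continuous_on_id]]) simp
  have cont_Y: "continuous_on cyl (\<lambda>z :: real \<times> 'k. Y (snd z))"
    by (rule continuous_on_compose2[OF Y_continuous continuous_on_snd[OF continuous_on_id]]) simp
  have vc: "continuous_on cyl v" by (rule smooth_cyl_continuous[OF v])
  have dU: "cyl_dx U z = h' (fst z) * Y (snd z)" if "z \<in> cyl" for z
    unfolding cyl_dx_def U_def
    using vector_derivative_unit_interval[OF has_vector_derivative_at_within[OF
      has_vector_derivative_mult_left[OF h_deriv]], of "fst z" "Y (snd z)"] that
    by (auto simp: cyl_def)
  \<comment> \<open>\<open>B\<close> has the same integral over each slice as the tangential part \<open>G\<close>, and \<open>A + B\<close> is an
    \<open>x\<close>-derivative\<close>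
  define A where "A z = cyl_dx v z * cnj (h' (fst z) * Y (snd z))" for z :: "real \<times> 'k"
  define G where "G z = grad_prod K (\<lambda>q. v (fst z, q)) (\<lambda>q. U (fst z, q)) (snd z)" for z :: "real \<times> 'k"
  define B where "B z = v z * cnj (of_real m * h (fst z) * Y (snd z))" for z :: "real \<times> 'k"
  have cA: "continuous_on cyl A"
    unfolding A_def[abs_def]
    by (intro continuous_on_mult continuous_on_cnj smooth_cyl_dx(2)[OF v] cont_Y cont_fst h'_continuous)
  have cG: "continuous_on cyl G"
    unfolding G_def[abs_def] by (rule smooth_cyl_grad_prod[OF v U_smooth])
  have cB: "continuous_on cyl B"
    unfolding B_def[abs_def]
    by (intro continuous_on_mult continuous_on_cnj vc cont_Y cont_fst h_continuous continuous_on_const)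
  have GB: "(LINT p|vol K. G (x, p)) = (LINT p|vol K. B (x, p))" if x: "x \<in> {0..1}" for x
  proof -
    have vx: "C1_fun K (\<lambda>q. v (x, q))" by (rule smooth_cyl_slice[OF v x])
    have "G (x, p) = cnj (h x) * grad_prod K (\<lambda>q. v (x, q)) Y p" for p
      unfolding G_def using grad_prod_mult_right[OF vx YC1, of "h x" p] by (simp add: U_def)
    then have "(LINT p|vol K. G (x, p)) = cnj (h x) * (LINT p|vol K. grad_prod K (\<lambda>q. v (x, q)) Y p)"
      by simp
    also have "\<dots> = cnj (h x) * - (LINT p|vol K. v (x, p) * cnj (laplacian K Y p))"
      by (simp only: green_identity[OF vx Y_smooth])
    also have "\<dots> = cnj (h x) * (LINT p|vol K. of_real m * (v (x, p) * cnj (Y p)))"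
      unfolding lap by (simp add: mult.left_commute)
    also have "\<dots> = (LINT p|vol K. B (x, p))"
      unfolding B_def by (subst integral_mult_right_zero[symmetric]) (simp add: mult_ac)
    finally show ?thesis .
  qed
  have "dirichlet_form K f v U = (LINT z|base_measure K. A z + G z)"
    unfolding dirichlet_form_base[OF v U_smooth]
    by (rule Bochner_Integration.integral_cong[OF refl]) (simp add: A_def G_def dU space_base)
  also have "\<dots> = (LINT z|base_measure K. A z) + (LINT z|base_measure K. G z)"
    by (intro Bochner_Integration.integral_add integrable_base cA cG)
  also have "(LINT z|base_measure K. G z) = (LINT z|base_measure K. B z)"
    unfolding fubini_base(1)[OF cG] fubini_base(1)[OF cB]
    by (rule Bochner_Integration.integral_cong[OF refl]) (simp add: GB)
  also have "(LINT z|base_measure K. A z) + (LINT z|base_measure K. B z) = (LINT z|base_measure K. A z + B z)"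
    by (intro Bochner_Integration.integral_add[symmetric] integrable_base cA cB)
  also have "\<dots> = (LINT p|vol K. LINT x|?R. A (x, p) + B (x, p))"
    by (rule fubini_base(2)[OF continuous_on_add[OF cA cB]])
  also have "\<dots> = (LINT p|vol K. (v (1, p) * cnj (h' 1) - v (0, p) * cnj (h' 0)) * cnj (Y p))"
  proof (rule Bochner_Integration.integral_cong[OF refl])
    fix p
    let ?g = "\<lambda>x. v (x, p) * cnj (h' x * Y p)"
    have "(LINT x|?R. A (x, p) + B (x, p)) = (LINT x|lborel. indicator {0..1} x *\<^sub>R (A (x, p) + B (x, p)))"
      by (rule integral_restrict_space) simp
    also have "\<dots> = ?g 1 - ?g 0"
    proof (rule integral_FTC_atLeastAtMost)
      show "continuous_on {0..1} (\<lambda>x. A (x, p) + B (x, p))"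
        by (rule continuous_on_compose2[OF continuous_on_add[OF cA cB]])
           (auto simp: cyl_def intro!: continuous_on_Pair continuous_on_const continuous_on_id)
      fix x :: real assume "0 \<le> x" "x \<le> 1"
      then have x: "x \<in> {0..1}" by simp
      have "(?g has_vector_derivative v (x, p) * cnj (of_real m * h x * Y p) +
          cyl_dx v (x, p) * cnj (h' x * Y p)) (at x within {0..1})"
        by (rule has_vector_derivative_mult[OF smooth_cyl_dx(1)[OF v x] has_vector_derivative_cnj[OF
          has_vector_derivative_at_within[OF has_vector_derivative_mult_left[OF h'_deriv]]]])
      then show "(?g has_vector_derivative A (x, p) + B (x, p)) (at x within {0..1})"
        by (simp add: A_def B_def add.commute)
    qed simp
    finally show "(LINT x|?R. A (x, p) + B (x, p)) =
        (v (1, p) * cnj (h' 1) - v (0, p) * cnj (h' 0)) * cnj (Y p)"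
      by (simp add: algebra_simps)
  qed
  also have "\<dots> = cnj (h' 1) * inner_L2 (vol K) (\<lambda>p. v (1, p)) Y - cnj (h' 0) * inner_L2 (vol K) (\<lambda>p. v (0, p)) Y"
  proof -
    have i: "integrable (vol K) (\<lambda>p. v (x, p) * cnj (Y p))" if "x \<in> {0..1}" for x
      by (intro integrable_continuous_vol continuous_on_mult continuous_on_cnj slice_continuous[OF v that] Y_continuous)
    have "(\<lambda>p. (v (1, p) * cnj (h' 1) - v (0, p) * cnj (h' 0)) * cnj (Y p)) =
        (\<lambda>p. cnj (h' 1) * (v (1, p) * cnj (Y p)) - cnj (h' 0) * (v (0, p) * cnj (Y p)))"
      by (simp add: algebra_simps)
    then show ?thesis unfolding inner_L2_def using i[of 0] i[of 1] by simp
  qed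
  also have "\<dots> = inner_L2 (vol_boundary K f) v normal_data"
  proof -
    have pull: "inner_L2 (vol K) w (\<lambda>p. a * Y p) = cnj a * inner_L2 (vol K) w Y" for w a
      unfolding inner_L2_def by (subst integral_mult_right_zero[symmetric]) (simp add: mult_ac)
    have "sqrt (f 0) \<noteq> 0" "sqrt (f 1) \<noteq> 0" using f_pos[of 0] f_pos[of 1] by auto
    moreover have "inner_L2 (vol_boundary K f) v normal_data =
      sqrt (f 0) * inner_L2 (vol K) (\<lambda>p. v (0, p)) (\<lambda>p. normal_data (0, p)) +
      sqrt (f 1) * inner_L2 (vol K) (\<lambda>p. v (1, p)) (\<lambda>p. normal_data (1, p))"
      unfolding normal_data_def
      by (intro inner_boundary slice_continuous[OF v] mode_fun_slice_continuous) auto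
    moreover have "(\<lambda>p. normal_data (0, p)) = (\<lambda>p. (- h' 0 / sqrt (f 0)) * Y p)"
      "(\<lambda>p. normal_data (1, p)) = (\<lambda>p. (h' 1 / sqrt (f 1)) * Y p)"
      by (simp_all add: normal_data_def mode_fun_def)
    ultimately show ?thesis by (simp only: pull) simp
  qed
  finally show ?thesis .
qed

end

section \<open>The Dirichlet-to-Neumann operator on separated functions\<close>

lemma smooth_cyl_diff:
  assumes u: "smooth_cyl K u" and v: "smooth_cyl K v"
  shows "smooth_cyl K (\<lambda>z. u z - v z)"
  unfolding smooth_cyl_def
proof
  fix c assume c: "c \<in> charts K"
  let ?I = "chart_image c"
  define jet :: "(real \<Rightarrow> real \<Rightarrow> complex) \<Rightarrow> (nat \<Rightarrow> nat \<Rightarrow> real \<Rightarrow> real \<Rightarrow> complex) \<Rightarrow> bool" where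
    "jet w D \<longleftrightarrow> (\<forall>x\<in>{0..1}. \<forall>t\<in>?I. D 0 0 x t = w x t) \<and>
        (\<forall>i j. continuous_on ({0..1} \<times> ?I) (\<lambda>(x, t). D i j x t)) \<and>
        (\<forall>i j. \<forall>x\<in>{0..1}. \<forall>t\<in>?I.
           ((\<lambda>s. D i j s t) has_vector_derivative D (Suc i) j x t) (at x within {0..1}) \<and>
           ((\<lambda>s. D i j x s) has_vector_derivative D i (Suc j) x t) (at t within ?I))" for w D
  have jet: "smooth_on2 {0..1} ?I w \<longleftrightarrow> (\<exists>D. jet w D)" for w unfolding smooth_on2_def jet_def ..
  have "\<exists>D. jet (\<lambda>x t. u (x, chart_inv c t)) D" "\<exists>D. jet (\<lambda>x t. v (x, chart_inv c t)) D"
    using u v c unfolding smooth_cyl_def jet[symmetric] by blast+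
  then obtain D E where D: "jet (\<lambda>x t. u (x, chart_inv c t)) D" and E: "jet (\<lambda>x t. v (x, chart_inv c t)) E"
    by (elim exE)
  note D1 = D[unfolded jet_def, THEN conjunct1, rule_format]
    and E1 = E[unfolded jet_def, THEN conjunct1, rule_format]
    and D2 = D[unfolded jet_def, THEN conjunct2, THEN conjunct1, rule_format]
    and E2 = E[unfolded jet_def, THEN conjunct2, THEN conjunct1, rule_format]
    and D3 = D[unfolded jet_def, THEN conjunct2, THEN conjunct2, rule_format]
    and E3 = E[unfolded jet_def, THEN conjunct2, THEN conjunct2, rule_format]
  have "jet (\<lambda>x t. u (x, chart_inv c t) - v (x, chart_inv c t)) (\<lambda>i j x t. D i j x t - E i j x t)"
    unfolding jet_def
  proof (intro conjI allI ballI)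
    fix x :: real and t assume x: "x \<in> {0..1}" and t: "t \<in> ?I"
    show "D 0 0 x t - E 0 0 x t = u (x, chart_inv c t) - v (x, chart_inv c t)"
      by (simp only: D1[OF x t] E1[OF x t])
    show "((\<lambda>s. D i j s t - E i j s t) has_vector_derivative D (Suc i) j x t - E (Suc i) j x t)
        (at x within {0..1})" for i j
      by (rule has_vector_derivative_diff[OF D3[OF x t, THEN conjunct1] E3[OF x t, THEN conjunct1]])
    show "((\<lambda>s. D i j x s - E i j x s) has_vector_derivative D i (Suc j) x t - E i (Suc j) x t)
        (at t within ?I)" for i j
      by (rule has_vector_derivative_diff[OF D3[OF x t, THEN conjunct2] E3[OF x t, THEN conjunct2]])
  next
    show "continuous_on ({0..1} \<times> ?I) (\<lambda>(x, t). D i j x t - E i j x t)" for i j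
      using continuous_on_diff[OF D2[of i j] E2[of i j]] by (simp add: case_prod_beta)
  qed
  then show "smooth_on2 {0..1} ?I (\<lambda>x t. u (x, chart_inv c t) - v (x, chart_inv c t))"
    unfolding jet by (rule exI[of _ "\<lambda>i j x t. D i j x t - E i j x t"])
qed

context separated_solution begin

lemma inner_multiples_Y: "inner_L2 (vol K) (\<lambda>p. a * Y p) (\<lambda>p. b * Y p) = a * cnj b"
proof -
  have "inner_L2 (vol K) (\<lambda>p. a * Y p) (\<lambda>p. b * Y p) = (a * cnj b) * inner_L2 (vol K) Y Y"
    unfolding inner_L2_def by (subst integral_mult_right_zero[symmetric]) (simp add: mult_ac)
  then show ?thesis by (simp add: Y_norm)
qed

lemma inner_boundary_modes:
  assumes u: "\<And>p. u (0, p) = a * Y p" "\<And>p. u (1, p) = b * Y p"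
    and v: "\<And>p. v (0, p) = a' * Y p" "\<And>p. v (1, p) = b' * Y p"
  shows "inner_L2 (vol_boundary K f) u v = sqrt (f 0) * (a * cnj a') + sqrt (f 1) * (b * cnj b')"
  using inner_boundary[of u v]
  by (simp add: u v inner_multiples_Y continuous_on_mult Y_continuous)

lemma sqrt_f_nonzero: "complex_of_real (sqrt (f 0)) \<noteq> 0" "complex_of_real (sqrt (f 1)) \<noteq> 0"
  using f_pos[of 0] f_pos[of 1] by auto

lemma normal_data_boundary:
  "normal_data (0, p) = (- h' 0 / sqrt (f 0)) * Y p" "normal_data (1, p) = (h' 1 / sqrt (f 1)) * Y p"
  by (simp_all add: normal_data_def mode_fun_def)

lemma normal_data_L2: "normal_data \<in> L2 (vol_boundary K f)"
  unfolding normal_data_def by (intro L2_boundaryI mode_fun_slice_continuous)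

text \<open>
  Duality: the operator is tested on a separated solution \<open>U\<close>. By Green's formula the Dirichlet form
  of an approximating sequence with \<open>U\<close> only sees its boundary values, so the limit is known
  without any information on the interior of the solution.
\<close>

lemma DN_eigenvalue_relation:
  assumes DN: "DN K f 0 \<psi> (\<lambda>z. of_real l * \<psi> z)"
    and \<psi>: "\<And>p. \<psi> (0, p) = a * Y p" "\<And>p. \<psi> (1, p) = b * Y p"
  shows "b * cnj (h' 1) - a * cnj (h' 0) =
    of_real l * (sqrt (f 0) * (a * cnj (h 0)) + sqrt (f 1) * (b * cnj (h 1)))"
proof -
  obtain u S where S: "weak_solution_via K f 0 S u \<psi>"
    and lim: "\<And>v. smooth_cyl K v \<Longrightarrow> (\<lambda>k. dirichlet_form K f (S k) v) \<longlonglongrightarrow>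
      of_real 0 * inner_L2 (vol_cyl K f) u v + inner_L2 (vol_boundary K f) (\<lambda>z. of_real l * \<psi> z) v"
    using DN unfolding DN_def by blast
  have Sk: "\<And>k. smooth_cyl K (S k)" and tr: "tendsto_L2 (vol_boundary K f) S \<psi>"
    using S unfolding weak_solution_via_def H1_approx_def by blast+
  \<comment> \<open>the same limit is computed from Green's formula and from the definition of the operator\<close>
  have "(\<lambda>k. dirichlet_form K f (S k) U) \<longlonglongrightarrow> inner_L2 (vol_boundary K f) \<psi> normal_data"
    unfolding dirichlet_form_U[OF Sk] by (rule tendsto_inner_L2[OF tr normal_data_L2])
  moreover have "(\<lambda>k. dirichlet_form K f (S k) U) \<longlonglongrightarrow> inner_L2 (vol_boundary K f) (\<lambda>z. of_real l * \<psi> z) U"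
    using lim[OF U_smooth] by simp
  ultimately have "inner_L2 (vol_boundary K f) \<psi> normal_data = inner_L2 (vol_boundary K f) (\<lambda>z. of_real l * \<psi> z) U"
    by (rule LIMSEQ_unique)
  moreover have "inner_L2 (vol_boundary K f) \<psi> normal_data = b * cnj (h' 1) - a * cnj (h' 0)"
    using inner_boundary_modes[OF \<psi> normal_data_boundary] sqrt_f_nonzero by simp
  moreover have "inner_L2 (vol_boundary K f) (\<lambda>z. of_real l * \<psi> z) U =
      sqrt (f 0) * (of_real l * a * cnj (h 0)) + sqrt (f 1) * (of_real l * b * cnj (h 1))"
    by (rule inner_boundary_modes) (simp_all add: \<psi> U_def)
  ultimately show ?thesis by (simp add: algebra_simps)
qed

lemma inner_boundary_cnj: "cnj (inner_L2 (vol_boundary K f) u v) = inner_L2 (vol_boundary K f) v u"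
  unfolding inner_L2_def Bochner_Integration.integral_cnj[symmetric] by (simp add: mult.commute)

lemma dirichlet_form_U_left:
  assumes "smooth_cyl K v"
  shows "dirichlet_form K f U v = inner_L2 (vol_boundary K f) normal_data v"
  by (subst dirichlet_form_cnj) (simp add: dirichlet_form_U[OF assms] inner_boundary_cnj)

lemma U_weak_harmonic:
  assumes v: "smooth_cyl K v" "\<forall>z\<in>cyl_boundary. v z = 0"
  shows "dirichlet_form K f U v = 0"
proof -
  have "inner_L2 (vol_boundary K f) normal_data v = (LINT z|vol_boundary K f. 0)"
    unfolding inner_L2_def
    by (rule Bochner_Integration.integral_cong) (use v(2) in \<open>auto simp: space_vol_boundary cyl_boundary_def\<close>)
  then show ?thesis by (simp add: dirichlet_form_U_left[OF v(1)])
qed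

lemma U_boundary_L2: "U \<in> L2 (vol_boundary K f)"
  by (intro L2_boundaryI slice_continuous[OF U_smooth]) auto

text \<open>
  Boundary conditions of Robin type at both ends say that the normal derivative of \<open>U\<close> is \<open>l\<close> times
  its boundary value. As \<open>U\<close> is smooth, the constant sequence approximates it.
\<close>

lemma DN_U:
  assumes h0: "h' 0 = - of_real (l * sqrt (f 0)) * h 0" and h1: "h' 1 = of_real (l * sqrt (f 1)) * h 1"
  shows "DN K f 0 U (\<lambda>z. of_real l * U z)"
proof -
  have zero: "dirichlet_form K f (\<lambda>z. U z - U z) (\<lambda>z. U z - U z) = 0"
    using dirichlet_form_diff[OF U_smooth U_smooth smooth_cyl_diff[OF U_smooth U_smooth]] by simp
  have H1: "H1_approx K f (\<lambda>_. U) U U"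
    unfolding H1_approx_def tendsto_L2_def
    using U_smooth L2_cylI[OF U_continuous] U_boundary_L2 zero by simp
  have weak: "weak_solution_via K f 0 (\<lambda>_. U) U U"
    unfolding weak_solution_via_def using H1 U_weak_harmonic by simp
  have nd: "normal_data z = of_real l * U z" if "z \<in> space (vol_boundary K f)" for z
    using that sqrt_f_nonzero by (auto simp: space_vol_boundary normal_data_boundary U_def h0 h1)
  have "dirichlet_form K f U v = inner_L2 (vol_boundary K f) (\<lambda>z. of_real l * U z) v" if "smooth_cyl K v" for v
    unfolding dirichlet_form_U_left[OF that] inner_L2_def
    by (rule Bochner_Integration.integral_cong) (simp_all add: nd)
  moreover have "(\<lambda>z. of_real l * U z) \<in> L2 (vol_boundary K f)"
    by (intro L2_boundaryI continuous_on_mult continuous_on_const slice_continuous[OF U_smooth]) auto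
  ultimately show ?thesis
    unfolding DN_def using weak by (intro conjI exI[of _ U] exI[of _ "\<lambda>_. U"]) simp_all
qed

text \<open>
  The difference of the two solutions has zero boundary values and therefore vanishes almost
  everywhere, as zero is not a Dirichlet eigenvalue; continuity gives every point.
\<close>

lemma dirichlet_solution_eq_U:
  assumes spec: "0 \<notin> dirichlet_spectrum K f"
    and cont: "continuous_on cyl \<phi>" and sol: "dirichlet_solution K f 0 \<phi> \<psi>"
    and \<psi>: "\<And>p. \<psi> (0, p) = h 0 * Y p" "\<And>p. \<psi> (1, p) = h 1 * Y p"
    and z: "z \<in> cyl"
  shows "\<phi> z = U z"
proof -
  obtain S where "weak_solution_via K f 0 S \<phi> \<psi>" using sol unfolding dirichlet_solution_def by blast
  then have H1: "H1_approx K f S \<phi> \<psi>"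
    and weak: "\<And>v. smooth_cyl K v \<Longrightarrow> \<forall>z\<in>cyl_boundary. v z = 0 \<Longrightarrow>
        (\<lambda>k. dirichlet_form K f (S k) v) \<longlonglongrightarrow> 0"
    unfolding weak_solution_via_def by auto
  have Sk: "\<And>k. smooth_cyl K (S k)"
    and Sc: "tendsto_L2 (vol_cyl K f) S \<phi>" and Sb: "tendsto_L2 (vol_boundary K f) S \<psi>"
    and Cauchy: "\<forall>e>0. \<exists>N. \<forall>j\<ge>N. \<forall>k\<ge>N.
        cmod (dirichlet_form K f (\<lambda>z. S j z - S k z) (\<lambda>z. S j z - S k z)) < e"
    using H1 unfolding H1_approx_def by blast+
  let ?S = "\<lambda>k z. S k z - U z"
  have Sk': "smooth_cyl K (?S k)" for k by (rule smooth_cyl_diff[OF Sk U_smooth])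
  have Uc: "U \<in> L2 (vol_cyl K f)" by (rule L2_cylI[OF U_continuous])
  have "tendsto_L2 (vol_cyl K f) ?S (\<lambda>z. \<phi> z - U z)"
    using Sc unfolding tendsto_L2_def by (auto intro: L2_diff Uc)
  moreover have "tendsto_L2 (vol_boundary K f) ?S (\<lambda>_. 0)"
  proof -
    have "(LINT z|vol_boundary K f. (cmod (?S k z - 0))\<^sup>2) = (LINT z|vol_boundary K f. (cmod (S k z - \<psi> z))\<^sup>2)" for k
      by (rule Bochner_Integration.integral_cong) (auto simp: space_vol_boundary \<psi> U_def)
    then show ?thesis
      using Sb L2_boundaryI[of "\<lambda>_. 0"] unfolding tendsto_L2_def by (auto intro: L2_diff U_boundary_L2)
  qed
  ultimately have "H1_approx K f ?S (\<lambda>z. \<phi> z - U z) (\<lambda>_. 0)"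
    unfolding H1_approx_def using Sk' Cauchy by simp
  moreover have "(\<lambda>k. dirichlet_form K f (?S k) v) \<longlonglongrightarrow> of_real 0 * inner_L2 (vol_cyl K f) (\<lambda>z. \<phi> z - U z) v"
    if v: "smooth_cyl K v" "\<forall>z\<in>cyl_boundary. v z = 0" for v
    using weak[OF v] by (simp add: dirichlet_form_diff[OF Sk U_smooth v(1)] U_weak_harmonic[OF v])
  ultimately have "weak_solution_via K f 0 ?S (\<lambda>z. \<phi> z - U z) (\<lambda>_. 0)"
    unfolding weak_solution_via_def by blast
  then have "dirichlet_solution K f 0 (\<lambda>z. \<phi> z - U z) (\<lambda>_. 0)"
    unfolding dirichlet_solution_def by (rule exI[of _ ?S])
  then have "AE z in vol_cyl K f. \<phi> z - U z = 0"
    using spec unfolding dirichlet_spectrum_def by blast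
  then have "AE z in vol_cyl K f. \<phi> z = U z" by simp
  then show ?thesis by (rule AE_cyl_continuous_eq[OF cont U_continuous _ z])
qed

end

section \<open>The characteristic equation of one mode\<close>

definition coth :: "real \<Rightarrow> real" where "coth s = cosh s / sinh s"

text \<open>
  Up to the factor \<open>s\<close> this is the square root of the discriminant of the matrix of the operator on
  one mode, in which \<open>(p - q)\<^sup>2 coth\<^sup>2 s + 4 p q / sinh\<^sup>2 s\<close> has been simplified by
  \<open>coth\<^sup>2 s = 1 + 1 / sinh\<^sup>2 s\<close>.
\<close>

definition gap :: "real \<Rightarrow> real \<Rightarrow> real \<Rightarrow> real" where
  "gap p q s = sqrt ((p - q)\<^sup>2 + ((p + q) / sinh s)\<^sup>2)"

definition root_minus :: "real \<Rightarrow> real \<Rightarrow> real \<Rightarrow> real" where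
  "root_minus p q s = s / 2 * ((p + q) * coth s - gap p q s)"

definition root_plus :: "real \<Rightarrow> real \<Rightarrow> real \<Rightarrow> real" where
  "root_plus p q s = s / 2 * ((p + q) * coth s + gap p q s)"

lemma coth_square:
  assumes "s > 0"
  shows "(coth s)\<^sup>2 = 1 + (1 / sinh s)\<^sup>2"
proof -
  have "sinh s \<noteq> 0" using assms by simp
  then show ?thesis using cosh_square_eq[of s] unfolding coth_def by (simp add: power_divide field_simps)
qed

lemma gap_square: "(gap p q s)\<^sup>2 = (p - q)\<^sup>2 + (p + q)\<^sup>2 * (1 / sinh s)\<^sup>2"
  unfolding gap_def by (simp add: power_divide)

text \<open>
  The characteristic equation of the matrix with diagonal entries \<open>s p coth s\<close>, \<open>s q coth s\<close> and
  off-diagonal entries \<open>- s p / sinh s\<close>, \<open>- s q / sinh s\<close>. Its roots have the sum \<open>s (p + q) coth s\<close> and the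
  product \<open>s\<^sup>2 p q\<close>.
\<close>

lemma char_poly_roots:
  assumes "s > 0"
  shows "(l - s * p * coth s) * (l - s * q * coth s) = s\<^sup>2 * p * q * (1 / sinh s)\<^sup>2 \<longleftrightarrow>
    l = root_minus p q s \<or> l = root_plus p q s"
proof -
  have "(l - s * p * coth s) * (l - s * q * coth s) - s\<^sup>2 * p * q * (1 / sinh s)\<^sup>2 =
      l\<^sup>2 - s * (p + q) * coth s * l + s\<^sup>2 * p * q * ((coth s)\<^sup>2 - (1 / sinh s)\<^sup>2)"
    by (simp add: algebra_simps power2_eq_square)
  also have "\<dots> = l\<^sup>2 - s * (p + q) * coth s * l + s\<^sup>2 * p * q"
    using coth_square[OF assms] by simp
  also have "\<dots> = (l - root_minus p q s) * (l - root_plus p q s)"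
  proof -
    have "root_minus p q s * root_plus p q s = s\<^sup>2 / 4 * ((p + q)\<^sup>2 * (coth s)\<^sup>2 - (gap p q s)\<^sup>2)"
      unfolding root_minus_def root_plus_def by (simp add: algebra_simps power2_eq_square)
    also have "\<dots> = s\<^sup>2 * p * q"
      unfolding coth_square[OF assms] gap_square by (simp add: algebra_simps power2_eq_square)
    finally have prod: "root_minus p q s * root_plus p q s = s\<^sup>2 * p * q" .
    have "root_minus p q s + root_plus p q s = s * (p + q) * coth s"
      unfolding root_minus_def root_plus_def by (simp add: algebra_simps)
    then show ?thesis using prod by (simp add: algebra_simps power2_eq_square) (simp flip: distrib_left add: distrib_left[symmetric])
  qed
  finally show ?thesis by auto
qed

lemma coth_bounds:
  assumes "s > 0"
  shows "1 \<le> coth s" "coth s - 1 \<le> 1 / sinh s"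
proof -
  have "sinh s > 0" using assms by simp
  moreover have "cosh s = sinh s + exp (- s)" by (simp add: cosh_def sinh_def field_simps)
  ultimately show "1 \<le> coth s" "coth s - 1 \<le> 1 / sinh s"
    using assms unfolding coth_def by (simp_all add: field_simps)
qed

lemma inverse_sinh_bound:
  fixes s s0 :: real
  assumes "0 < s0" "s0 \<le> s"
  shows "1 / sinh s \<le> 2 / (1 - exp (- 2 * s0)) * exp (- s)"
proof -
  have e: "exp (- 2 * s) \<le> exp (- 2 * s0)" "exp (- 2 * s0) < 1" using assms by auto
  have sh: "sinh s = exp s * (1 - exp (- 2 * s)) / 2"
    by (simp add: sinh_def right_diff_distrib exp_add[symmetric])
  have inv: "exp (- s) = 1 / exp s" by (simp add: exp_minus inverse_eq_divide)
  have "1 / sinh s = 2 / (1 - exp (- 2 * s)) * exp (- s)"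
    unfolding sh inv by simp
  also have "\<dots> \<le> 2 / (1 - exp (- 2 * s0)) * exp (- s)"
    using e by (intro mult_right_mono divide_left_mono) auto
  finally show ?thesis .
qed

lemma gap_bounds:
  assumes "s > 0" "0 < p" "0 < q"
  shows "gap p q s > 0" "\<bar>p - q\<bar> \<le> gap p q s" "\<bar>p - q\<bar> * coth s \<le> gap p q s"
    and "p \<noteq> q \<Longrightarrow> gap p q s - \<bar>p - q\<bar> \<le> (p + q)\<^sup>2 / \<bar>p - q\<bar> * (1 / sinh s)\<^sup>2"
proof -
  have sh: "sinh s > 0" using assms by simp
  show pos: "gap p q s > 0" unfolding gap_def using assms sh
    by (intro real_sqrt_gt_zero add_nonneg_pos) (auto simp: zero_less_power2)
  show le: "\<bar>p - q\<bar> \<le> gap p q s" unfolding gap_def by (rule real_le_rsqrt) simp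
  have "(\<bar>p - q\<bar> * coth s)\<^sup>2 = (p - q)\<^sup>2 * (1 + (1 / sinh s)\<^sup>2)"
    by (simp add: power_mult_distrib coth_square[OF assms(1)])
  also have "\<dots> \<le> (p - q)\<^sup>2 + ((p + q) / sinh s)\<^sup>2"
  proof -
    have "(p - q)\<^sup>2 \<le> (p + q)\<^sup>2" using assms by (simp add: power2_eq_square algebra_simps)
    from mult_right_mono[OF this, of "(1 / sinh s)\<^sup>2"] show ?thesis
      by (simp add: power_divide algebra_simps)
  qed
  finally show "\<bar>p - q\<bar> * coth s \<le> gap p q s" unfolding gap_def by (rule real_le_rsqrt)
  assume ne: "p \<noteq> q"
  have "(gap p q s - \<bar>p - q\<bar>) * \<bar>p - q\<bar> \<le> (gap p q s - \<bar>p - q\<bar>) * (gap p q s + \<bar>p - q\<bar>)"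
    using le pos by (intro mult_left_mono) auto
  also have "\<dots> = (gap p q s)\<^sup>2 - (p - q)\<^sup>2" by (simp add: algebra_simps power2_eq_square abs_mult_self_eq)
  also have "\<dots> = (p + q)\<^sup>2 * (1 / sinh s)\<^sup>2" unfolding gap_square by simp
  finally have "gap p q s - \<bar>p - q\<bar> \<le> (p + q)\<^sup>2 * (1 / sinh s)\<^sup>2 / \<bar>p - q\<bar>"
    using ne by (intro mult_imp_le_div_pos) auto
  then show "gap p q s - \<bar>p - q\<bar> \<le> (p + q)\<^sup>2 / \<bar>p - q\<bar> * (1 / sinh s)\<^sup>2" by simp
qed

text \<open>
  The larger root is at least the larger diagonal entry and the smaller root at most the smaller
  one, so each root keeps the distance \<open>s \<bar>p - q\<bar>\<close> from the opposite diagonal entry.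
\<close>

lemma root_separation:
  assumes "s > 0" "0 < p" "0 < q"
  shows "root_plus p q s - s * min p q * coth s \<ge> s * \<bar>p - q\<bar>"
    and "s * max p q * coth s - root_minus p q s \<ge> s * \<bar>p - q\<bar>"
proof -
  have c: "coth s \<ge> 1" by (rule coth_bounds(1)[OF assms(1)])
  have "\<bar>p - q\<bar> \<le> \<bar>p - q\<bar> * coth s" using mult_left_mono[OF c, of "\<bar>p - q\<bar>"] by simp
  then have 1: "s * \<bar>p - q\<bar> \<le> s * (\<bar>p - q\<bar> * coth s)" using assms by (intro mult_left_mono) auto
  have 2: "s / 2 * (\<bar>p - q\<bar> * coth s) \<le> s / 2 * gap p q s"
    using gap_bounds(3)[OF assms] assms by (intro mult_left_mono) auto
  have "root_plus p q s - s * min p q * coth s = s / 2 * (\<bar>p - q\<bar> * coth s) + s / 2 * gap p q s"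
    unfolding root_plus_def by (cases "p \<le> q") (auto simp: min_def abs_if field_simps)
  then show "root_plus p q s - s * min p q * coth s \<ge> s * \<bar>p - q\<bar>" using 1 2 by simp
  have "s * max p q * coth s - root_minus p q s = s / 2 * (\<bar>p - q\<bar> * coth s) + s / 2 * gap p q s"
    unfolding root_minus_def by (cases "p \<le> q") (auto simp: max_def abs_if field_simps)
  then show "s * max p q * coth s - root_minus p q s \<ge> s * \<bar>p - q\<bar>" using 1 2 by simp
qed

text \<open>
  The solution of \<open>h'' = s\<^sup>2 h\<close> with \<open>h(0) = a\<close> and \<open>h(1) = b\<close>.
\<close>

definition harm :: "real \<Rightarrow> complex \<Rightarrow> complex \<Rightarrow> real \<Rightarrow> complex" where
  "harm s a b x = a * of_real (sinh (s * (1 - x)) / sinh s) + b * of_real (sinh (s * x) / sinh s)"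

definition harm' :: "real \<Rightarrow> complex \<Rightarrow> complex \<Rightarrow> real \<Rightarrow> complex" where
  "harm' s a b x = a * of_real (- s * cosh (s * (1 - x)) / sinh s) + b * of_real (s * cosh (s * x) / sinh s)"

lemma harm_deriv:
  shows "(harm s a b has_vector_derivative harm' s a b x) (at x)"
    and "(harm' s a b has_vector_derivative of_real (s\<^sup>2) * harm s a b x) (at x)"
proof -
  have "((\<lambda>x. sinh (s * (1 - x)) / sinh s) has_real_derivative - s * cosh (s * (1 - x)) / sinh s) (at x)"
    "((\<lambda>x. sinh (s * x) / sinh s) has_real_derivative s * cosh (s * x) / sinh s) (at x)"
    "((\<lambda>x. - s * cosh (s * (1 - x)) / sinh s) has_real_derivative s\<^sup>2 * (sinh (s * (1 - x)) / sinh s)) (at x)"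
    "((\<lambda>x. s * cosh (s * x) / sinh s) has_real_derivative s\<^sup>2 * (sinh (s * x) / sinh s)) (at x)"
    unfolding divide_inverse
    by (auto intro!: derivative_eq_intros simp: power2_eq_square)
  note d = this[THEN has_vector_derivative_of_real, THEN has_vector_derivative_mult_right]
  show "(harm s a b has_vector_derivative harm' s a b x) (at x)"
    unfolding harm_def[abs_def] harm'_def by (rule has_vector_derivative_add[OF d(1,2)])
  have "(harm' s a b has_vector_derivative a * complex_of_real (s\<^sup>2 * (sinh (s * (1 - x)) / sinh s)) +
      b * complex_of_real (s\<^sup>2 * (sinh (s * x) / sinh s))) (at x)"
    unfolding harm'_def[abs_def] by (rule has_vector_derivative_add[OF d(3,4)])
  then show "(harm' s a b has_vector_derivative of_real (s\<^sup>2) * harm s a b x) (at x)"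
    unfolding harm_def by (simp add: algebra_simps)
qed

lemma harm_boundary:
  assumes "s > 0"
  shows "harm s a b 0 = a" "harm s a b 1 = b"
    and "harm' s a b 0 = of_real s * (b * of_real (1 / sinh s) - a * of_real (coth s))"
    and "harm' s a b 1 = of_real s * (b * of_real (coth s) - a * of_real (1 / sinh s))"
proof -
  have "sinh s \<noteq> 0" using assms by simp
  then show "harm s a b 0 = a" "harm s a b 1 = b" unfolding harm_def by simp_all
  show "harm' s a b 0 = of_real s * (b * of_real (1 / sinh s) - a * of_real (coth s))"
    "harm' s a b 1 = of_real s * (b * of_real (coth s) - a * of_real (1 / sinh s))"
    unfolding harm'_def coth_def by (simp_all add: algebra_simps)
qed

lemma sinh_ratio_bound:
  fixes s x :: real
  assumes "s > 0" "x \<in> {0..1}"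
  shows "\<bar>sinh (s * (1 - x)) / sinh s\<bar> \<le> exp (- s * x)"
proof -
  have sh: "sinh s > 0" using assms by simp
  have "sinh (s * (1 - x)) \<le> exp (- s * x) * sinh s"
  proof -
    have "exp (- (s * (1 - x))) \<ge> exp (- s * x - s)" using assms by (simp add: algebra_simps)
    then show ?thesis
      by (simp add: sinh_def algebra_simps exp_add[symmetric] exp_diff[symmetric] del: exp_le_cancel_iff)
         (simp add: exp_add[symmetric])
  qed
  moreover have "sinh (s * (1 - x)) \<ge> 0" using assms by simp
  ultimately show ?thesis using sh by (simp add: field_simps)
qed

lemma harm_bound:
  assumes "s > 0" "x \<in> {0..1}"
  shows "cmod (harm s a b x) \<le> cmod a * exp (- s * x) + cmod b * exp (- s * (1 - x))"
proof -
  have "cmod (harm s a b x) \<le> cmod (a * of_real (sinh (s * (1 - x)) / sinh s)) + cmod (b * of_real (sinh (s * x) / sinh s))"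
    unfolding harm_def by (rule norm_triangle_ineq)
  also have "\<dots> \<le> cmod a * exp (- s * x) + cmod b * exp (- s * (1 - x))"
    unfolding norm_mult norm_of_real
    using sinh_ratio_bound[OF assms] sinh_ratio_bound[OF assms(1), of "1 - x"] assms(2)
    by (intro add_mono mult_left_mono) auto
  finally show ?thesis .
qed


section \<open>Steklov eigenvalues and eigenfunctions of one mode\<close>

text \<open>
  Writing the eigenvalue on the curve as \<open>s\<^sup>2\<close> makes \<open>s\<close> the rate of exponential decay along the
  cylinder.
\<close>

locale cylinder_mode = conformal_cylinder K f
  for K :: "'k::{t2_space, second_countable_topology} riem_manifold1" and f +
  fixes Y :: "nat \<Rightarrow> 'k \<Rightarrow> complex" and k :: nat and s :: real
  assumes s_pos: "s > 0"
    and Yk_smooth: "smooth_fun K (Y k)"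
    and Yk_eigen: "- laplacian K (Y k) p = of_real (s\<^sup>2) * Y k p"
    and Yk_norm: "inner_L2 (vol K) (Y k) (Y k) = 1"
begin

abbreviation p :: real where "p \<equiv> 1 / sqrt (f 0)"
abbreviation q :: real where "q \<equiv> 1 / sqrt (f 1)"

lemma pq_pos: "p > 0" "q > 0" and sqrt_f_pos: "sqrt (f 0) > 0" "sqrt (f 1) > 0"
  using f_pos[of 0] f_pos[of 1] by auto

lemma separated: "separated_solution K f (Y k) (s\<^sup>2) (harm s a b) (harm' s a b)"
  by unfold_locales (rule Yk_smooth Yk_eigen Yk_norm harm_deriv)+

text \<open>
  The two rows of the eigenvalue equation, found by testing with the separated solutions whose
  boundary values are concentrated at the left and at the right end.
\<close>

lemma DN_mode_equations:
  assumes DN: "DN K f 0 \<psi> (\<lambda>z. of_real l * \<psi> z)"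
    and \<psi>: "\<And>\<theta>. \<psi> (0, \<theta>) = a * Y k \<theta>" "\<And>\<theta>. \<psi> (1, \<theta>) = b * Y k \<theta>"
  shows "of_real (l - s * p * coth s) * a = - of_real (s * p / sinh s) * b"
    and "of_real (l - s * q * coth s) * b = - of_real (s * q / sinh s) * a"
proof -
  note rel = separated_solution.DN_eigenvalue_relation[OF separated DN \<psi>]
  have n: "of_real p * complex_of_real (sqrt (f 0)) = 1" "of_real q * complex_of_real (sqrt (f 1)) = 1"
    using sqrt_f_pos by (simp_all flip: of_real_mult)
  have "of_real l * (sqrt (f 0) * a) = of_real (s * coth s) * a - of_real (s / sinh s) * b"
    using rel[of 1 0] by (simp add: harm_boundary[OF s_pos] algebra_simps)
  then have "of_real p * (of_real l * (sqrt (f 0) * a)) =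
      of_real p * (of_real (s * coth s) * a - of_real (s / sinh s) * b)"
    by (simp only:)
  moreover have "of_real p * (of_real l * (sqrt (f 0) * a)) = (of_real p * complex_of_real (sqrt (f 0))) * (of_real l * a)"
    by (simp only: mult_ac)
  ultimately have "of_real l * a = of_real p * (of_real (s * coth s) * a - of_real (s / sinh s) * b)"
    unfolding n by (simp only: mult_1_left)
  then show "of_real (l - s * p * coth s) * a = - of_real (s * p / sinh s) * b"
    by (simp add: algebra_simps)
  have "of_real l * (sqrt (f 1) * b) = of_real (s * coth s) * b - of_real (s / sinh s) * a"
    using rel[of 0 1] by (simp add: harm_boundary[OF s_pos] algebra_simps)
  then have "of_real q * (of_real l * (sqrt (f 1) * b)) =
      of_real q * (of_real (s * coth s) * b - of_real (s / sinh s) * a)"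
    by (simp only:)
  moreover have "of_real q * (of_real l * (sqrt (f 1) * b)) = (of_real q * complex_of_real (sqrt (f 1))) * (of_real l * b)"
    by (simp only: mult_ac)
  ultimately have "of_real l * b = of_real q * (of_real (s * coth s) * b - of_real (s / sinh s) * a)"
    unfolding n by (simp only: mult_1_left)
  then show "of_real (l - s * q * coth s) * b = - of_real (s * q / sinh s) * a"
    by (simp add: algebra_simps)
qed

text \<open>
  A nonzero solution of the two linear equations forces the characteristic equation. Conversely,
  for a root the vector that annihilates the first row solves the second one too, and the
  separated solution with these boundary values is an eigenfunction.
\<close>

lemma steklov_eigenvalues_eq:
  "steklov_eigenvalues K f 0 Y k = {root_minus p q s, root_plus p q s}"
proof (intro set_eqI iffI)
  fix l assume "l \<in> steklov_eigenvalues K f 0 Y k"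
  then obtain \<psi> z where \<psi>: "\<psi> \<in> mode_space Y k" "z \<in> cyl_boundary" "\<psi> z \<noteq> 0"
    and DN: "DN K f 0 \<psi> (\<lambda>z. of_real l * \<psi> z)"
    unfolding steklov_eigenvalues_def by blast
  obtain a b where ab: "\<And>\<theta>. \<psi> (0, \<theta>) = a * Y k \<theta>" "\<And>\<theta>. \<psi> (1, \<theta>) = b * Y k \<theta>"
    using \<psi>(1) unfolding mode_space_def by blast
  have nz: "a \<noteq> 0 \<or> b \<noteq> 0" using \<psi>(2,3) ab by (auto simp: cyl_boundary_def)
  define A B P Q where "A = l - s * p * coth s" and "B = l - s * q * coth s"
    and "P = s * p / sinh s" and "Q = s * q / sinh s"
  have eq: "of_real A * a = - of_real P * b" "of_real B * b = - of_real Q * a"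
    unfolding A_def B_def P_def Q_def by (rule DN_mode_equations[OF DN ab])+
  have "of_real B * (of_real A * a) = - of_real P * (of_real B * b)"
    by (simp only: eq(1)) (simp add: mult_ac)
  also have "\<dots> = of_real P * (of_real Q * a)" by (simp only: eq(2)) simp
  finally have 1: "of_real B * (of_real A * a) = of_real P * (of_real Q * a)" .
  have "of_real A * (of_real B * b) = - of_real Q * (of_real A * a)"
    by (simp only: eq(2)) (simp add: mult_ac)
  also have "\<dots> = of_real Q * (of_real P * b)" by (simp only: eq(1)) simp
  finally have 2: "of_real A * (of_real B * b) = of_real Q * (of_real P * b)" .
  have "complex_of_real (A * B) * a = of_real (P * Q) * a" "complex_of_real (A * B) * b = of_real (P * Q) * b"
    unfolding of_real_mult using 1 2 by (simp_all only: mult_ac)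
  with nz have "A * B = P * Q" by (metis mult_cancel_right of_real_eq_iff)
  then have "A * B = s\<^sup>2 * p * q * (1 / sinh s)\<^sup>2"
    unfolding P_def Q_def by (simp add: power2_eq_square)
  then show "l \<in> {root_minus p q s, root_plus p q s}"
    unfolding A_def B_def char_poly_roots[OF s_pos] by simp
next
  fix l assume "l \<in> {root_minus p q s, root_plus p q s}"
  then have char: "(l - s * p * coth s) * (l - s * q * coth s) = s\<^sup>2 * p * q * (1 / sinh s)\<^sup>2"
    unfolding char_poly_roots[OF s_pos] by simp
  \<comment> \<open>a vector in the kernel of the first row\<close>
  define a b where "a = s * p / sinh s" and "b = s * p * coth s - l"
  interpret separated_solution K f "Y k" "s\<^sup>2" "harm s (of_real a) (of_real b)" "harm' s (of_real a) (of_real b)"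
    by (rule separated)
  have sh: "sinh s > 0" using s_pos by simp
  have a: "a > 0" unfolding a_def using s_pos sqrt_f_pos(1) sh by simp
  have pf: "p * sqrt (f 0) = 1" "q * sqrt (f 1) = 1" using sqrt_f_pos by simp_all
  have e0: "s * (b / sinh s - a * coth s) = - (l * sqrt (f 0)) * a"
  proof -
    have "- (l * sqrt (f 0)) * a = - l * (s / sinh s) * (p * sqrt (f 0))" unfolding a_def by simp
    also have "\<dots> = s * (b / sinh s - a * coth s)"
      unfolding pf a_def b_def by (simp add: diff_divide_distrib algebra_simps)
    finally show ?thesis by simp
  qed
  have e1: "s * (b * coth s - a / sinh s) = l * sqrt (f 1) * b"
  proof -
    have "q * (s * (b * coth s - a / sinh s)) = s * q * coth s * b - s\<^sup>2 * p * q * (1 / sinh s)\<^sup>2"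
      unfolding a_def by (simp add: power2_eq_square algebra_simps)
    also have "\<dots> = l * b" unfolding char[symmetric] b_def by (simp add: algebra_simps)
    finally have "sqrt (f 1) * (q * (s * (b * coth s - a / sinh s))) = sqrt (f 1) * (l * b)" by simp
    then show ?thesis using pf(2) sqrt_f_pos(2) by (simp add: mult_ac)
  qed
  have "DN K f 0 U (\<lambda>z. of_real l * U z)"
  proof (rule DN_U)
    show "harm' s (of_real a) (of_real b) 0 = - of_real (l * sqrt (f 0)) * harm s (of_real a) (of_real b) 0"
      using arg_cong[OF e0, of complex_of_real] by (simp add: harm_boundary[OF s_pos])
    show "harm' s (of_real a) (of_real b) 1 = of_real (l * sqrt (f 1)) * harm s (of_real a) (of_real b) 1"
      using arg_cong[OF e1, of complex_of_real] by (simp add: harm_boundary[OF s_pos])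
  qed
  moreover have "U \<in> mode_space Y k"
    unfolding mode_space_def U_def by auto
  moreover have "\<exists>z\<in>cyl_boundary. U z \<noteq> 0"
  proof -
    obtain \<theta> where "Y k \<theta> \<noteq> 0"
    proof (rule ccontr)
      assume "\<not> thesis"
      then have "Y k \<theta> = 0" for \<theta> using that by blast
      then show False using Yk_norm unfolding inner_L2_def by simp
    qed
    then have "U (0, \<theta>) \<noteq> 0" using a by (simp add: U_def harm_boundary[OF s_pos])
    then show ?thesis by (intro bexI[of _ "(0, \<theta>)"]) (auto simp: cyl_boundary_def)
  qed
  ultimately show "l \<in> steklov_eigenvalues K f 0 Y k" unfolding steklov_eigenvalues_def by blast
qed

lemma steklov_minus_eq: "steklov_minus K f 0 Y k = root_minus p q s"
  and steklov_plus_eq: "steklov_plus K f 0 Y k = root_plus p q s"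
proof -
  have "root_minus p q s \<le> root_plus p q s"
    using gap_bounds(1)[OF s_pos pq_pos] s_pos unfolding root_minus_def root_plus_def
    by (intro mult_left_mono) auto
  then show "steklov_minus K f 0 Y k = root_minus p q s" "steklov_plus K f 0 Y k = root_plus p q s"
    unfolding steklov_minus_def steklov_plus_def steklov_eigenvalues_eq by simp_all
qed

text \<open>
  Normalisation bounds the coefficients \<open>a\<close>, \<open>b\<close> on the two boundary components, since the
  measure there carries the weights \<open>1 / p\<close> and \<open>1 / q\<close>. The eigenfunction is the separated solution
  with these coefficients, whose two parts decay exponentially away from their ends, and the
  factor on the curve is bounded independently of the eigenvalue.
\<close>

lemma steklov_eigenfunction_bound:
  assumes spec: "0 \<notin> dirichlet_spectrum K f" and \<phi>: "steklov_eigenfunction K f 0 Y k l \<phi>"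
  defines "M \<equiv> sqrt (2 / measure (vol K) UNIV)"
  obtains a b where
    "of_real (l - s * p * coth s) * a = - of_real (s * p / sinh s) * b"
    "of_real (l - s * q * coth s) * b = - of_real (s * q / sinh s) * a"
    "cmod a \<le> sqrt p" "cmod b \<le> sqrt q"
    "\<And>x \<theta>. x \<in> {0..1} \<Longrightarrow>
      cmod (\<phi> (x, \<theta>)) \<le> M * (cmod a * exp (- s * x) + cmod b * exp (- s * (1 - x)))"
proof -
  obtain \<psi> where cont: "continuous_on cyl \<phi>" and \<psi>: "\<psi> \<in> mode_space Y k"
    and norm: "(LINT z|vol_boundary K f. (cmod (\<psi> z))\<^sup>2) = 1"
    and DN: "DN K f 0 \<psi> (\<lambda>z. of_real l * \<psi> z)" and sol: "dirichlet_solution K f 0 \<phi> \<psi>"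
    using \<phi> unfolding steklov_eigenfunction_def by blast
  obtain a b where ab: "\<And>\<theta>. \<psi> (0, \<theta>) = a * Y k \<theta>" "\<And>\<theta>. \<psi> (1, \<theta>) = b * Y k \<theta>"
    using \<psi> unfolding mode_space_def by blast
  interpret separated_solution K f "Y k" "s\<^sup>2" "harm s a b" "harm' s a b" by (rule separated)
  have "inner_L2 (vol_boundary K f) \<psi> \<psi> = of_real (LINT z|vol_boundary K f. (cmod (\<psi> z))\<^sup>2)"
    unfolding inner_L2_def by (simp add: complex_norm_square[symmetric] flip: of_real_power)
  then have "of_real (sqrt (f 0)) * (a * cnj a) + of_real (sqrt (f 1)) * (b * cnj b) = (1 :: complex)"
    using inner_boundary_modes[OF ab ab] norm by simp
  then have "complex_of_real (sqrt (f 0) * (cmod a)\<^sup>2 + sqrt (f 1) * (cmod b)\<^sup>2) = of_real 1"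
    by (simp only: of_real_add of_real_mult complex_norm_square of_real_1)
  then have nrm: "sqrt (f 0) * (cmod a)\<^sup>2 + sqrt (f 1) * (cmod b)\<^sup>2 = 1" by (simp only: of_real_eq_iff)
  have ge: "0 \<le> sqrt (f 0) * (cmod a)\<^sup>2" "0 \<le> sqrt (f 1) * (cmod b)\<^sup>2"
    using sqrt_f_pos by (intro mult_nonneg_nonneg; simp)+
  then have "sqrt (f 0) * (cmod a)\<^sup>2 \<le> 1" "sqrt (f 1) * (cmod b)\<^sup>2 \<le> 1" using nrm by linarith+
  then have "(cmod a)\<^sup>2 \<le> p" "(cmod b)\<^sup>2 \<le> q"
    using sqrt_f_pos by (simp_all add: pos_le_divide_eq mult.commute)
  then have small: "cmod a \<le> sqrt p" "cmod b \<le> sqrt q" by (simp_all only: real_le_rsqrt)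
  have bound: "cmod (\<phi> (x, \<theta>)) \<le> M * (cmod a * exp (- s * x) + cmod b * exp (- s * (1 - x)))"
    if x: "x \<in> {0..1}" for x \<theta>
  proof -
    have "\<phi> (x, \<theta>) = U (x, \<theta>)"
      by (rule dirichlet_solution_eq_U[OF spec cont sol])
         (use x in \<open>auto simp: ab harm_boundary[OF s_pos] cyl_def\<close>)
    then have "cmod (\<phi> (x, \<theta>)) = cmod (harm s a b x) * cmod (Y k \<theta>)" by (simp add: U_def norm_mult)
    also have "\<dots> \<le> (cmod a * exp (- s * x) + cmod b * exp (- s * (1 - x))) * M"
    proof (rule mult_mono[OF harm_bound[OF s_pos x]])
      have "(cmod (Y k \<theta>))\<^sup>2 \<le> 2 / measure (vol K) UNIV"
        by (rule eigenfunction_bound[OF Yk_smooth Yk_eigen _ Yk_norm]) (use s_pos in simp)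
      then show "cmod (Y k \<theta>) \<le> M" unfolding M_def by (rule real_le_rsqrt)
    qed auto
    finally show ?thesis by (simp add: mult.commute)
  qed
  show ?thesis by (rule that[OF DN_mode_equations[OF DN ab] small bound])
qed

end

section \<open>Asymptotics and localisation\<close>

text \<open>
  If an eigenvalue stays away from a diagonal entry, the corresponding row of the eigenvalue
  equation makes that component of the eigenvector as small as the off-diagonal entry, which is
  exponentially small.
\<close>

lemma component_decay:
  fixes a b :: complex and A P s \<delta> \<kappa> \<beta> :: real
  assumes eq: "of_real A * a = - of_real (s * P / sinh s) * b"
    and A: "s * \<delta> \<le> \<bar>A\<bar>" and pos: "\<delta> > 0" "s > 0" "P > 0"
    and b: "cmod b \<le> \<beta>" and \<kappa>: "1 / sinh s \<le> \<kappa> * exp (- s)"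
  shows "cmod a \<le> P * \<beta> * \<kappa> / \<delta> * exp (- s)"
proof -
  have sh: "sinh s > 0" using pos by simp
  have "s * \<delta> * cmod a \<le> \<bar>A\<bar> * cmod a" by (intro mult_right_mono A) simp
  also have "\<dots> = cmod (of_real A * a)" by (simp add: norm_mult)
  also have "\<dots> = s * P * (cmod b * (1 / sinh s))"
    unfolding eq using pos sh by (simp add: norm_mult norm_divide)
  also have "\<dots> \<le> s * P * (\<beta> * (\<kappa> * exp (- s)))"
    using b \<kappa> pos sh order_trans[OF norm_ge_zero b] by (intro mult_left_mono mult_mono) auto
  finally have "s * (\<delta> * cmod a) \<le> s * (P * \<beta> * \<kappa> * exp (- s))" by (simp only: mult_ac)
  then have "\<delta> * cmod a \<le> P * \<beta> * \<kappa> * exp (- s)" using pos(2) by simp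
  then show ?thesis using pos(1) by (simp add: field_simps)
qed

lemma two_term_bound:
  fixes M \<alpha> \<beta> e1 e2 :: real
  assumes "M \<ge> 0" "\<alpha> \<ge> 0" "\<beta> \<ge> 0" "e1 \<ge> 0" "e2 \<ge> 0"
  shows "M * (\<alpha> * e1 + \<beta> * e2) \<le> (M * (\<alpha> + \<beta>) + 1) * (e1 + e2)"
proof -
  have "0 \<le> M * \<alpha> * e2 + M * \<beta> * e1 + (e1 + e2)" using assms by simp
  then show ?thesis by (simp add: algebra_simps)
qed

lemma roots_equal_weights:
  assumes "s > 0" "p > 0" "1 / sinh s \<le> \<kappa> * exp (- s)"
  shows "\<bar>root_plus p p s - s * p\<bar> \<le> 2 * p * \<kappa> * (s * exp (- s))"
    and "\<bar>root_minus p p s - s * p\<bar> \<le> 2 * p * \<kappa> * (s * exp (- s))"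
    and "root_plus p p s - root_minus p p s = 2 * p * (s / sinh s)"
proof -
  have sh: "sinh s > 0" using assms by simp
  have gap: "gap p p s = 2 * p * (1 / sinh s)"
    unfolding gap_def using assms sh by simp
  have c: "0 \<le> coth s - 1" "coth s - 1 \<le> 1 / sinh s" using coth_bounds[OF assms(1)] by auto
  have b: "\<bar>s * p * x\<bar> \<le> 2 * p * \<kappa> * (s * exp (- s))" if "\<bar>x\<bar> \<le> 2 * (1 / sinh s)" for x
  proof -
    have "\<bar>s * p * x\<bar> = s * p * \<bar>x\<bar>" using assms by (simp add: abs_mult)
    also have "\<dots> \<le> s * p * (2 * (\<kappa> * exp (- s)))"
      using that assms by (intro mult_left_mono) auto
    finally show ?thesis by (simp add: mult_ac)
  qed
  have "root_plus p p s - s * p = s * p * ((coth s - 1) + 1 / sinh s)"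
    unfolding root_plus_def gap by (simp add: algebra_simps)
  then show "\<bar>root_plus p p s - s * p\<bar> \<le> 2 * p * \<kappa> * (s * exp (- s))" using b c sh by simp
  have "root_minus p p s - s * p = s * p * ((coth s - 1) - 1 / sinh s)"
    unfolding root_minus_def gap by (simp add: algebra_simps)
  then show "\<bar>root_minus p p s - s * p\<bar> \<le> 2 * p * \<kappa> * (s * exp (- s))" using b c sh by simp
  show "root_plus p p s - root_minus p p s = 2 * p * (s / sinh s)"
    unfolding root_plus_def root_minus_def gap by (simp add: algebra_simps)
qed

text \<open>
  Apart from the main term the roots consist of \<open>coth s - 1\<close>, of order \<open>exp (- s)\<close>, and of the excess of
  \<open>gap\<close> over \<open>\<bar>p - q\<bar>\<close>, which is of second order in \<open>1 / sinh s\<close>. The first contribution drops out of the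
  difference of the roots.
\<close>

lemma roots_distinct_weights:
  assumes s: "s > 0" and pq: "p > 0" "q > 0" "p \<noteq> q" and \<kappa>: "1 / sinh s \<le> \<kappa> * exp (- s)"
  defines "c \<equiv> (p + q)\<^sup>2 / \<bar>p - q\<bar> * \<kappa>\<^sup>2"
  shows "\<bar>root_plus p q s - max p q * s\<bar> \<le> ((p + q) * \<kappa> + c) * (s * exp (- s))"
    and "\<bar>root_minus p q s - min p q * s\<bar> \<le> ((p + q) * \<kappa> + c) * (s * exp (- s))"
    and "\<bar>root_plus p q s - root_minus p q s - \<bar>p - q\<bar> * s\<bar> \<le> c * (s * exp (- 2 * s))"
proof -
  have sh: "sinh s > 0" using s by simp
  have \<kappa>0: "\<kappa> > 0"
  proof -
    have "0 < \<kappa> * exp (- s)" using \<kappa> sh by (meson less_le_trans zero_less_divide_1_iff)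
    then show ?thesis by (simp add: zero_less_mult_iff)
  qed
  have coth: "0 \<le> coth s - 1" "coth s - 1 \<le> \<kappa> * exp (- s)" using coth_bounds[OF s] \<kappa> by auto
  define g where "g = gap p q s - \<bar>p - q\<bar>"
  have g0: "g \<ge> 0" unfolding g_def using gap_bounds(2)[OF s pq(1,2)] by simp
  have "g \<le> (p + q)\<^sup>2 / \<bar>p - q\<bar> * (1 / sinh s)\<^sup>2"
    unfolding g_def by (rule gap_bounds(4)[OF s pq])
  also have "\<dots> \<le> (p + q)\<^sup>2 / \<bar>p - q\<bar> * (\<kappa> * exp (- s))\<^sup>2"
    using \<kappa> sh by (intro mult_left_mono power_mono) auto
  also have "\<dots> = c * exp (- 2 * s)"
    unfolding c_def by (simp add: power_mult_distrib exp_double[symmetric])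
  finally have g1: "g \<le> c * exp (- 2 * s)" .
  have c0: "c \<ge> 0" unfolding c_def by simp
  have "c * exp (- 2 * s) \<le> c * exp (- s)" using c0 s by (intro mult_left_mono) auto
  then have g2: "g \<le> c * exp (- s)" using g1 by simp
  have half: "\<bar>s / 2 * ((p + q) * (coth s - 1) + t)\<bar> \<le> ((p + q) * \<kappa> + c) * (s * exp (- s))"
    if "\<bar>t\<bar> \<le> g" for t
  proof -
    have "\<bar>(p + q) * (coth s - 1) + t\<bar> \<le> (p + q) * (coth s - 1) + g"
      using that coth(1) pq by (intro order_trans[OF abs_triangle_ineq] add_mono) (auto simp: abs_mult)
    also have "\<dots> \<le> (p + q) * (\<kappa> * exp (- s)) + c * exp (- s)"
      using coth pq g2 by (intro add_mono mult_left_mono) auto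
    also have "\<dots> = ((p + q) * \<kappa> + c) * exp (- s)" by (simp add: algebra_simps)
    finally have 1: "\<bar>(p + q) * (coth s - 1) + t\<bar> \<le> ((p + q) * \<kappa> + c) * exp (- s)" .
    have "\<bar>s / 2 * ((p + q) * (coth s - 1) + t)\<bar> = s / 2 * \<bar>(p + q) * (coth s - 1) + t\<bar>"
      using s by (simp add: abs_mult)
    also have "\<dots> \<le> s * (((p + q) * \<kappa> + c) * exp (- s))"
      using 1 s by (intro mult_mono) auto
    finally show ?thesis by (simp add: mult_ac)
  qed
  have mx: "max p q = (p + q + \<bar>p - q\<bar>) / 2" "min p q = (p + q - \<bar>p - q\<bar>) / 2"
    by (auto simp: max_def min_def)
  have "root_plus p q s - max p q * s = s / 2 * ((p + q) * (coth s - 1) + g)"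
    unfolding root_plus_def mx g_def by (simp add: algebra_simps add_divide_distrib diff_divide_distrib)
  then show "\<bar>root_plus p q s - max p q * s\<bar> \<le> ((p + q) * \<kappa> + c) * (s * exp (- s))"
    using half[of g] g0 by simp
  have "root_minus p q s - min p q * s = s / 2 * ((p + q) * (coth s - 1) + (- g))"
    unfolding root_minus_def mx g_def by (simp add: algebra_simps add_divide_distrib diff_divide_distrib)
  then show "\<bar>root_minus p q s - min p q * s\<bar> \<le> ((p + q) * \<kappa> + c) * (s * exp (- s))"
    using half[of "- g"] g0 by simp
  have "root_plus p q s - root_minus p q s - \<bar>p - q\<bar> * s = s * g"
    unfolding root_minus_def root_plus_def g_def by (simp add: algebra_simps)
  moreover have "\<bar>s * g\<bar> \<le> s * (c * exp (- 2 * s))" using g0 g1 s by (simp add: abs_mult)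
  ultimately show "\<bar>root_plus p q s - root_minus p q s - \<bar>p - q\<bar> * s\<bar> \<le> c * (s * exp (- 2 * s))"
    by (simp add: mult_ac)
qed

context cylinder_mode begin

lemma eigenfunction_two_ended:
  assumes spec: "0 \<notin> dirichlet_spectrum K f" and \<phi>: "steklov_eigenfunction K f 0 Y k l \<phi>"
    and x: "x \<in> {0..1}"
  shows "cmod (\<phi> (x, \<theta>)) \<le>
    (sqrt (2 / measure (vol K) UNIV) * (sqrt p + sqrt q) + 1) * (exp (- s * x) + exp (- s * (1 - x)))"
proof (rule steklov_eigenfunction_bound[OF spec \<phi>])
  let ?M = "sqrt (2 / measure (vol K) UNIV)"
  fix a b
  assume ab: "cmod a \<le> sqrt p" "cmod b \<le> sqrt q"
    and "\<And>x \<theta>. x \<in> {0..1} \<Longrightarrow> cmod (\<phi> (x, \<theta>)) \<le> ?M * (cmod a * exp (- s * x) + cmod b * exp (- s * (1 - x)))"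
  then have "cmod (\<phi> (x, \<theta>)) \<le> ?M * (cmod a * exp (- s * x) + cmod b * exp (- s * (1 - x)))" using x by blast
  also have "\<dots> \<le> ?M * (sqrt p * exp (- s * x) + sqrt q * exp (- s * (1 - x)))"
    by (intro mult_left_mono add_mono mult_right_mono ab) auto
  also have "\<dots> \<le> (?M * (sqrt p + sqrt q) + 1) * (exp (- s * x) + exp (- s * (1 - x)))"
    by (rule two_term_bound) (use pq_pos in auto)
  finally show ?thesis .
qed

text \<open>
  The eigenvalue is separated from the diagonal entry of the right end, so the right component
  is exponentially small and the eigenfunction lives near the left end.
\<close>

lemma eigenfunction_at_left_end:
  assumes spec: "0 \<notin> dirichlet_spectrum K f" and \<phi>: "steklov_eigenfunction K f 0 Y k l \<phi>"
    and sep: "s * \<delta> \<le> \<bar>l - s * q * coth s\<bar>" "\<delta> > 0"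
    and \<kappa>: "1 / sinh s \<le> \<kappa> * exp (- s)" "\<kappa> > 0"
    and x: "x \<in> {0..1}"
  shows "cmod (\<phi> (x, \<theta>)) \<le>
    (sqrt (2 / measure (vol K) UNIV) * (sqrt p + q * sqrt p * \<kappa> / \<delta>) + 1) *
      (exp (- s * x) + exp (- s * (2 - x)))"
proof (rule steklov_eigenfunction_bound[OF spec \<phi>])
  let ?M = "sqrt (2 / measure (vol K) UNIV)" and ?B = "q * sqrt p * \<kappa> / \<delta>"
  fix a b
  assume eq: "of_real (l - s * q * coth s) * b = - of_real (s * q / sinh s) * a"
    and a: "cmod a \<le> sqrt p"
    and "\<And>x \<theta>. x \<in> {0..1} \<Longrightarrow> cmod (\<phi> (x, \<theta>)) \<le> ?M * (cmod a * exp (- s * x) + cmod b * exp (- s * (1 - x)))"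
  then have "cmod (\<phi> (x, \<theta>)) \<le> ?M * (cmod a * exp (- s * x) + cmod b * exp (- s * (1 - x)))" using x by blast
  also have "\<dots> \<le> ?M * (sqrt p * exp (- s * x) + (?B * exp (- s)) * exp (- s * (1 - x)))"
    using component_decay[OF eq sep s_pos pq_pos(2) a \<kappa>(1)] a
    by (intro mult_left_mono add_mono mult_right_mono) auto
  also have "(?B * exp (- s)) * exp (- s * (1 - x)) = ?B * exp (- s * (2 - x))"
    by (simp add: exp_add[symmetric] algebra_simps)
  also have "?M * (sqrt p * exp (- s * x) + ?B * exp (- s * (2 - x))) \<le>
      (?M * (sqrt p + ?B) + 1) * (exp (- s * x) + exp (- s * (2 - x)))"
    by (rule two_term_bound) (use pq_pos sep(2) \<kappa>(2) sqrt_f_pos in auto)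
  finally show ?thesis .
qed

lemma eigenfunction_at_right_end:
  assumes spec: "0 \<notin> dirichlet_spectrum K f" and \<phi>: "steklov_eigenfunction K f 0 Y k l \<phi>"
    and sep: "s * \<delta> \<le> \<bar>l - s * p * coth s\<bar>" "\<delta> > 0"
    and \<kappa>: "1 / sinh s \<le> \<kappa> * exp (- s)" "\<kappa> > 0"
    and x: "x \<in> {0..1}"
  shows "cmod (\<phi> (x, \<theta>)) \<le>
    (sqrt (2 / measure (vol K) UNIV) * (p * sqrt q * \<kappa> / \<delta> + sqrt q) + 1) *
      (exp (- s * (1 + x)) + exp (- s * (1 - x)))"
proof (rule steklov_eigenfunction_bound[OF spec \<phi>])
  let ?M = "sqrt (2 / measure (vol K) UNIV)" and ?A = "p * sqrt q * \<kappa> / \<delta>"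
  fix a b
  assume eq: "of_real (l - s * p * coth s) * a = - of_real (s * p / sinh s) * b"
    and b: "cmod b \<le> sqrt q"
    and "\<And>x \<theta>. x \<in> {0..1} \<Longrightarrow> cmod (\<phi> (x, \<theta>)) \<le> ?M * (cmod a * exp (- s * x) + cmod b * exp (- s * (1 - x)))"
  then have "cmod (\<phi> (x, \<theta>)) \<le> ?M * (cmod a * exp (- s * x) + cmod b * exp (- s * (1 - x)))" using x by blast
  also have "\<dots> \<le> ?M * ((?A * exp (- s)) * exp (- s * x) + sqrt q * exp (- s * (1 - x)))"
    using component_decay[OF eq sep s_pos pq_pos(1) b \<kappa>(1)] b
    by (intro mult_left_mono add_mono mult_right_mono) auto
  also have "(?A * exp (- s)) * exp (- s * x) = ?A * exp (- s * (1 + x))"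
    by (simp add: exp_add[symmetric] algebra_simps)
  also have "?M * (?A * exp (- s * (1 + x)) + sqrt q * exp (- s * (1 - x))) \<le>
      (?M * (?A + sqrt q) + 1) * (exp (- s * (1 + x)) + exp (- s * (1 - x)))"
    by (rule two_term_bound) (use pq_pos sep(2) \<kappa>(2) sqrt_f_pos in auto)
  finally show ?thesis .
qed

end

lemma bigo_from_one:
  fixes g h :: "nat \<Rightarrow> real"
  assumes "\<And>m. m \<ge> 1 \<Longrightarrow> \<bar>g m\<bar> \<le> C * h m" "\<And>m. h m \<ge> 0"
  shows "g \<in> O(h)"
  by (rule bigoI[of _ C]) (use assms in \<open>auto intro!: eventually_sequentiallyI[of 1]\<close>)

theorem theorem1p3:
  fixes K :: "'k::{t2_space, second_countable_topology} riem_manifold1"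
    and f :: "real \<Rightarrow> real"
    and \<omega> :: real
    and \<mu> :: "nat \<Rightarrow> real"
    and Y :: "nat \<Rightarrow> 'k \<Rightarrow> complex"
    and lminus lplus d :: "nat \<Rightarrow> real"
    and \<phi>minus \<phi>plus :: "nat \<Rightarrow> real \<times> 'k \<Rightarrow> complex"
  assumes K: "closed_connected_riem_manifold1 K"
    and f_smooth: "smooth_on {0..1} f"
    and f_pos: "\<forall>x\<in>{0..1}. f x > 0"
    and \<omega>_spec: "\<omega> \<notin> dirichlet_spectrum K f"
    and Y: "laplace_eigenbasis K \<mu> Y"
    and lminus: "lminus = steklov_minus K f \<omega> Y"
    and lplus: "lplus = steklov_plus K f \<omega> Y"
    and d: "d = (\<lambda>m. lplus m - lminus m)"
    and \<phi>minus: "\<forall>m. steklov_eigenfunction K f \<omega> Y m (lminus m) (\<phi>minus m)"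
    and \<phi>plus: "\<forall>m. steklov_eigenfunction K f \<omega> Y m (lplus m) (\<phi>plus m)"
    and \<omega>_zero: "\<omega> = 0"
  shows
    "(f 0 = f 1 \<longrightarrow>
        (\<lambda>m. lplus m - sqrt (\<mu> m) / sqrt (f 0)) \<in> O(\<lambda>m. sqrt (\<mu> m) * exp (- sqrt (\<mu> m))) \<and>
        (\<lambda>m. lminus m - sqrt (\<mu> m) / sqrt (f 0)) \<in> O(\<lambda>m. sqrt (\<mu> m) * exp (- sqrt (\<mu> m))) \<and>
        (\<forall>m\<ge>1. d m = 2 / sqrt (f 0) * (sqrt (\<mu> m) / sinh (sqrt (\<mu> m)))) \<and>
        (\<exists>C>0. \<exists>m0>0. \<forall>m\<ge>m0. \<forall>x\<in>{0..1}. \<forall>\<theta>.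
           cmod (\<phi>plus m (x, \<theta>)) \<le> C * (exp (- sqrt (\<mu> m) * x) + exp (- sqrt (\<mu> m) * (1 - x))) \<and>
           cmod (\<phi>minus m (x, \<theta>)) \<le> C * (exp (- sqrt (\<mu> m) * x) + exp (- sqrt (\<mu> m) * (1 - x)))))
     \<and>
     (f 0 \<noteq> f 1 \<longrightarrow>
        (\<lambda>m. lplus m - max (1 / sqrt (f 0)) (1 / sqrt (f 1)) * sqrt (\<mu> m))
           \<in> O(\<lambda>m. sqrt (\<mu> m) * exp (- sqrt (\<mu> m))) \<and>
        (\<lambda>m. lminus m - min (1 / sqrt (f 0)) (1 / sqrt (f 1)) * sqrt (\<mu> m))
           \<in> O(\<lambda>m. sqrt (\<mu> m) * exp (- sqrt (\<mu> m))) \<and>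
        (\<lambda>m. d m - \<bar>1 / sqrt (f 0) - 1 / sqrt (f 1)\<bar> * sqrt (\<mu> m))
           \<in> O(\<lambda>m. sqrt (\<mu> m) * exp (- 2 * sqrt (\<mu> m))) \<and>
        (f 0 < f 1 \<longrightarrow>
          (\<exists>C>0. \<exists>m0>0. \<forall>m\<ge>m0. \<forall>x\<in>{0..1}. \<forall>\<theta>.
             cmod (\<phi>plus m (x, \<theta>)) \<le> C * (exp (- sqrt (\<mu> m) * x) + exp (- sqrt (\<mu> m) * (2 - x))) \<and>
             cmod (\<phi>minus m (x, \<theta>)) \<le> C * (exp (- sqrt (\<mu> m) * (1 + x)) + exp (- sqrt (\<mu> m) * (1 - x))))) \<and>
        (f 0 > f 1 \<longrightarrow>
          (\<exists>C>0. \<exists>m0>0. \<forall>m\<ge>m0. \<forall>x\<in>{0..1}. \<forall>\<theta>.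
             cmod (\<phi>minus m (x, \<theta>)) \<le> C * (exp (- sqrt (\<mu> m) * x) + exp (- sqrt (\<mu> m) * (2 - x))) \<and>
             cmod (\<phi>plus m (x, \<theta>)) \<le> C * (exp (- sqrt (\<mu> m) * (1 + x)) + exp (- sqrt (\<mu> m) * (1 - x))))))"
proof -
  have spec: "0 \<notin> dirichlet_spectrum K f" using \<omega>_spec \<omega>_zero by simp
  interpret conformal_cylinder K f
  proof unfold_locales
    show "closed_connected_riem_manifold1 K" by (rule K)
    show "continuous_on {0..1} f" by (rule smooth_on_continuous[OF f_smooth])
    show "f x > 0" if "x \<in> {0..1}" for x using f_pos that by (rule bspec)
  qed
  note basis = Y[unfolded laplace_eigenbasis_def]
  define s where "s m = sqrt (\<mu> m)" for m
  have \<mu>_mono: "mono \<mu>" using basis by (elim conjE)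
  have \<mu>1: "0 < \<mu> 1" using basis by (elim conjE)
  have \<mu>0: "\<mu> 0 = 0" using basis by (elim conjE)
  have \<mu>_nonneg: "0 \<le> \<mu> m" for m using monoD[OF \<mu>_mono, of 0 m] \<mu>0 by simp
  have s_ge: "s 1 \<le> s m" if "m \<ge> 1" for m using monoD[OF \<mu>_mono that] unfolding s_def by simp
  have s1: "0 < s 1" unfolding s_def using \<mu>1 by simp
  have s_pos: "0 < s m" if "m \<ge> 1" for m using s_ge[OF that] s1 by simp
  have modes: "\<forall>m. smooth_fun K (Y m) \<and> (\<forall>p. - laplacian K (Y m) p = of_real (\<mu> m) * Y m p)"
    using basis by (elim conjE)
  have orth: "\<forall>i j. inner_L2 (vol K) (Y i) (Y j) = (if i = j then 1 else 0)"
    using basis by (elim conjE)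
  have mode: "cylinder_mode K f Y m (s m)" if "m \<ge> 1" for m
  proof unfold_locales
    have s2: "(s m)\<^sup>2 = \<mu> m" by (simp add: s_def \<mu>_nonneg)
    show "s m > 0" by (rule s_pos[OF that])
    show "smooth_fun K (Y m)" using modes by blast
    show "- laplacian K (Y m) p = of_real ((s m)\<^sup>2) * Y m p" for p using modes unfolding s2 by blast
    show "inner_L2 (vol K) (Y m) (Y m) = 1" using orth by simp
  qed
  define p q where "p = 1 / sqrt (f 0)" and "q = 1 / sqrt (f 1)"
  have f01: "f 0 > 0" "f 1 > 0" using f_pos[of 0] f_pos[of 1] by simp_all
  then have pq: "p > 0" "q > 0" unfolding p_def q_def by auto
  have lm: "lminus m = root_minus p q (s m)" and lp: "lplus m = root_plus p q (s m)" if "m \<ge> 1" for m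
    unfolding lminus lplus \<omega>_zero p_def q_def
    by (rule cylinder_mode.steklov_minus_eq[OF mode[OF that]], rule cylinder_mode.steklov_plus_eq[OF mode[OF that]])
  define \<kappa> where "\<kappa> = 2 / (1 - exp (- 2 * s 1))"
  have \<kappa>_pos: "\<kappa> > 0" unfolding \<kappa>_def using s1 by simp
  have \<kappa>: "1 / sinh (s m) \<le> \<kappa> * exp (- s m)" if "m \<ge> 1" for m
    unfolding \<kappa>_def by (rule inverse_sinh_bound[OF s1 s_ge[OF that]])
  have \<phi>p: "steklov_eigenfunction K f 0 Y m (root_plus p q (s m)) (\<phi>plus m)"
    and \<phi>m: "steklov_eigenfunction K f 0 Y m (root_minus p q (s m)) (\<phi>minus m)" if "m \<ge> 1" for m
    using \<phi>plus \<phi>minus \<omega>_zero lp[OF that] lm[OF that] by metis+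
  define M where "M = sqrt (2 / measure (vol K) UNIV)"
  have M: "M \<ge> 0" unfolding M_def by simp
  \<comment> \<open>The constants do not depend on \<open>m\<close>: \<open>\<kappa>\<close>, computed from the smallest positive eigenvalue, bounds
    \<open>exp s / sinh s\<close> for all \<open>m \<ge> 1\<close>.\<close>
  have left: "cmod (\<phi> (x, \<theta>)) \<le> (M * (sqrt p + q * sqrt p * \<kappa> / \<bar>p - q\<bar>) + 1) *
        (exp (- sqrt (\<mu> m) * x) + exp (- sqrt (\<mu> m) * (2 - x)))"
    if "p \<noteq> q" "m \<ge> 1" "steklov_eigenfunction K f 0 Y m l \<phi>"
      "s m * \<bar>p - q\<bar> \<le> \<bar>l - s m * q * coth (s m)\<bar>" "x \<in> {0..1}" for m l \<phi> x \<theta>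
    using cylinder_mode.eigenfunction_at_left_end[OF mode[OF that(2)] spec that(3)
      that(4)[unfolded q_def] _ \<kappa>[OF that(2)] \<kappa>_pos that(5)] that(1)
    unfolding M_def p_def q_def s_def by simp
  have right: "cmod (\<phi> (x, \<theta>)) \<le> (M * (p * sqrt q * \<kappa> / \<bar>p - q\<bar> + sqrt q) + 1) *
        (exp (- sqrt (\<mu> m) * (1 + x)) + exp (- sqrt (\<mu> m) * (1 - x)))"
    if "p \<noteq> q" "m \<ge> 1" "steklov_eigenfunction K f 0 Y m l \<phi>"
      "s m * \<bar>p - q\<bar> \<le> \<bar>l - s m * p * coth (s m)\<bar>" "x \<in> {0..1}" for m l \<phi> x \<theta>
    using cylinder_mode.eigenfunction_at_right_end[OF mode[OF that(2)] spec that(3)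
      that(4)[unfolded p_def] _ \<kappa>[OF that(2)] \<kappa>_pos that(5)] that(1)
    unfolding M_def p_def q_def s_def by simp
  define CL CR where "CL = M * (sqrt p + q * sqrt p * \<kappa> / \<bar>p - q\<bar>) + 1"
    and "CR = M * (p * sqrt q * \<kappa> / \<bar>p - q\<bar> + sqrt q) + 1"
  have CLR: "0 < CL" "0 < CR" unfolding CL_def CR_def
    using M pq \<kappa>_pos by (auto intro!: add_nonneg_pos mult_nonneg_nonneg add_nonneg_nonneg divide_nonneg_nonneg)
  have enlarge: "C * e \<le> (CL + CR) * e" if "e \<ge> 0" "C = CL \<or> C = CR" for C e :: real
    using that CLR by (intro mult_right_mono) auto
  show ?thesis
  proof (intro conjI impI)
    assume eq: "f 0 = f 1"
    then have qp: "q = p" unfolding p_def q_def by simp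
    note R = roots_equal_weights[OF s_pos pq(1) \<kappa>]
    have f0: "sqrt (\<mu> m) / sqrt (f 0) = s m * p" for m by (simp add: s_def p_def)
    show "(\<lambda>m. lplus m - sqrt (\<mu> m) / sqrt (f 0)) \<in> O(\<lambda>m. sqrt (\<mu> m) * exp (- sqrt (\<mu> m)))"
      unfolding f0 by (rule bigo_from_one[of _ "2 * p * \<kappa>"]) (use R(1) lp qp \<mu>_nonneg in \<open>auto simp: s_def\<close>)
    show "(\<lambda>m. lminus m - sqrt (\<mu> m) / sqrt (f 0)) \<in> O(\<lambda>m. sqrt (\<mu> m) * exp (- sqrt (\<mu> m)))"
      unfolding f0 by (rule bigo_from_one[of _ "2 * p * \<kappa>"]) (use R(2) lm qp \<mu>_nonneg in \<open>auto simp: s_def\<close>)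
    show "\<forall>m\<ge>1. d m = 2 / sqrt (f 0) * (sqrt (\<mu> m) / sinh (sqrt (\<mu> m)))"
      using R(3) lm lp qp by (simp add: d s_def p_def)
    have "cmod (\<phi> (x, \<theta>)) \<le> (M * (sqrt p + sqrt q) + 1) *
        (exp (- sqrt (\<mu> m) * x) + exp (- sqrt (\<mu> m) * (1 - x)))"
      if "m \<ge> 1" "steklov_eigenfunction K f 0 Y m l \<phi>" "x \<in> {0..1}" for m l \<phi> x \<theta>
      using cylinder_mode.eigenfunction_two_ended[OF mode[OF that(1)] spec that(2,3)]
      unfolding M_def p_def q_def s_def .
    moreover have "M * (sqrt p + sqrt q) + 1 > 0" using M pq by (intro add_nonneg_pos mult_nonneg_nonneg) auto
    ultimately show "\<exists>C>0. \<exists>m0>0. \<forall>m\<ge>m0. \<forall>x\<in>{0..1}. \<forall>\<theta>.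
           cmod (\<phi>plus m (x, \<theta>)) \<le> C * (exp (- sqrt (\<mu> m) * x) + exp (- sqrt (\<mu> m) * (1 - x))) \<and>
           cmod (\<phi>minus m (x, \<theta>)) \<le> C * (exp (- sqrt (\<mu> m) * x) + exp (- sqrt (\<mu> m) * (1 - x)))"
      using \<phi>p \<phi>m
      by (intro exI[of _ "M * (sqrt p + sqrt q) + 1"] exI[of _ 1] conjI allI ballI impI) (blast | simp)+
  next
    assume "f 0 \<noteq> f 1"
    then have ne: "p \<noteq> q" unfolding p_def q_def using f01 by simp
    note R = roots_distinct_weights[OF s_pos pq ne \<kappa>]
    let ?c = "(p + q)\<^sup>2 / \<bar>p - q\<bar> * \<kappa>\<^sup>2"
    show "(\<lambda>m. lplus m - max (1 / sqrt (f 0)) (1 / sqrt (f 1)) * sqrt (\<mu> m))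
           \<in> O(\<lambda>m. sqrt (\<mu> m) * exp (- sqrt (\<mu> m)))"
      unfolding p_def[symmetric] q_def[symmetric]
      by (rule bigo_from_one[of _ "(p + q) * \<kappa> + ?c"]) (use R(1) lp \<mu>_nonneg in \<open>auto simp: s_def\<close>)
    show "(\<lambda>m. lminus m - min (1 / sqrt (f 0)) (1 / sqrt (f 1)) * sqrt (\<mu> m))
           \<in> O(\<lambda>m. sqrt (\<mu> m) * exp (- sqrt (\<mu> m)))"
      unfolding p_def[symmetric] q_def[symmetric]
      by (rule bigo_from_one[of _ "(p + q) * \<kappa> + ?c"]) (use R(2) lm \<mu>_nonneg in \<open>auto simp: s_def\<close>)
    show "(\<lambda>m. d m - \<bar>1 / sqrt (f 0) - 1 / sqrt (f 1)\<bar> * sqrt (\<mu> m))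
           \<in> O(\<lambda>m. sqrt (\<mu> m) * exp (- 2 * sqrt (\<mu> m)))"
      unfolding p_def[symmetric] q_def[symmetric]
      by (rule bigo_from_one[of _ ?c]) (use R(3) lm lp \<mu>_nonneg in \<open>auto simp: s_def d\<close>)
  next
    assume "f 0 < f 1"
    then have gt: "p > q" unfolding p_def q_def using f01 by (simp add: frac_less2)
    have sep: "s m * \<bar>p - q\<bar> \<le> \<bar>root_plus p q (s m) - s m * q * coth (s m)\<bar>"
      "s m * \<bar>p - q\<bar> \<le> \<bar>root_minus p q (s m) - s m * p * coth (s m)\<bar>" if "m \<ge> 1" for m
      using root_separation[OF s_pos[OF that] pq] gt by (simp_all add: min_def max_def)
    show "\<exists>C>0. \<exists>m0>0. \<forall>m\<ge>m0. \<forall>x\<in>{0..1}. \<forall>\<theta>.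
             cmod (\<phi>plus m (x, \<theta>)) \<le> C * (exp (- sqrt (\<mu> m) * x) + exp (- sqrt (\<mu> m) * (2 - x))) \<and>
             cmod (\<phi>minus m (x, \<theta>)) \<le> C * (exp (- sqrt (\<mu> m) * (1 + x)) + exp (- sqrt (\<mu> m) * (1 - x)))"
    proof (intro exI[of _ "CL + CR"] exI[of _ 1] conjI allI ballI impI)
      fix m :: nat and x :: real and \<theta> assume m: "1 \<le> m" and x: "x \<in> {0..1}"
      show "cmod (\<phi>plus m (x, \<theta>)) \<le> (CL + CR) * (exp (- sqrt (\<mu> m) * x) + exp (- sqrt (\<mu> m) * (2 - x)))"
        using left[OF _ m \<phi>p[OF m] sep(1)[OF m] x] gt
        by (intro order_trans[OF _ enlarge[of _ CL]]) (auto simp: CL_def)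
      show "cmod (\<phi>minus m (x, \<theta>)) \<le> (CL + CR) * (exp (- sqrt (\<mu> m) * (1 + x)) + exp (- sqrt (\<mu> m) * (1 - x)))"
        using right[OF _ m \<phi>m[OF m] sep(2)[OF m] x] gt
        by (intro order_trans[OF _ enlarge[of _ CR]]) (auto simp: CR_def)
    qed (use CLR in auto)
  next
    assume "f 0 > f 1"
    then have lt: "p < q" unfolding p_def q_def using f01 by (simp add: frac_less2)
    have sep: "s m * \<bar>p - q\<bar> \<le> \<bar>root_plus p q (s m) - s m * p * coth (s m)\<bar>"
      "s m * \<bar>p - q\<bar> \<le> \<bar>root_minus p q (s m) - s m * q * coth (s m)\<bar>" if "m \<ge> 1" for m
      using root_separation[OF s_pos[OF that] pq] lt by (simp_all add: min_def max_def)
    show "\<exists>C>0. \<exists>m0>0. \<forall>m\<ge>m0. \<forall>x\<in>{0..1}. \<forall>\<theta>.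
             cmod (\<phi>minus m (x, \<theta>)) \<le> C * (exp (- sqrt (\<mu> m) * x) + exp (- sqrt (\<mu> m) * (2 - x))) \<and>
             cmod (\<phi>plus m (x, \<theta>)) \<le> C * (exp (- sqrt (\<mu> m) * (1 + x)) + exp (- sqrt (\<mu> m) * (1 - x)))"
    proof (intro exI[of _ "CL + CR"] exI[of _ 1] conjI allI ballI impI)
      fix m :: nat and x :: real and \<theta> assume m: "1 \<le> m" and x: "x \<in> {0..1}"
      show "cmod (\<phi>minus m (x, \<theta>)) \<le> (CL + CR) * (exp (- sqrt (\<mu> m) * x) + exp (- sqrt (\<mu> m) * (2 - x)))"
        using left[OF _ m \<phi>m[OF m] sep(2)[OF m] x] lt
        by (intro order_trans[OF _ enlarge[of _ CL]]) (auto simp: CL_def)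
      show "cmod (\<phi>plus m (x, \<theta>)) \<le> (CL + CR) * (exp (- sqrt (\<mu> m) * (1 + x)) + exp (- sqrt (\<mu> m) * (1 - x)))"
        using right[OF _ m \<phi>p[OF m] sep(1)[OF m] x] lt
        by (intro order_trans[OF _ enlarge[of _ CR]]) (auto simp: CR_def)
    qed (use CLR in auto)
  qed
qed

end
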